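(* Let $i\in\mathbb Z$, let $S=\{k_1,\dots,k_n\}\subset\mathbb N$ be a finite (possibly empty) subset, and let $K,J\in\mathbb C$. (i) Let $K\neq 0$. Then the $\widehat{\mathfrak{sl}}_2$-module $M_S$ is irreducible, while the $\widehat{\mathfrak{sl}}_2$-module $M_{i,S}$ is irreducible if and only if $J-iK\notin\mathbb Z$. (ii) Let $K=0$. Then the $\widehat{\mathfrak{sl}}_2$-module $M_i$ is irreducible if and only if $J\notin\mathbb Z$.
   Context: The ground field is $\mathbb C$; $\mathbb N$ is the set of positive integers. $\widehat{\mathfrak{sl}}_2=(\mathfrak{sl}_2\otimes\mathbb C[t,t^{-1}])\oplus\mathbb Cc\oplus\mathbb Cd$ with bracket $[a\otimes t^m,b\otimes t^n]=[a,b]\otimes t^{m+n}+\delta_{m,-n}\,m\,(a,b)\,c$, $[d,a\otimes t^m]=m\,a\otimes t^m$, $c$ central, where $(a,b)=\mathrm{tr}(ab)$ is the trace form on $\mathfrak{sl}_2$. With $e,f,h$ the standard basis of $\mathfrak{sl}_2$, put $e_n=e\otimes t^n$, $f_n=f\otimes t^n$, $h_n=h\otimes t^n$ ($n\in\mathbb Z$). Let ${\bf x}=\{x_n\}_{n\in\mathbb Z}$, ${\bf y}=\{y_m\}_{m\in\mathbb N}$ be commuting variables, and $\partial x_n,\partial y_m$ the partial derivatives. For $T\subset\mathbb N$: ${\bf y}_T=\{y_m: m\in T\}$, $\widehat{\bf y}_T=\{y_m:m\in\mathbb N\setminus T\}$; $\widehat{\bf x}_i=\{x_n:n\neq i\}$.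 A superscript $\pm1$ indicates that Laurent polynomials in those variables are allowed. For $K,J\in\mathbb C$ the map $\Phi$ (first free field realization) sends $f_n\mapsto x_n$; $h_n\mapsto -2\sum_{m\in\mathbb Z}x_{m+n}\partial x_m+\delta_{n<0}\,y_{-n}+\delta_{n>0}\,2nK\,\partial y_n+\delta_{n,0}J$; $e_n\mapsto -\sum_{m,k\in\mathbb Z}x_{k+m+n}\partial x_k\partial x_m+\sum_{k>0}y_k\,\partial x_{-k-n}+2K\sum_{m>0}m\,\partial y_m\partial x_{m-n}+(Kn+J)\partial x_{-n}$; $d\mapsto\sum_{j\in\mathbb Z}j x_j\partial x_j-\sum_{j>0}j y_j\partial y_j$; $c\mapsto K$. These operators act (with finitely many nonzero terms on each element) on Laurent polynomials and give $\widehat{\mathfrak{sl}}_2$-module structures on the following spaces, for $S=\{k_1,\dots,k_n\}$: $N_S=\mathbb C[{\bf x},{\bf y}_S^{\pm1},\widehat{\bf y}_S]$, $\;I_S=\sum_{r=1}^n\mathbb C[{\bf x},{\bf y}_{S\setminus\{k_r\}}^{\pm1},\widehat{\bf y}_{S\setminus\{k_r\}}]$, $\;M_S=N_S/I_S$; $N_{i,S}=\mathbb C[x_i^{\pm1},{\bf y}_S^{\pm1},\widehat{\bf x}_i,\widehat{\bf y}_S]$, $\;I_{i,S}=\mathbb C[{\bf x},{\bf y}_S^{\pm1},\widehat{\bf y}_S]+\sum_{r=1}^n\mathbb C[x_i^{\pm1},{\bf y}_{S\setminus\{k_r\}}^{\pm1},\widehat{\bf x}_i,\widehat{\bf y}_{S\setminus\{k_r\}}]$,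 $\;M_{i,S}=N_{i,S}/I_{i,S}$. When $K=0$, the map $\Phi'$: $f_n\mapsto x_n$, $h_n\mapsto-2\sum_{m}x_{m+n}\partial x_m+\delta_{n,0}J$, $e_n\mapsto-\sum_{m,k}x_{k+m+n}\partial x_k\partial x_m+J\partial x_{-n}$, $d\mapsto\sum_j jx_j\partial x_j$, $c\mapsto0$ makes $M_i=\mathbb C[x_i^{\pm1},\widehat{\bf x}_i]/\mathbb C[{\bf x}]$ an $\widehat{\mathfrak{sl}}_2$-module. *)

theory Defs
  imports
    "HOL-Analysis.Determinants"
    "HOL-Library.Poly_Mapping"
    "HOL-Library.Set_Algebras"
    "HOL-Algebra.AbelCoset"
    "HOL-Algebra.Module"
    "HOL-Algebra.Algebraic_Closure_Type"
begin

section \<open>Modules over a Lie algebra\<close>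

text \<open>Vector spaces with explicit carriers are modules in the sense of HOL-Algebra over a field.
  The fields \<open>mult\<close> and \<open>one\<close>, which the record type inherits from rings, play no role.\<close>

record ('k, 'g) lie_alg = "('k, 'g) module" +
  bracket :: "'g \<Rightarrow> 'g \<Rightarrow> 'g"

record ('k, 'v, 'g) lie_mod = "('k, 'v) module" +
  act :: "'g \<Rightarrow> 'v \<Rightarrow> 'v"

locale lie_module = Module.module R V
  for R :: "('k, 'm) ring_scheme" and L :: "('k, 'g, 'n) lie_alg_scheme"
    and V :: "('k, 'v, 'g, 'o) lie_mod_scheme" +
  assumes act_closed:
      "\<lbrakk>x \<in> carrier L; v \<in> carrier V\<rbrakk> \<Longrightarrow> act V x v \<in> carrier V"
    and act_add_left:
      "\<lbrakk>x \<in> carrier L; y \<in> carrier L; v \<in> carrier V\<rbrakk>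
        \<Longrightarrow> act V (x \<oplus>\<^bsub>L\<^esub> y) v = act V x v \<oplus>\<^bsub>V\<^esub> act V y v"
    and act_smult_left:
      "\<lbrakk>a \<in> carrier R; x \<in> carrier L; v \<in> carrier V\<rbrakk>
        \<Longrightarrow> act V (a \<odot>\<^bsub>L\<^esub> x) v = a \<odot>\<^bsub>V\<^esub> act V x v"
    and act_add_right:
      "\<lbrakk>x \<in> carrier L; v \<in> carrier V; w \<in> carrier V\<rbrakk>
        \<Longrightarrow> act V x (v \<oplus>\<^bsub>V\<^esub> w) = act V x v \<oplus>\<^bsub>V\<^esub> act V x w"
    and act_smult_right:
      "\<lbrakk>a \<in> carrier R; x \<in> carrier L; v \<in> carrier V\<rbrakk>
        \<Longrightarrow> act V x (a \<odot>\<^bsub>V\<^esub> v) = a \<odot>\<^bsub>V\<^esub> act V x v"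
    and act_bracket:
      "\<lbrakk>x \<in> carrier L; y \<in> carrier L; v \<in> carrier V\<rbrakk>
        \<Longrightarrow> act V (bracket L x y) v = act V x (act V y v) \<ominus>\<^bsub>V\<^esub> act V y (act V x v)"

definition lie_submodule ::
  "'v set \<Rightarrow> ('k, 'm) ring_scheme \<Rightarrow> ('k, 'g, 'n) lie_alg_scheme
    \<Rightarrow> ('k, 'v, 'g, 'o) lie_mod_scheme \<Rightarrow> bool" where
  "lie_submodule W R L V \<longleftrightarrow>
     submodule W R V \<and> (\<forall>x \<in> carrier L. \<forall>w \<in> W. act V x w \<in> W)"

definition irreducible_lie_module ::
  "('k, 'm) ring_scheme \<Rightarrow> ('k, 'g, 'n) lie_alg_scheme
    \<Rightarrow> ('k, 'v, 'g, 'o) lie_mod_scheme \<Rightarrow> bool" where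
  "irreducible_lie_module R L V \<longleftrightarrow>
     lie_module R L V \<and> carrier V \<noteq> {\<zero>\<^bsub>V\<^esub>} \<and>
     (\<forall>W. lie_submodule W R L V \<longrightarrow> W = {\<zero>\<^bsub>V\<^esub>} \<or> W = carrier V)"

text \<open>For a Lie submodule \<open>I\<close> the result of acting on (or scaling) all elements of the coset \<open>I + v\<close>
  lies in one coset of \<open>I\<close>; adding \<open>I\<close> fills it up.\<close>

definition lie_quotient ::
  "('k, 'v, 'g) lie_mod \<Rightarrow> 'v set \<Rightarrow> ('k, 'v set, 'g) lie_mod" where
  "lie_quotient V I =
     \<lparr>carrier = a_rcosets\<^bsub>V\<^esub> I, monoid.mult = undefined, one = undefined, ring.zero = I, ring.add = set_add V,
      module.smult = (\<lambda>a A. (module.smult V a ` A) <+>\<^bsub>V\<^esub> I),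
      act = (\<lambda>x A. (act V x ` A) <+>\<^bsub>V\<^esub> I)\<rparr>"

section \<open>The affine Lie algebra\<close>

abbreviation CC :: "complex ring" where
  "CC \<equiv> ring_of_type_algebra"

text \<open>The triple \<open>(a, p, q)\<close> stands for \<open>(\<Sum>m. a\<^sub>m \<otimes> t\<^sup>m) + p c + q d\<close>, where \<open>a\<^sub>m = lookup a m\<close>.\<close>

type_synonym affine = "(int \<Rightarrow>\<^sub>0 complex^2^2) \<times> complex \<times> complex"

definition mscale :: "complex \<Rightarrow> complex^2^2 \<Rightarrow> complex^2^2" where
  "mscale c A = (\<chi> i j. c * A $ i $ j)"

fun affine_smult :: "complex \<Rightarrow> affine \<Rightarrow> affine" where
  "affine_smult c (a, p, q) = (Poly_Mapping.map (mscale c) a, c * p, c * q)"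

definition loop_deriv :: "(int \<Rightarrow>\<^sub>0 complex^2^2) \<Rightarrow> (int \<Rightarrow>\<^sub>0 complex^2^2)" where
  "loop_deriv a = (\<Sum>m \<in> Poly_Mapping.keys a.
     Poly_Mapping.single m (mscale (of_int m) (Poly_Mapping.lookup a m)))"

definition loop_bracket ::
  "(int \<Rightarrow>\<^sub>0 complex^2^2) \<Rightarrow> (int \<Rightarrow>\<^sub>0 complex^2^2) \<Rightarrow> (int \<Rightarrow>\<^sub>0 complex^2^2)" where
  "loop_bracket a b = (\<Sum>m \<in> Poly_Mapping.keys a. \<Sum>n \<in> Poly_Mapping.keys b.
     Poly_Mapping.single (m + n)
       (Poly_Mapping.lookup a m ** Poly_Mapping.lookup b n
        - Poly_Mapping.lookup b n ** Poly_Mapping.lookup a m))"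

definition loop_cocycle ::
  "(int \<Rightarrow>\<^sub>0 complex^2^2) \<Rightarrow> (int \<Rightarrow>\<^sub>0 complex^2^2) \<Rightarrow> complex" where
  "loop_cocycle a b = (\<Sum>m \<in> Poly_Mapping.keys a. \<Sum>n \<in> Poly_Mapping.keys b.
     (of_int m * trace (Poly_Mapping.lookup a m ** Poly_Mapping.lookup b n) when m = - n))"

fun affine_bracket :: "affine \<Rightarrow> affine \<Rightarrow> affine" where
  "affine_bracket (a, p, q) (b, r, s) =
     (loop_bracket a b + Poly_Mapping.map (mscale q) (loop_deriv b)
        - Poly_Mapping.map (mscale s) (loop_deriv a),
      loop_cocycle a b, 0)"

definition affine_sl2 :: "(complex, affine) lie_alg" where
  "affine_sl2 =
     \<lparr>carrier = {(a, p, q). \<forall>m. trace (Poly_Mapping.lookup a m) = 0},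
      monoid.mult = undefined, one = undefined, ring.zero = 0, ring.add = (+),
      module.smult = affine_smult, bracket = affine_bracket\<rparr>"

section \<open>Laurent polynomials in infinitely many variables\<close>

text \<open>Only the variables \<open>Yv m\<close> with \<open>m > 0\<close> occur in the spaces below.\<close>

datatype var = Xv int | Yv nat

text \<open>The group algebra of the free abelian group on the variables: exponent vectors are finitely
  supported functions \<open>var \<Rightarrow>\<^sub>0 int\<close>.\<close>

type_synonym laurent = "(var \<Rightarrow>\<^sub>0 int) \<Rightarrow>\<^sub>0 complex"

definition const :: "complex \<Rightarrow> laurent" where
  "const c = Poly_Mapping.single 0 c"

definition gen :: "var \<Rightarrow> laurent" where
  "gen v = Poly_Mapping.single (Poly_Mapping.single v 1) 1"

definition pdiff :: "var \<Rightarrow> laurent \<Rightarrow> laurent" where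
  "pdiff v p = (\<Sum>\<nu> \<in> Poly_Mapping.keys p.
     Poly_Mapping.single (\<nu> - Poly_Mapping.single v 1)
       (of_int (Poly_Mapping.lookup \<nu> v) * Poly_Mapping.lookup p \<nu>))"

text \<open>\<open>laurent_polys A B\<close> is the space of polynomials in the variables from \<open>A \<union> B\<close> in which those
  from \<open>B\<close> may also occur with negative exponents.\<close>

definition laurent_polys :: "var set \<Rightarrow> var set \<Rightarrow> laurent set" where
  "laurent_polys A B = {p. \<forall>\<nu> \<in> Poly_Mapping.keys p. \<forall>v.
     Poly_Mapping.lookup \<nu> v \<noteq> 0 \<longrightarrow> v \<in> B \<or> (v \<in> A \<and> 0 \<le> Poly_Mapping.lookup \<nu> v)}"

section \<open>The free field realizations\<close>

text \<open>The infinite sums below are \<^const>\<open>Sum_any\<close>: on every Laurent polynomial only finitely many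
  terms are nonzero.\<close>

definition f_op :: "int \<Rightarrow> laurent \<Rightarrow> laurent" where
  "f_op n p = gen (Xv n) * p"

definition h_op :: "complex \<Rightarrow> complex \<Rightarrow> int \<Rightarrow> laurent \<Rightarrow> laurent" where
  "h_op K J n p =
     - const 2 * Sum_any (\<lambda>m. gen (Xv (m + n)) * pdiff (Xv m) p)
     + (gen (Yv (nat (- n))) * p when n < 0)
     + (const (2 * of_int n * K) * pdiff (Yv (nat n)) p when n > 0)
     + (const J * p when n = 0)"

definition e_op :: "complex \<Rightarrow> complex \<Rightarrow> int \<Rightarrow> laurent \<Rightarrow> laurent" where
  "e_op K J n p =
     - Sum_any (\<lambda>m. Sum_any (\<lambda>k. gen (Xv (k + m + n)) * pdiff (Xv k) (pdiff (Xv m) p)))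
     + Sum_any (\<lambda>k. gen (Yv k) * pdiff (Xv (- int k - n)) p when k > 0)
     + const (2 * K) *
         Sum_any (\<lambda>m. const (of_nat m) * pdiff (Yv m) (pdiff (Xv (int m - n)) p) when m > 0)
     + const (K * of_int n + J) * pdiff (Xv (- n)) p"

definition d_op :: "laurent \<Rightarrow> laurent" where
  "d_op p =
     Sum_any (\<lambda>j. const (of_int j) * gen (Xv j) * pdiff (Xv j) p)
     - Sum_any (\<lambda>j. const (of_nat j) * gen (Yv j) * pdiff (Yv j) p when j > 0)"

definition h_op' :: "complex \<Rightarrow> int \<Rightarrow> laurent \<Rightarrow> laurent" where
  "h_op' J n p =
     - const 2 * Sum_any (\<lambda>m. gen (Xv (m + n)) * pdiff (Xv m) p) + (const J * p when n = 0)"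

definition e_op' :: "complex \<Rightarrow> int \<Rightarrow> laurent \<Rightarrow> laurent" where
  "e_op' J n p =
     - Sum_any (\<lambda>m. Sum_any (\<lambda>k. gen (Xv (k + m + n)) * pdiff (Xv k) (pdiff (Xv m) p)))
     + const J * pdiff (Xv (- n)) p"

definition d_op' :: "laurent \<Rightarrow> laurent" where
  "d_op' p = Sum_any (\<lambda>j. const (of_int j) * gen (Xv j) * pdiff (Xv j) p)"

text \<open>The linear map on the affine Lie algebra with prescribed images of \<open>e\<^sub>n\<close>, \<open>f\<^sub>n\<close>, \<open>h\<^sub>n\<close>, \<open>c\<close>, \<open>d\<close>:
  a traceless matrix \<open>A\<close> equals \<open>A\<^sub>1\<^sub>2 e + A\<^sub>2\<^sub>1 f + A\<^sub>1\<^sub>1 h\<close>.\<close>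

fun lin_ext ::
  "(int \<Rightarrow> laurent \<Rightarrow> laurent) \<Rightarrow> (int \<Rightarrow> laurent \<Rightarrow> laurent) \<Rightarrow> (int \<Rightarrow> laurent \<Rightarrow> laurent)
    \<Rightarrow> (laurent \<Rightarrow> laurent) \<Rightarrow> (laurent \<Rightarrow> laurent) \<Rightarrow> affine \<Rightarrow> laurent \<Rightarrow> laurent" where
  "lin_ext E F H C D (a, p, q) v =
     (\<Sum>n \<in> Poly_Mapping.keys a.
        const (Poly_Mapping.lookup a n $ 1 $ 2) * E n v
        + const (Poly_Mapping.lookup a n $ 2 $ 1) * F n v
        + const (Poly_Mapping.lookup a n $ 1 $ 1) * H n v)
     + const p * C v + const q * D v"

definition Phi :: "complex \<Rightarrow> complex \<Rightarrow> affine \<Rightarrow> laurent \<Rightarrow> laurent" where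
  "Phi K J = lin_ext (e_op K J) f_op (h_op K J) (\<lambda>v. const K * v) d_op"

definition Phi' :: "complex \<Rightarrow> affine \<Rightarrow> laurent \<Rightarrow> laurent" where
  "Phi' J = lin_ext (e_op' J) f_op (h_op' J) (\<lambda>v. 0) d_op'"

definition laurent_module ::
  "laurent set \<Rightarrow> (affine \<Rightarrow> laurent \<Rightarrow> laurent) \<Rightarrow> (complex, laurent, affine) lie_mod" where
  "laurent_module N \<rho> =
     \<lparr>carrier = N, monoid.mult = (*), one = 1, ring.zero = 0, ring.add = (+),
      module.smult = (\<lambda>c p. const c * p), act = \<rho>\<rparr>"

section \<open>The modules\<close>

abbreviation xs :: "var set" where
  "xs \<equiv> range Xv"

abbreviation xs_hat :: "int \<Rightarrow> var set" where
  "xs_hat i \<equiv> Xv ` (- {i})"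

abbreviation ys :: "nat set \<Rightarrow> var set" where
  "ys T \<equiv> Yv ` T"

abbreviation ys_hat :: "nat set \<Rightarrow> var set" where
  "ys_hat T \<equiv> Yv ` ({0<..} - T)"

definition N_S :: "nat set \<Rightarrow> laurent set" where
  "N_S S = laurent_polys (xs \<union> ys_hat S) (ys S)"

definition I_S :: "nat set \<Rightarrow> laurent set" where
  "I_S S = (\<Sum>k\<in>S. laurent_polys (xs \<union> ys_hat (S - {k})) (ys (S - {k})))"

definition M_S :: "complex \<Rightarrow> complex \<Rightarrow> nat set \<Rightarrow> (complex, laurent set, affine) lie_mod" where
  "M_S K J S = lie_quotient (laurent_module (N_S S) (Phi K J)) (I_S S)"

definition N_iS :: "int \<Rightarrow> nat set \<Rightarrow> laurent set" where
  "N_iS i S = laurent_polys (xs_hat i \<union> ys_hat S) ({Xv i} \<union> ys S)"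

definition I_iS :: "int \<Rightarrow> nat set \<Rightarrow> laurent set" where
  "I_iS i S =
     laurent_polys (xs \<union> ys_hat S) (ys S)
     + (\<Sum>k\<in>S. laurent_polys (xs_hat i \<union> ys_hat (S - {k})) ({Xv i} \<union> ys (S - {k})))"

definition M_iS ::
  "complex \<Rightarrow> complex \<Rightarrow> int \<Rightarrow> nat set \<Rightarrow> (complex, laurent set, affine) lie_mod" where
  "M_iS K J i S = lie_quotient (laurent_module (N_iS i S) (Phi K J)) (I_iS i S)"

definition M_i :: "complex \<Rightarrow> int \<Rightarrow> (complex, laurent set, affine) lie_mod" where
  "M_i J i = lie_quotient (laurent_module (laurent_polys (xs_hat i) {Xv i}) (Phi' J))
     (laurent_polys xs {})"

end

theory Submission
  imports Defs
begin

text \<open>Each of the modules is \<open>N / I\<close> with \<open>N\<close> and \<open>I\<close> spanned by monomials: for a finite set \<open>P\<close> of polar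
  variables the monomials outside \<open>I\<close> are those with negative exponents exactly on \<open>P\<close>, so a submodule
  is an invariant space \<open>W\<close> between \<open>I\<close> and \<open>N\<close>. If some \<open>v \<in> W - I\<close> involves no \<open>x\<close>-variable beyond a
  factor \<open>x\<^sub>i\<inverse>\<close>, then the Heisenberg algebra, the \<open>f\<^sub>n\<close> and \<open>e\<^sub>-\<^sub>i\<close> generate everything from \<open>v\<close>. To get such a \<open>v\<close>
  one lowers the degree in \<open>x\<close>.

  Without a polar \<open>x\<close>-variable \<open>e\<^sub>n\<close> with \<open>n\<close> very negative does this: its coefficient at a fresh variable
  \<open>y\<^sub>-\<^sub>n\<^sub>-\<^sub>j\<close> is \<open>\<partial>v / \<partial>x\<^sub>j\<close>. With the polar variable \<open>x\<^sub>i\<close> let \<open>e = e\<^sub>-\<^sub>i\<close>, which with \<open>f\<^sub>i\<close> spans a copy of \<open>sl\<^sub>2\<close>. If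
  \<open>x\<^sub>i v = 0\<close> and \<open>v\<close> has weight \<open>\<lambda>\<close>, then \<open>\<lambda>(\<lambda> + 1) e\<^sub>n v - (\<lambda> + 1) h\<^sub>n\<^sub>+\<^sub>i e v - f\<^sub>n\<^sub>+\<^sub>2\<^sub>i e\<^sup>2 v\<close> is again annihilated by \<open>x\<^sub>i\<close>.
  For \<open>K \<noteq> 0\<close> its coefficient at a fresh \<open>y\<close> is \<open>\<lambda>(\<lambda> + 1) \<partial>v / \<partial>x\<^sub>j\<close>; for \<open>K = 0\<close>, if it vanishes for all \<open>n \<noteq> -i\<close>, then
  comparing coefficients at fresh \<open>x\<close>-variables shows \<open>e v = \<lambda> \<partial>v / \<partial>x\<^sub>i\<close>, and it equals \<open>\<lambda>(\<lambda> + 1) J \<partial>v / \<partial>x\<^sub>-\<^sub>n\<close>.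
  Here \<open>\<lambda>\<close> differs from \<open>J - iK\<close> by an integer, so these factors are nonzero when \<open>J - iK\<close> is not an integer.

  If \<open>J - iK\<close> is an integer, the vectors annihilated by a power of \<open>e\<close> form a submodule. It is proper
  because \<open>e\<close> multiplies \<open>x\<^sub>i\<^sup>-\<^sup>r\<close> by a nonzero multiple of \<open>x\<^sub>i\<inverse>\<close> for large \<open>r\<close>, and nonzero because
  there is an \<open>sl\<^sub>2\<close>-singular vector \<open>\<Sum>\<^sub>n c\<^sub>n x\<^sub>i\<^sup>n\<^sup>-\<^sup>r e\<^sup>n(x\<^sub>j\<^sup>s)\<close> with suitable \<open>s \<le> r\<close>.\<close>

section \<open>Laurent polynomials and linear operators\<close>

abbreviation lk where "lk \<equiv> Poly_Mapping.lookup"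
abbreviation kys where "kys \<equiv> Poly_Mapping.keys"
abbreviation sgl where "sgl \<equiv> Poly_Mapping.single"

abbreviation monom :: "(var \<Rightarrow>\<^sub>0 int) \<Rightarrow> laurent" where
  "monom \<nu> \<equiv> sgl \<nu> 1"

lemma const_0 [simp]: "const 0 = 0" by (simp add: const_def)
lemma const_1 [simp]: "const 1 = 1" by (simp add: const_def)
lemma const_add: "const (a + b) = const a + const b" by (simp add: const_def single_add)
lemma const_mult: "const (a * b) = const a * const b" by (simp add: const_def mult_single)
lemma const_minus: "const (- a) = - const a" by (simp add: const_def single_uminus)
lemma const_diff: "const (a - b) = const a - const b" by (simp add: const_def single_diff)
lemma const_numeral [simp]: "const (numeral n) = numeral n" by (simp add: const_def)
lemmas const_arith = const_add const_mult const_minus const_diff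

lemma const_mult_single: "const c * sgl \<nu> d = sgl \<nu> (c * d)"
  by (simp add: const_def mult_single)

lemma lookup_const_mult [simp]: "lk (const c * p) \<nu> = c * lk p \<nu>"
proof -
  have "const c * p = Poly_Mapping.map ((*) c) p"
    by (simp add: const_def mult_map_scale_conv_mult)
  then show ?thesis by (simp add: Poly_Mapping.map.rep_eq when_def)
qed

lemma const_inverse_mult: "c \<noteq> 0 \<Longrightarrow> const (inverse c) * (const c * p) = p"
  by (simp flip: mult.assoc const_mult)

lemma laurent_expansion: "(p :: laurent) = (\<Sum>\<nu>\<in>kys p. const (lk p \<nu>) * monom \<nu>)"
  by (rule poly_mapping_eqI)
    (auto simp: lookup_sum lookup_single when_def in_keys_iff if_distrib sum.delta cong: if_cong)

section \<open>Complex-linear operators and how to compare them\<close>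

definition lin_op :: "(laurent \<Rightarrow> laurent) \<Rightarrow> bool" where
  "lin_op T \<longleftrightarrow> (\<forall>p q. T (p + q) = T p + T q) \<and> (\<forall>c p. T (const c * p) = const c * T p)"

lemma lin_op_add: "lin_op T \<Longrightarrow> T (p + q) = T p + T q" by (simp add: lin_op_def)
lemma lin_op_const: "lin_op T \<Longrightarrow> T (const c * p) = const c * T p" by (simp add: lin_op_def)
lemma lin_op_0: "lin_op T \<Longrightarrow> T 0 = 0" using lin_op_const[of T 0 0] by simp
lemma lin_op_minus: "lin_op T \<Longrightarrow> T (- p) = - T p"
  using lin_op_const[of T "-1" p] by (simp add: const_minus)
lemma lin_op_diff: "lin_op T \<Longrightarrow> T (p - q) = T p - T q"
  using lin_op_add[of T p "- q"] by (simp add: lin_op_minus)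
lemma lin_op_numeral: "lin_op T \<Longrightarrow> T (numeral n * p) = numeral n * T p"
  using lin_op_const[of T "numeral n" p] by simp
lemma lin_op_sum: "lin_op T \<Longrightarrow> T (sum f A) = (\<Sum>x\<in>A. T (f x))"
  by (induction A rule: infinite_finite_induct) (simp_all add: lin_op_0 lin_op_add)
lemma lin_op_const_1: "lin_op T \<Longrightarrow> T (const c) = const c * T 1"
  using lin_op_const[of T c 1] by simp
lemmas lin_op_simps = lin_op_const_1 lin_op_add lin_op_const lin_op_0 lin_op_minus lin_op_diff lin_op_numeral

lemma lin_op_id: "lin_op (\<lambda>p. p)" by (simp add: lin_op_def)
lemma lin_op_zero: "lin_op (\<lambda>p. 0)" by (simp add: lin_op_def)
lemma lin_op_plus: "lin_op S \<Longrightarrow> lin_op T \<Longrightarrow> lin_op (\<lambda>p. S p + T p)" by (simp add: lin_op_def algebra_simps)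
lemma lin_op_minusI: "lin_op T \<Longrightarrow> lin_op (\<lambda>p. - T p)" by (simp add: lin_op_def algebra_simps)
lemma lin_op_diffI: "lin_op S \<Longrightarrow> lin_op T \<Longrightarrow> lin_op (\<lambda>p. S p - T p)" by (simp add: lin_op_def algebra_simps)
lemma lin_op_mult: "lin_op T \<Longrightarrow> lin_op (\<lambda>p. r * T p)" by (simp add: lin_op_def algebra_simps)
lemma lin_op_comp: "lin_op S \<Longrightarrow> lin_op T \<Longrightarrow> lin_op (\<lambda>p. S (T p))" by (simp add: lin_op_def)
lemma lin_op_when: "lin_op T \<Longrightarrow> lin_op (\<lambda>p. T p when b)" by (cases b) (simp_all add: lin_op_zero)
lemma lin_op_Sum_anyI:
  assumes "\<And>x. lin_op (T x)" "\<And>p. finite {x. T x p \<noteq> 0}"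
  shows "lin_op (\<lambda>p. Sum_any (\<lambda>x. T x p))"
  unfolding lin_op_def
proof safe
  fix p q show "(\<Sum>x. T x (p + q)) = (\<Sum>x. T x p) + (\<Sum>x. T x q)"
    by (simp add: lin_op_add[OF assms(1)] Sum_any.distrib assms(2))
next
  fix c p show "(\<Sum>x. T x (const c * p)) = const c * (\<Sum>x. T x p)"
    by (simp add: lin_op_const[OF assms(1)] Sum_any_right_distrib assms(2))
qed
lemmas lin_op_intros = lin_op_id lin_op_zero lin_op_plus lin_op_minusI lin_op_diffI lin_op_mult lin_op_when

lemma lin_op_eqI:
  assumes "lin_op S" "lin_op T" "\<And>\<nu>. S (monom \<nu>) = T (monom \<nu>)"
  shows "S p = T p"
proof -
  have "S (\<Sum>\<nu>\<in>kys p. const (lk p \<nu>) * monom \<nu>) = T (\<Sum>\<nu>\<in>kys p. const (lk p \<nu>) * monom \<nu>)"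
    by (simp add: lin_op_sum lin_op_const assms)
  then show ?thesis using laurent_expansion[of p] by simp
qed

lemma gen_mult_monom [simp]: "gen v * sgl \<nu> c = sgl (\<nu> + sgl v 1) c"
  by (simp add: gen_def mult_single add.commute)

text \<open>A linear operator that commutes with the variables also commutes with their inverses, so it
  is multiplication by its value at 1.\<close>

lemma lin_op_eq_0I:
  assumes T: "lin_op T" and c: "\<And>v p. T (gen v * p) = gen v * T p" and 1: "T 1 = 0"
  shows "T p = 0"
proof -
  have inv: "monom (- sgl v 1) * (gen v * q) = q" for v q
    by (simp add: gen_def mult_single flip: mult.assoc)
  have step: "T (monom (\<nu> + sgl v 1)) = 0 \<longleftrightarrow> T (monom \<nu>) = 0" for v \<nu>
    using c[of v "monom \<nu>"] inv[of v "T (monom \<nu>)"] by auto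
  have nat_step: "T (monom (\<nu> + sgl v (int k))) = 0 \<longleftrightarrow> T (monom \<nu>) = 0" for v k \<nu>
  proof (induction k)
    case (Suc k)
    have "\<nu> + sgl v (int (Suc k)) = (\<nu> + sgl v (int k)) + sgl v 1"
      by (simp add: add.assoc add.commute[of 1] flip: single_add)
    then show ?case using step[of "\<nu> + sgl v (int k)" v] Suc by (simp only:)
  qed simp
  have int_step: "T (monom (\<nu> + sgl v k)) = 0 \<longleftrightarrow> T (monom \<nu>) = 0" for v k \<nu>
  proof (cases "k \<ge> 0")
    case True then show ?thesis using nat_step[of \<nu> v "nat k"] by simp
  next
    case False
    then have "(\<nu> + sgl v k) + sgl v (int (nat (- k))) = \<nu>"
      by (simp add: add.assoc flip: single_add)
    then show ?thesis using nat_step[of "\<nu> + sgl v k" v "nat (- k)"] by (simp only:)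
  qed
  have "T (monom (\<Sum>v\<in>A. sgl v (f v))) = 0" if "finite A" for A f
    using that
  proof induction
    case empty then show ?case using 1 by simp
  next
    case (insert v A)
    then show ?case using int_step[of "\<Sum>v\<in>A. sgl v (f v)" v "f v"] by (simp add: add.commute)
  qed
  moreover have "\<nu> = (\<Sum>v\<in>kys \<nu>. sgl v (lk \<nu> v))" for \<nu> :: "var \<Rightarrow>\<^sub>0 int"
    by (rule poly_mapping_eqI)
      (auto simp: lookup_sum lookup_single when_def in_keys_iff if_distrib sum.delta cong: if_cong)
  ultimately have "T (monom \<nu>) = 0" for \<nu>
    by (metis finite_keys)
  then show ?thesis using lin_op_eqI[OF T lin_op_zero] by simp
qed

text \<open>Apply the previous lemma to the difference, which commutes with every variable exactly
  when \<open>S\<close> and \<open>T\<close> have equal commutators with it. A relation between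
  differential operators is thus reduced to relations of lower order and to the value at
  \<open>1\<close>; the commutators of \<open>E\<close>, \<open>H\<close> and \<open>D\<close> are
  computed this way.\<close>

lemma lin_op_eq_by_gens:
  assumes "lin_op S" "lin_op T" "S 1 = T 1"
    and "\<And>v p. S (gen v * p) - gen v * S p = T (gen v * p) - gen v * T p"
  shows "S p = T p"
  using lin_op_eq_0I[of "\<lambda>p. S p - T p" p] assms by (simp add: lin_op_diffI algebra_simps)

section \<open>Partial derivatives\<close>

lemma pdiff_superset:
  assumes "finite A" "kys p \<subseteq> A"
  shows "pdiff v p = (\<Sum>\<nu>\<in>A. sgl (\<nu> - sgl v 1) (of_int (lk \<nu> v) * lk p \<nu>))"
  unfolding pdiff_def
  by (rule sum.mono_neutral_left[OF assms]) (auto simp: in_keys_iff)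

lemma lin_op_pdiff: "lin_op (pdiff v)"
  unfolding lin_op_def
proof safe
  fix p q
  have "pdiff v (p + q) = (\<Sum>\<nu>\<in>kys p \<union> kys q. sgl (\<nu> - sgl v 1) (of_int (lk \<nu> v) * lk (p + q) \<nu>))"
    by (rule pdiff_superset) (auto simp: Poly_Mapping.keys_add)
  then show "pdiff v (p + q) = pdiff v p + pdiff v q"
    using pdiff_superset[of "kys p \<union> kys q" p v] pdiff_superset[of "kys p \<union> kys q" q v]
    by (simp add: lookup_add distrib_left single_add sum.distrib)
next
  fix c p
  have "pdiff v (const c * p) = (\<Sum>\<nu>\<in>kys p. sgl (\<nu> - sgl v 1) (of_int (lk \<nu> v) * lk (const c * p) \<nu>))"
    by (rule pdiff_superset) (auto simp: in_keys_iff)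
  then show "pdiff v (const c * p) = const c * pdiff v p"
    unfolding pdiff_def
    by (simp add: sum_distrib_left const_mult_single mult.left_commute)
qed

lemmas lin_op_pdiff_comp = lin_op_comp[OF lin_op_pdiff]

lemma pdiff_single [simp]: "pdiff v (sgl \<nu> c) = sgl (\<nu> - sgl v 1) (of_int (lk \<nu> v) * c)"
  by (subst pdiff_superset[of "{\<nu>}"]) auto

lemma pdiff_1 [simp]: "pdiff v 1 = 0"
  using pdiff_single[of v 0 1] by simp

lemma pdiff_gen_mult:
  "pdiff v (gen w * p) = gen w * pdiff v p + (p when v = w)"
proof (rule lin_op_eqI[of "\<lambda>p. pdiff v (gen w * p)" "\<lambda>p. gen w * pdiff v p + (p when v = w)"])
  fix \<nu> :: "var \<Rightarrow>\<^sub>0 int"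
  have e: "\<nu> + sgl w 1 - sgl v 1 = \<nu> - sgl v 1 + sgl w 1" by (simp only: diff_conv_add_uminus add_ac)
  show "pdiff v (gen w * monom \<nu>) = gen w * pdiff v (monom \<nu>) + (monom \<nu> when v = w)"
    by (auto simp: when_def lookup_add e single_add lookup_single)
qed (intro lin_op_intros lin_op_pdiff_comp)+

lemma pdiff_commute: "pdiff v (pdiff w p) = pdiff w (pdiff v p)"
proof (rule lin_op_eqI[of "\<lambda>p. pdiff v (pdiff w p)" "\<lambda>p. pdiff w (pdiff v p)"])
  fix \<nu> show "pdiff v (pdiff w (monom \<nu>)) = pdiff w (pdiff v (monom \<nu>))"
    by (cases "v = w") (auto simp: lookup_minus lookup_single algebra_simps)
qed (intro lin_op_intros lin_op_pdiff_comp)+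

lemma pdiff_0 [simp]: "pdiff v 0 = 0" by (rule lin_op_0[OF lin_op_pdiff])
lemmas pdiff_simps = lin_op_simps[OF lin_op_pdiff]

text \<open>A finite set, so a variable outside it always exists. Such fresh variables isolate
  single terms of an operator in the irreducibility proofs.\<close>

definition laurent_vars :: "laurent \<Rightarrow> var set" where
  "laurent_vars p = (\<Union>\<nu>\<in>kys p. kys \<nu>)"

lemma finite_laurent_vars: "finite (laurent_vars p)" by (simp add: laurent_vars_def)

lemma pdiff_eq_0: "v \<notin> laurent_vars p \<Longrightarrow> pdiff v p = 0"
  unfolding pdiff_def laurent_vars_def by (rule sum.neutral) (auto simp: in_keys_iff)

lemma finite_pdiff: "inj f \<Longrightarrow> finite {m. pdiff (f m) p \<noteq> 0}"
proof (rule finite_subset[of _ "f -` laurent_vars p"])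
  show "{m. pdiff (f m) p \<noteq> 0} \<subseteq> f -` laurent_vars p" using pdiff_eq_0 by auto
  show "inj f \<Longrightarrow> finite (f -` laurent_vars p)" by (rule finite_vimageI[OF finite_laurent_vars])
qed

lemma lookup_gen_mult [simp]: "lk (gen v * p) \<nu> = lk p (\<nu> - sgl v 1)"
proof -
  have "gen v * p = (\<Sum>\<mu>\<in>kys p. const (lk p \<mu>) * monom (\<mu> + sgl v 1))"
    by (subst laurent_expansion[of p]) (simp add: sum_distrib_left mult.left_commute[of "gen v"])
  also have "lk \<dots> \<nu> = (\<Sum>\<mu>\<in>kys p. if \<mu> = \<nu> - sgl v 1 then lk p \<mu> else 0)"
    unfolding lookup_sum
    by (rule sum.cong) (auto simp: lookup_single when_def algebra_simps)
  finally show ?thesis by (simp add: sum.delta in_keys_iff)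
qed

lemma lookup_pdiff: "lk (pdiff v p) \<nu> = of_int (lk \<nu> v + 1) * lk p (\<nu> + sgl v 1)"
proof -
  have "lk (pdiff v p) \<nu> = (\<Sum>\<mu>\<in>kys p. if \<mu> = \<nu> + sgl v 1 then of_int (lk \<mu> v) * lk p \<mu> else 0)"
    unfolding pdiff_def lookup_sum
    by (rule sum.cong) (auto simp: lookup_single when_def algebra_simps)
  then show ?thesis by (simp add: sum.delta in_keys_iff lookup_add)
qed

section \<open>The commutation relations\<close>

text \<open>Common shape of the infinite sums in the realizations. The derivative acts first, so for
  injective \<open>U\<close> only finitely many terms survive on a given \<open>p\<close>, and
  commutators with a variable can be computed once for all sums.\<close>

definition diff_sum :: "('i \<Rightarrow> var) \<Rightarrow> ('i \<Rightarrow> laurent \<Rightarrow> laurent) \<Rightarrow> laurent \<Rightarrow> laurent" where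
  "diff_sum U F p = Sum_any (\<lambda>m. F m (pdiff (U m) p))"

lemma finite_diff_sum:
  assumes "inj U" "\<And>m. lin_op (F m)"
  shows "finite {m. F m (pdiff (U m) p) \<noteq> 0}"
  by (rule finite_subset[OF _ finite_pdiff[OF assms(1), of p]]) (auto simp: lin_op_0[OF assms(2)])

lemma lin_op_diff_sum:
  assumes "inj U" "\<And>m. lin_op (F m)"
  shows "lin_op (diff_sum U F)"
  unfolding diff_sum_def by (intro lin_op_Sum_anyI lin_op_comp[OF assms(2)] lin_op_pdiff finite_diff_sum assms)

lemma diff_sum_1: "(\<And>m. lin_op (F m)) \<Longrightarrow> diff_sum U F 1 = 0"
  by (simp add: diff_sum_def lin_op_0)

text \<open>\<open>G m\<close> is the commutator of \<open>F m\<close> with the variable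
  \<open>w\<close>. By the product rule the commutator of the sum has a part from the coefficients,
  \<open>diff_sum U G\<close>, and a part from the derivatives, which picks out the index with
  \<open>U m = w\<close>.\<close>

lemma diff_sum_gen:
  assumes U: "inj U" and F: "\<And>m. lin_op (F m)" and G: "\<And>m. lin_op (G m)"
    and FG: "\<And>m q. F m (gen w * q) = gen w * F m q + G m q"
  shows "diff_sum U F (gen w * p) = gen w * diff_sum U F p + diff_sum U G p + Sum_any (\<lambda>m. F m p when U m = w)"
proof -
  note fF = finite_diff_sum[of U F, OF U F] and fG = finite_diff_sum[of U G, OF U G]
  have f1: "finite {m. (F m p when U m = w) \<noteq> 0}"
    by (rule finite_subset[OF _ finite_vimageI[of "{w}", OF _ U]]) auto
  have f2: "finite {m. gen w * F m (pdiff (U m) p) \<noteq> 0}"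
    by (rule finite_subset[OF _ fF[of p]]) auto
  have f3: "finite {m. gen w * F m (pdiff (U m) p) + G m (pdiff (U m) p) \<noteq> 0}"
    by (rule finite_subset[OF _ finite_UnI[OF f2 fG]]) auto
  have "F m (pdiff (U m) (gen w * p))
      = gen w * F m (pdiff (U m) p) + G m (pdiff (U m) p) + (F m p when U m = w)" for m
    by (cases "U m = w") (simp_all add: pdiff_gen_mult lin_op_add[OF F] FG)
  then show ?thesis
    by (simp only: diff_sum_def Sum_any.distrib[OF f3 f1] Sum_any.distrib[OF f2 fG] Sum_any_right_distrib[OF fF])
qed

lemma Sum_any_when_inj: "inj U \<Longrightarrow> Sum_any (\<lambda>m. F m p when U m = U k) = F k (p :: laurent)"
  by (simp add: inj_eq)

lemma Sum_any_when_not_range: "w \<notin> range U \<Longrightarrow> Sum_any (\<lambda>m. F m p when U m = w) = (0 :: laurent)"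
proof -
  assume "w \<notin> range U"
  then have "(F m p when U m = w) = 0" for m by (auto simp: when_def)
  then show ?thesis by simp
qed

lemma inj_Xv [simp]: "inj Xv" by (simp add: inj_def)
lemma inj_Yv [simp]: "inj Yv" by (simp add: inj_def)

section \<open>The components of the free field operators and their commutators with the
  variables\<close>

definition deriv_x :: "int \<Rightarrow> laurent \<Rightarrow> laurent" where
  "deriv_x n = diff_sum Xv (\<lambda>m q. gen (Xv (m + n)) * q)"
text \<open>The double sum in \<open>e_n\<close>, nested so that its coefficients are first-order
  operators and \<open>diff_sum_gen\<close> applies.\<close>

definition De :: "int \<Rightarrow> laurent \<Rightarrow> laurent" where
  "De n = diff_sum Xv (\<lambda>m. deriv_x (m + n))"
definition Ey :: "int \<Rightarrow> laurent \<Rightarrow> laurent" where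
  "Ey n = diff_sum (\<lambda>k. Xv (- int k - n)) (\<lambda>k q. gen (Yv k) * q when k > 0)"
definition Ek :: "int \<Rightarrow> laurent \<Rightarrow> laurent" where
  "Ek n = diff_sum Yv (\<lambda>m q. const (of_nat m) * pdiff (Xv (int m - n)) q when m > 0)"
text \<open>Up to sign this is the commutator of \<open>E n\<close> with
  \<open>pdiff (Xv m)\<close>, for \<open>q = m - n\<close>.\<close>

definition Bq :: "int \<Rightarrow> laurent \<Rightarrow> laurent" where
  "Bq q = diff_sum Xv (\<lambda>k. pdiff (Xv (q - k)))"
definition Dx :: "laurent \<Rightarrow> laurent" where
  "Dx = diff_sum Xv (\<lambda>j q. const (of_int j) * gen (Xv j) * q)"
definition Dy :: "laurent \<Rightarrow> laurent" where
  "Dy = diff_sum Yv (\<lambda>j q. const (of_nat j) * gen (Yv j) * q when j > 0)"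

lemma lin_op_mult_left: "lin_op (\<lambda>q. r * q)" by (rule lin_op_mult[OF lin_op_id])

lemma lin_op_deriv_x: "lin_op (deriv_x n)"
  unfolding deriv_x_def by (intro lin_op_diff_sum lin_op_mult_left inj_Xv)
lemma lin_op_De: "lin_op (De n)"
  unfolding De_def by (intro lin_op_diff_sum lin_op_deriv_x inj_Xv)
lemma inj_Ey [simp]: "inj (\<lambda>k. Xv (- int k - n))" by (simp add: inj_def)
lemma lin_op_Ey: "lin_op (Ey n)"
  unfolding Ey_def by (intro lin_op_diff_sum lin_op_when lin_op_mult_left inj_Ey)
lemma lin_op_Ek: "lin_op (Ek n)"
  unfolding Ek_def by (intro lin_op_diff_sum lin_op_when lin_op_mult lin_op_pdiff inj_Yv)
lemma lin_op_Bq: "lin_op (Bq n)"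
  unfolding Bq_def by (intro lin_op_diff_sum lin_op_pdiff inj_Xv)
lemma lin_op_Dx: "lin_op Dx"
  unfolding Dx_def by (intro lin_op_diff_sum lin_op_mult_left inj_Xv)
lemma lin_op_Dy: "lin_op Dy"
  unfolding Dy_def by (intro lin_op_diff_sum lin_op_when lin_op_mult_left inj_Yv)

lemma diff_sum_zero: "diff_sum U (\<lambda>m q. 0) p = 0" by (simp add: diff_sum_def)

lemma diff_sum_gen0:
  assumes U: "inj U" and F: "\<And>m. lin_op (F m)"
    and FG: "\<And>m q. F m (gen w * q) = gen w * F m q"
  shows "diff_sum U F (gen w * p) = gen w * diff_sum U F p + Sum_any (\<lambda>m. F m p when U m = w)"
  using diff_sum_gen[OF U F lin_op_zero, where w = w and p = p] FG by (simp add: diff_sum_zero)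

lemmas diff_sum_lin_op_intros = inj_Xv inj_Yv inj_Ey lin_op_when lin_op_mult_left lin_op_mult lin_op_pdiff lin_op_id lin_op_deriv_x

lemma deriv_x_gen: "deriv_x n (gen w * p) = gen w * deriv_x n p + Sum_any (\<lambda>m. gen (Xv (m + n)) * p when Xv m = w)"
  unfolding deriv_x_def by (rule diff_sum_gen0) (auto simp: lin_op_mult_left algebra_simps)
lemma deriv_x_gen_X: "deriv_x n (gen (Xv j) * p) = gen (Xv j) * deriv_x n p + gen (Xv (n + j)) * p"
  unfolding deriv_x_gen Sum_any_when_inj[OF inj_Xv] by (simp add: add.commute)
lemma deriv_x_gen_Y: "deriv_x n (gen (Yv j) * p) = gen (Yv j) * deriv_x n p"
  unfolding deriv_x_gen by (simp add: Sum_any_when_not_range)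
lemma deriv_x_1: "deriv_x n 1 = 0" unfolding deriv_x_def by (rule diff_sum_1) (rule lin_op_mult_left)

lemmas diff_sum_comm = when_def pdiff_gen_mult deriv_x_gen_X deriv_x_gen_Y

lemma De_gen_X: "De n (gen (Xv j) * p) = gen (Xv j) * De n p + 2 * deriv_x (n + j) p"
proof -
  have "De n (gen (Xv j) * p) = gen (Xv j) * De n p + diff_sum Xv (\<lambda>m q. gen (Xv (m + n + j)) * q) p
      + Sum_any (\<lambda>m. deriv_x (m + n) p when Xv m = Xv j)"
    unfolding De_def by (rule diff_sum_gen)
      (intro diff_sum_lin_op_intros | simp add: diff_sum_comm; simp add: algebra_simps)+
  then show ?thesis
    unfolding Sum_any_when_inj[OF inj_Xv] by (simp add: deriv_x_def add.assoc add.commute[of j])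
qed
lemma De_gen_Y: "De n (gen (Yv j) * p) = gen (Yv j) * De n p"
proof -
  have "De n (gen (Yv j) * p) = gen (Yv j) * De n p + Sum_any (\<lambda>m. deriv_x (m + n) p when Xv m = Yv j)"
    unfolding De_def by (rule diff_sum_gen0)
      (intro diff_sum_lin_op_intros | simp add: diff_sum_comm; simp add: algebra_simps)+
  then show ?thesis by (simp add: Sum_any_when_not_range)
qed
lemma De_1: "De n 1 = 0" unfolding De_def by (rule diff_sum_1) (rule lin_op_deriv_x)

lemma Ey_gen: "Ey n (gen w * p) = gen w * Ey n p
    + Sum_any (\<lambda>k. (gen (Yv k) * p when k > 0) when Xv (- int k - n) = w)"
  unfolding Ey_def by (rule diff_sum_gen0)
      (intro diff_sum_lin_op_intros | simp add: diff_sum_comm; simp add: algebra_simps)+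
lemma Ey_gen_X: "Ey n (gen (Xv j) * p)
    = gen (Xv j) * Ey n p + (gen (Yv (nat (- n - j))) * p when n + j < 0)"
proof -
  have "Sum_any (\<lambda>k. (gen (Yv k) * p when k > 0) when Xv (- int k - n) = Xv j)
      = Sum_any (\<lambda>k. (gen (Yv k) * p when n + j < 0) when k = nat (- n - j))"
    by (rule Sum_any.cong) (auto simp: when_def)
  then show ?thesis by (simp add: Ey_gen)
qed
lemma Ey_gen_Y: "Ey n (gen (Yv j) * p) = gen (Yv j) * Ey n p"
  unfolding Ey_gen by (simp add: Sum_any_when_not_range)
lemma Ey_1: "Ey n 1 = 0"
  unfolding Ey_def by (rule diff_sum_1) (intro lin_op_when lin_op_mult_left)

lemma Ek_gen_X: "Ek n (gen (Xv j) * p)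
    = gen (Xv j) * Ek n p + (const (of_int (n + j)) * pdiff (Yv (nat (n + j))) p when n + j > 0)"
proof -
  have "Ek n (gen (Xv j) * p) = gen (Xv j) * Ek n p
      + diff_sum Yv (\<lambda>m q. (const (of_nat m) * q when m > 0) when int m - n = j) p
      + Sum_any (\<lambda>m. (const (of_nat m) * pdiff (Xv (int m - n)) p when m > 0) when Yv m = Xv j)"
    unfolding Ek_def by (rule diff_sum_gen)
      (intro diff_sum_lin_op_intros | simp add: diff_sum_comm; simp add: algebra_simps)+
  moreover have "diff_sum Yv (\<lambda>m q. (const (of_nat m) * q when m > 0) when int m - n = j) p
     = Sum_any (\<lambda>m. (const (of_nat m) * pdiff (Yv m) p when n + j > 0) when m = nat (n + j))"
    unfolding diff_sum_def by (rule Sum_any.cong) (auto simp: when_def)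
  ultimately show ?thesis
    by (auto simp: Sum_any_when_not_range when_def)
qed
lemma Ek_gen_Y: "Ek n (gen (Yv j) * p)
    = gen (Yv j) * Ek n p + const (of_nat j) * pdiff (Xv (int j - n)) p"
proof -
  have "Ek n (gen (Yv j) * p) = gen (Yv j) * Ek n p
      + Sum_any (\<lambda>m. (const (of_nat m) * pdiff (Xv (int m - n)) p when m > 0) when Yv m = Yv j)"
    unfolding Ek_def by (rule diff_sum_gen0)
      (intro diff_sum_lin_op_intros | simp add: diff_sum_comm; simp add: algebra_simps)+
  \<comment> \<open>At \<open>j = 0\<close> the guard removes the term, and the factor
    \<open>of_nat j\<close> on the right vanishes as well.\<close>
  then show ?thesis unfolding Sum_any_when_inj[OF inj_Yv] by (cases "j = 0") auto
qed
lemma Ek_1: "Ek n 1 = 0"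
  unfolding Ek_def by (rule diff_sum_1) (intro lin_op_when lin_op_mult lin_op_pdiff)

lemma Bq_gen_X: "Bq q (gen (Xv j) * p) = gen (Xv j) * Bq q p + 2 * pdiff (Xv (q - j)) p"
proof -
  have "Bq q (gen (Xv j) * p) = gen (Xv j) * Bq q p
      + diff_sum Xv (\<lambda>m p. p when q - m = j) p
      + Sum_any (\<lambda>m. pdiff (Xv (q - m)) p when Xv m = Xv j)"
    unfolding Bq_def by (rule diff_sum_gen)
      (intro diff_sum_lin_op_intros | simp add: diff_sum_comm; simp add: algebra_simps)+
  moreover have "diff_sum Xv (\<lambda>m p. p when q - m = j) p = Sum_any (\<lambda>m. pdiff (Xv m) p when m = q - j)"
    unfolding diff_sum_def by (rule Sum_any.cong) (auto simp: when_def)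
  ultimately show ?thesis
    unfolding Sum_any_when_inj[OF inj_Xv] by simp
qed
lemma Bq_gen_Y: "Bq q (gen (Yv j) * p) = gen (Yv j) * Bq q p"
proof -
  have "Bq q (gen (Yv j) * p) = gen (Yv j) * Bq q p
      + Sum_any (\<lambda>m. pdiff (Xv (q - m)) p when Xv m = Yv j)"
    unfolding Bq_def by (rule diff_sum_gen0)
      (intro diff_sum_lin_op_intros | simp add: diff_sum_comm; simp add: algebra_simps)+
  then show ?thesis by (simp add: Sum_any_when_not_range)
qed
lemma Bq_1: "Bq n 1 = 0" unfolding Bq_def by (rule diff_sum_1) (rule lin_op_pdiff)

lemma Dx_gen_X: "Dx (gen (Xv j) * p) = gen (Xv j) * Dx p + const (of_int j) * gen (Xv j) * p"
proof -
  have "Dx (gen (Xv j) * p) = gen (Xv j) * Dx p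
      + Sum_any (\<lambda>m. const (of_int m) * gen (Xv m) * p when Xv m = Xv j)"
    unfolding Dx_def by (rule diff_sum_gen0)
      (intro diff_sum_lin_op_intros | simp add: diff_sum_comm; simp add: algebra_simps)+
  then show ?thesis unfolding Sum_any_when_inj[OF inj_Xv] by simp
qed
lemma Dx_gen_Y: "Dx (gen (Yv j) * p) = gen (Yv j) * Dx p"
proof -
  have "Dx (gen (Yv j) * p) = gen (Yv j) * Dx p
      + Sum_any (\<lambda>m. const (of_int m) * gen (Xv m) * p when Xv m = Yv j)"
    unfolding Dx_def by (rule diff_sum_gen0)
      (intro diff_sum_lin_op_intros | simp add: diff_sum_comm; simp add: algebra_simps)+
  then show ?thesis by (simp add: Sum_any_when_not_range)
qed
lemma Dx_1: "Dx 1 = 0" unfolding Dx_def by (rule diff_sum_1) (rule lin_op_mult_left)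

lemma Dy_gen_X: "Dy (gen (Xv j) * p) = gen (Xv j) * Dy p"
proof -
  have "Dy (gen (Xv j) * p) = gen (Xv j) * Dy p
      + Sum_any (\<lambda>m. (const (of_nat m) * gen (Yv m) * p when m > 0) when Yv m = Xv j)"
    unfolding Dy_def by (rule diff_sum_gen0)
      (intro diff_sum_lin_op_intros | simp add: diff_sum_comm; simp add: algebra_simps)+
  then show ?thesis by (simp add: Sum_any_when_not_range)
qed
lemma Dy_gen_Y: "Dy (gen (Yv j) * p) = gen (Yv j) * Dy p + const (of_nat j) * gen (Yv j) * p"
proof -
  have "Dy (gen (Yv j) * p) = gen (Yv j) * Dy p
      + Sum_any (\<lambda>m. (const (of_nat m) * gen (Yv m) * p when m > 0) when Yv m = Yv j)"
    unfolding Dy_def by (rule diff_sum_gen0)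
      (intro diff_sum_lin_op_intros | simp add: diff_sum_comm; simp add: algebra_simps)+
  then show ?thesis unfolding Sum_any_when_inj[OF inj_Yv] by (cases "j = 0") auto
qed
lemma Dy_1: "Dy 1 = 0" unfolding Dy_def by (rule diff_sum_1) (intro lin_op_when lin_op_mult_left)

text \<open>\<open>a = 1\<close> gives \<^const>\<open>Phi\<close>; \<open>a = 0\<close> switches off the \<open>y\<close>-variables and gives \<^const>\<open>Phi'\<close>.\<close>

locale free_field =
  fixes a K J :: complex
  assumes a_cases: "a = 1 \<or> a = 0 \<and> K = 0"
begin

definition H :: "int \<Rightarrow> laurent \<Rightarrow> laurent" where
  "H n p = - const 2 * deriv_x n p + (const a * gen (Yv (nat (- n))) * p when n < 0)
     + (const (2 * of_int n * K) * pdiff (Yv (nat n)) p when n > 0) + (const J * p when n = 0)"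

definition E :: "int \<Rightarrow> laurent \<Rightarrow> laurent" where
  "E n p = - De n p + const a * Ey n p + const (2 * K) * Ek n p
     + const (K * of_int n + J) * pdiff (Xv (- n)) p"

definition D :: "laurent \<Rightarrow> laurent" where
  "D p = Dx p - const a * Dy p"

lemma aK [simp]: "a * K = K" using a_cases by auto
text \<open>In both cases \<open>a\<close> is idempotent and fixes \<open>K\<close>. As rewrite
  rules these facts let one computation serve \<open>Phi\<close> and \<open>Phi'\<close>
  together.\<close>

lemma const_a_const_K: "const a * (const K * p) = const K * p" "const a * const K = const K" "const K * const a = const K"
  "const K * (const a * p) = const K * p"
  "const a * (2 * (q * const K)) = 2 * (q * const K)" "const a * (const a * p) = const a * p"
  using a_cases by auto

lemma lin_op_H: "lin_op (H n)"
  unfolding H_def [abs_def] by (intro lin_op_plus lin_op_when lin_op_mult lin_op_pdiff lin_op_deriv_x lin_op_id)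
lemma lin_op_E: "lin_op (E n)"
  unfolding E_def [abs_def] by (intro lin_op_plus lin_op_when lin_op_mult lin_op_minusI lin_op_pdiff lin_op_De lin_op_Ey lin_op_Ek)
lemma lin_op_D: "lin_op D"
  unfolding D_def [abs_def] by (intro lin_op_diffI lin_op_mult lin_op_Dx lin_op_Dy)

lemmas H_simps = lin_op_simps[OF lin_op_H]
lemmas E_simps = lin_op_simps[OF lin_op_E]
lemmas D_simps = lin_op_simps[OF lin_op_D]
lemmas B_simps = lin_op_simps[OF lin_op_Bq]
lemmas op_simps = H_simps E_simps D_simps B_simps pdiff_simps

lemma H_gen_X: "H n (gen (Xv j) * p) = gen (Xv j) * H n p - 2 * (gen (Xv (n + j)) * p)"
  by (simp add: H_def deriv_x_gen_X pdiff_gen_mult when_def const_arith; simp add: algebra_simps)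
lemma H_gen_Y: "H n (gen (Yv j) * p) = gen (Yv j) * H n p + const (2 * of_int n * K) * (p when n = int j)"
  by (auto simp: H_def deriv_x_gen_Y pdiff_gen_mult when_def const_arith; simp add: algebra_simps)+
lemma H_1: "H n 1 = const a * (gen (Yv (nat (- n))) when n < 0) + (const J when n = 0)"
  by (simp add: H_def deriv_x_1 when_def)
lemma E_gen_X: "E n (gen (Xv j) * p) = gen (Xv j) * E n p + H (n + j) p + const (K * of_int n) * (p when n + j = 0)"
  by (simp add: E_def H_def De_gen_X Ey_gen_X Ek_gen_X pdiff_gen_mult when_def const_arith; simp add: algebra_simps)
lemma E_gen_Y: "E n (gen (Yv j) * p) = gen (Yv j) * E n p + const (2 * K * of_nat j) * pdiff (Xv (int j - n)) p"
  by (simp add: E_def De_gen_Y Ey_gen_Y Ek_gen_Y pdiff_gen_mult when_def const_arith; simp add: algebra_simps)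
lemma E_1: "E n 1 = 0"
  by (simp add: E_def De_1 Ey_1 Ek_1)
lemma D_gen_X: "D (gen (Xv j) * p) = gen (Xv j) * D p + const (of_int j) * (gen (Xv j) * p)"
  by (simp add: D_def Dx_gen_X Dy_gen_X const_arith; simp add: algebra_simps)
lemma D_gen_Y: "D (gen (Yv j) * p) = gen (Yv j) * D p - const (a * of_nat j) * (gen (Yv j) * p)"
  by (simp add: D_def Dx_gen_Y Dy_gen_Y const_arith; simp add: algebra_simps)
lemma D_1: "D 1 = 0" by (simp add: D_def Dx_1 Dy_1)

section \<open>Commutators of derivatives, currents and the degree operator\<close>

lemmas gen_rules = H_gen_X H_gen_Y E_gen_X E_gen_Y D_gen_X D_gen_Y Bq_gen_X Bq_gen_Y pdiff_gen_mult

lemmas one_rules = H_1 E_1 D_1 Bq_1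

lemmas lin_op_op_intros = lin_op_plus lin_op_minusI lin_op_diffI lin_op_mult lin_op_when
  lin_op_comp[OF lin_op_H] lin_op_comp[OF lin_op_E] lin_op_comp[OF lin_op_D] lin_op_comp[OF lin_op_Bq] lin_op_pdiff_comp
  lin_op_H lin_op_E lin_op_D lin_op_Bq lin_op_pdiff lin_op_id lin_op_zero



text \<open>First of a chain of relations proved alike with \<open>lin_op_eq_by_gens\<close>:
  commuting either side with a variable leads to relations established earlier in the chain, so the
  order of these lemmas matters.\<close>

lemma pdiff_X_H: "pdiff (Xv m) (H n p) = H n (pdiff (Xv m) p) - 2 * pdiff (Xv (m - n)) p"
  (is "?S p = ?T p")
proof (rule lin_op_eq_by_gens[where S = "?S" and T = "?T"])
  show "?S (gen v * q) - gen v * ?S q = ?T (gen v * q) - gen v * ?T q" for v q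
    by (cases v) (auto simp: gen_rules op_simps when_def const_arith mult.assoc
        add_eq_0_iff pdiff_commute; simp add: algebra_simps const_a_const_K)+
  \<comment> \<open>The operators may send \<open>1\<close> to a single variable, so the rules for
    moving past a variable are also needed at \<open>p = 1\<close>.\<close>
  show "?S 1 = ?T 1"
    by (auto simp: one_rules op_simps when_def const_arith mult.assoc add_eq_0_iff const_a_const_K
        gen_rules[where p = 1, simplified one_rules mult_1_right])
qed (intro lin_op_op_intros)+

lemma pdiff_Y_H: "pdiff (Yv m) (H n p) = H n (pdiff (Yv m) p) + (const a * p when m > 0 \<and> n = - int m)"
  (is "?S p = ?T p")
proof (rule lin_op_eq_by_gens[where S = "?S" and T = "?T"])
  show "?S (gen v * q) - gen v * ?S q = ?T (gen v * q) - gen v * ?T q" for v q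
    by (cases v) (auto simp: gen_rules op_simps when_def const_arith mult.assoc
        add_eq_0_iff pdiff_commute; simp add: algebra_simps const_a_const_K)+
  show "?S 1 = ?T 1"
    by (auto simp: one_rules op_simps when_def const_arith mult.assoc add_eq_0_iff const_a_const_K
        gen_rules[where p = 1, simplified one_rules mult_1_right])
qed (intro lin_op_op_intros)+

lemma pdiff_D: "pdiff (Xv m) (D p) = D (pdiff (Xv m) p) + const (of_int m) * pdiff (Xv m) p"
  (is "?S p = ?T p")
proof (rule lin_op_eq_by_gens[where S = "?S" and T = "?T"])
  show "?S (gen v * q) - gen v * ?S q = ?T (gen v * q) - gen v * ?T q" for v q
    by (cases v) (auto simp: gen_rules op_simps when_def const_arith mult.assoc
        add_eq_0_iff pdiff_commute; simp add: algebra_simps const_a_const_K)+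
  show "?S 1 = ?T 1"
    by (auto simp: one_rules op_simps when_def const_arith mult.assoc add_eq_0_iff const_a_const_K
        gen_rules[where p = 1, simplified one_rules mult_1_right])
qed (intro lin_op_op_intros)+

lemma pdiff_Y_D: "pdiff (Yv m) (D p) = D (pdiff (Yv m) p) - const (a * of_nat m) * pdiff (Yv m) p"
  (is "?S p = ?T p")
proof (rule lin_op_eq_by_gens[where S = "?S" and T = "?T"])
  show "?S (gen v * q) - gen v * ?S q = ?T (gen v * q) - gen v * ?T q" for v q
    by (cases v) (auto simp: gen_rules op_simps when_def const_arith mult.assoc
        add_eq_0_iff pdiff_commute; simp add: algebra_simps const_a_const_K)+
  show "?S 1 = ?T 1"
    by (auto simp: one_rules op_simps when_def const_arith mult.assoc add_eq_0_iff const_a_const_K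
        gen_rules[where p = 1, simplified one_rules mult_1_right])
qed (intro lin_op_op_intros)+

lemma pdiff_B: "pdiff w (Bq q p) = Bq q (pdiff w p)"
  (is "?S p = ?T p")
proof (rule lin_op_eq_by_gens[where S = "?S" and T = "?T"])
  show "?S (gen v * q) - gen v * ?S q = ?T (gen v * q) - gen v * ?T q" for v q
    by (cases v) (auto simp: gen_rules op_simps when_def const_arith mult.assoc
        add_eq_0_iff pdiff_commute; simp add: algebra_simps const_a_const_K)+
  show "?S 1 = ?T 1"
    by (auto simp: one_rules op_simps when_def const_arith mult.assoc add_eq_0_iff const_a_const_K
        gen_rules[where p = 1, simplified one_rules mult_1_right])
qed (intro lin_op_op_intros)+

lemmas comm_rules_HD = pdiff_X_H pdiff_Y_H pdiff_D pdiff_Y_D pdiff_B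

text \<open>Differentiating the coefficient \<open>x_(k+l+n)\<close> by \<open>x_m\<close> leaves
  the pairs of derivatives with \<open>k + l = m - n\<close>, which is \<open>Bq (m - n)\<close>.
  The other terms of \<open>E n\<close> have coefficients free of x-variables.\<close>

lemma pdiff_X_E: "pdiff (Xv m) (E n p) = E n (pdiff (Xv m) p) - Bq (m - n) p"
  (is "?S p = ?T p")
proof (rule lin_op_eq_by_gens[where S = "?S" and T = "?T"])
  show "?S (gen v * q) - gen v * ?S q = ?T (gen v * q) - gen v * ?T q" for v q
    by (cases v) (auto simp: gen_rules comm_rules_HD op_simps when_def const_arith mult.assoc
        add_eq_0_iff pdiff_commute; simp add: algebra_simps const_a_const_K)+
  show "?S 1 = ?T 1"
    by (auto simp: one_rules op_simps when_def const_arith mult.assoc add_eq_0_iff const_a_const_K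
        gen_rules[where p = 1, simplified one_rules mult_1_right])
qed (intro lin_op_op_intros)+

text \<open>When \<open>p\<close> does not involve \<open>y_m\<close>, only the single derivative by
  an x-variable remains. This is what later lowers the degree in \<open>x\<close>.\<close>

lemma pdiff_Y_E: "pdiff (Yv m) (E n p) = E n (pdiff (Yv m) p) + (const a * pdiff (Xv (- int m - n)) p when m > 0)"
  (is "?S p = ?T p")
proof (rule lin_op_eq_by_gens[where S = "?S" and T = "?T"])
  show "?S (gen v * q) - gen v * ?S q = ?T (gen v * q) - gen v * ?T q" for v q
    by (cases v) (auto simp: gen_rules comm_rules_HD op_simps when_def const_arith mult.assoc
        add_eq_0_iff pdiff_commute; simp add: algebra_simps const_a_const_K)+
  show "?S 1 = ?T 1"
    by (auto simp: one_rules op_simps when_def const_arith mult.assoc add_eq_0_iff const_a_const_K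
        gen_rules[where p = 1, simplified one_rules mult_1_right])
qed (intro lin_op_op_intros)+

lemma H_H: "H m (H n p) = H n (H m p) + const (2 * of_int m * K) * (p when m + n = 0)"
  (is "?S p = ?T p")
proof (rule lin_op_eq_by_gens[where S = "?S" and T = "?T"])
  show "?S (gen v * q) - gen v * ?S q = ?T (gen v * q) - gen v * ?T q" for v q
    by (cases v) (auto simp: gen_rules comm_rules_HD op_simps when_def const_arith mult.assoc
        add_eq_0_iff pdiff_commute; simp add: algebra_simps const_a_const_K)+
  show "?S 1 = ?T 1"
    by (auto simp: one_rules op_simps when_def const_arith mult.assoc add_eq_0_iff const_a_const_K
        gen_rules[where p = 1, simplified one_rules mult_1_right])
qed (intro lin_op_op_intros)+

lemma D_H: "D (H n p) = H n (D p) + const (of_int n) * H n p"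
  (is "?S p = ?T p")
proof (rule lin_op_eq_by_gens[where S = "?S" and T = "?T"])
  show "?S (gen v * q) - gen v * ?S q = ?T (gen v * q) - gen v * ?T q" for v q
    by (cases v) (auto simp: gen_rules comm_rules_HD op_simps when_def const_arith mult.assoc
        add_eq_0_iff pdiff_commute; simp add: algebra_simps const_a_const_K)+
  show "?S 1 = ?T 1"
    by (auto simp: one_rules op_simps when_def const_arith mult.assoc add_eq_0_iff const_a_const_K
        gen_rules[where p = 1, simplified one_rules mult_1_right])
qed (intro lin_op_op_intros)+

text \<open>As a rewrite rule \<open>H_H\<close> would loop; it is restricted to an inner index that
  is \<open>0\<close> or a sum, the form in which \<open>E_gen_X\<close> produces it.\<close>

lemmas comm_rules_E = pdiff_X_H pdiff_Y_H pdiff_D pdiff_Y_D pdiff_B pdiff_X_E pdiff_Y_E H_H[of _ 0] H_H[where n = "_ + _"]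

lemma H_E: "H m (E n p) = E n (H m p) + 2 * E (m + n) p"
  (is "?S p = ?T p")
proof (rule lin_op_eq_by_gens[where S = "?S" and T = "?T"])
  show "?S (gen v * q) - gen v * ?S q = ?T (gen v * q) - gen v * ?T q" for v q
    by (cases v) (auto simp: gen_rules comm_rules_E op_simps when_def const_arith mult.assoc
        add_eq_0_iff pdiff_commute; simp add: algebra_simps const_a_const_K)+
  show "?S 1 = ?T 1"
    by (auto simp: one_rules op_simps when_def const_arith mult.assoc add_eq_0_iff const_a_const_K
        gen_rules[where p = 1, simplified one_rules mult_1_right])
qed (intro lin_op_op_intros)+

lemmas comm_rules_HE = pdiff_X_H pdiff_Y_H pdiff_D pdiff_Y_D pdiff_B pdiff_X_E pdiff_Y_E H_E D_H

lemma E_E: "E m (E n p) = E n (E m p)"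
  (is "?S p = ?T p")
proof (rule lin_op_eq_by_gens[where S = "?S" and T = "?T"])
  show "?S (gen v * q) - gen v * ?S q = ?T (gen v * q) - gen v * ?T q" for v q
    by (cases v) (auto simp: gen_rules comm_rules_HE op_simps when_def const_arith mult.assoc
        add_eq_0_iff pdiff_commute; simp add: algebra_simps const_a_const_K)+
  show "?S 1 = ?T 1"
    by (auto simp: one_rules op_simps when_def const_arith mult.assoc add_eq_0_iff const_a_const_K
        gen_rules[where p = 1, simplified one_rules mult_1_right])
qed (intro lin_op_op_intros)+

lemma D_E: "D (E n p) = E n (D p) + const (of_int n) * E n p"
  (is "?S p = ?T p")
proof (rule lin_op_eq_by_gens[where S = "?S" and T = "?T"])
  show "?S (gen v * q) - gen v * ?S q = ?T (gen v * q) - gen v * ?T q" for v q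
    by (cases v) (auto simp: gen_rules comm_rules_HE op_simps when_def const_arith mult.assoc
        add_eq_0_iff pdiff_commute; simp add: algebra_simps const_a_const_K)+
  show "?S 1 = ?T 1"
    by (auto simp: one_rules op_simps when_def const_arith mult.assoc add_eq_0_iff const_a_const_K
        gen_rules[where p = 1, simplified one_rules mult_1_right])
qed (intro lin_op_op_intros)+

end

section \<open>Quotients of Laurent modules\<close>

definition lin_subspace :: "laurent set \<Rightarrow> bool" where
  "lin_subspace W \<longleftrightarrow> 0 \<in> W \<and> (\<forall>p\<in>W. \<forall>q\<in>W. p + q \<in> W) \<and> (\<forall>c. \<forall>p\<in>W. const c * p \<in> W)"

lemma lin_subspace_0: "lin_subspace W \<Longrightarrow> 0 \<in> W" by (simp add: lin_subspace_def)
lemma lin_subspace_add: "lin_subspace W \<Longrightarrow> p \<in> W \<Longrightarrow> q \<in> W \<Longrightarrow> p + q \<in> W" by (simp add: lin_subspace_def)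
lemma lin_subspace_const: "lin_subspace W \<Longrightarrow> p \<in> W \<Longrightarrow> const c * p \<in> W" by (simp add: lin_subspace_def)
lemma lin_subspace_minus: "lin_subspace W \<Longrightarrow> p \<in> W \<Longrightarrow> - p \<in> W"
  using lin_subspace_const[of W p "-1"] by (simp add: const_minus)
lemma lin_subspace_diff: "lin_subspace W \<Longrightarrow> p \<in> W \<Longrightarrow> q \<in> W \<Longrightarrow> p - q \<in> W"
  using lin_subspace_add[of W p "- q"] by (simp add: lin_subspace_minus)
lemma lin_subspace_sum: "lin_subspace W \<Longrightarrow> (\<And>x. x \<in> A \<Longrightarrow> f x \<in> W) \<Longrightarrow> sum f A \<in> W"
  by (induction A rule: infinite_finite_induct) (auto simp: lin_subspace_0 lin_subspace_add)
lemma lin_subspace_Sum_any: "lin_subspace W \<Longrightarrow> (\<And>x. f x \<in> W) \<Longrightarrow> Sum_any f \<in> W"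
  by (simp add: Sum_any.expand_set lin_subspace_sum)
lemma lin_subspace_numeral: "lin_subspace W \<Longrightarrow> p \<in> W \<Longrightarrow> numeral n * p \<in> W"
  using lin_subspace_const[of W p "numeral n"] by simp
lemmas lin_subspace_intros = lin_subspace_0 lin_subspace_add lin_subspace_const lin_subspace_minus lin_subspace_diff lin_subspace_numeral
lemma lin_subspace_const_iff: "lin_subspace W \<Longrightarrow> c \<noteq> 0 \<Longrightarrow> const c * p \<in> W \<longleftrightarrow> p \<in> W"
proof
  assume W: "lin_subspace W" "c \<noteq> 0" and p: "const c * p \<in> W"
  have "const (inverse c) * (const c * p) \<in> W" using W(1) p by (rule lin_subspace_const)
  then show "p \<in> W" unfolding const_inverse_mult[OF W(2)] .
qed (rule lin_subspace_const)

lemma lin_subspace_cong: "lin_subspace W \<Longrightarrow> p - q \<in> W \<Longrightarrow> p \<in> W \<longleftrightarrow> q \<in> W"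
proof
  assume W: "lin_subspace W" "p - q \<in> W"
  show "q \<in> W" if "p \<in> W" using lin_subspace_diff[OF W(1) that W(2)] by simp
  show "p \<in> W" if "q \<in> W" using lin_subspace_add[OF W that] by simp
qed

text \<open>The bracket relation is assumed on the carrier only: the intended \<open>rho\<close>
  ignores the entry \<open>(2,2)\<close> of a matrix, which the other entries determine when the
  trace is zero.\<close>

locale subquotient =
  fixes N I :: "laurent set" and \<rho> :: "affine \<Rightarrow> laurent \<Rightarrow> laurent"
  assumes N: "lin_subspace N" and I: "lin_subspace I" and IN: "I \<subseteq> N"
    and \<rho>_lin: "lin_op (\<rho> x)"
    and \<rho>_N: "p \<in> N \<Longrightarrow> \<rho> x p \<in> N" and \<rho>_I: "p \<in> I \<Longrightarrow> \<rho> x p \<in> I"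
    and \<rho>_add: "\<rho> (x + y) p = \<rho> x p + \<rho> y p"
    and \<rho>_smult: "\<rho> (affine_smult c x) p = const c * \<rho> x p"
    and \<rho>_bracket: "x \<in> carrier affine_sl2 \<Longrightarrow> y \<in> carrier affine_sl2
      \<Longrightarrow> \<rho> (affine_bracket x y) p = \<rho> x (\<rho> y p) - \<rho> y (\<rho> x p)"
begin

definition coset :: "laurent \<Rightarrow> laurent set" where "coset v = {w. w - v \<in> I}"

abbreviation Q :: "(complex, laurent set, affine) lie_mod" where
  "Q \<equiv> lie_quotient (laurent_module N \<rho>) I"

lemma coset_eq_iff: "coset u = coset v \<longleftrightarrow> u - v \<in> I"
proof
  assume "coset u = coset v"
  moreover have "u \<in> coset u" using lin_subspace_0[OF I] by (simp add: coset_def)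
  ultimately have "u \<in> coset v" by (simp only:)
  then show "u - v \<in> I" by (simp add: coset_def)
next
  assume uv: "u - v \<in> I"
  have "w - u \<in> I \<longleftrightarrow> w - v \<in> I" for w
    using lin_subspace_cong[OF I, of "w - v" "w - u"] uv by simp
  then show "coset u = coset v" by (simp add: coset_def)
qed

lemma coset_0: "coset 0 = I" by (auto simp: coset_def)

lemma a_r_coset_eq_coset: "a_r_coset (laurent_module N \<rho>) I v = coset v"
proof -
  have "w \<in> coset v \<longleftrightarrow> (\<exists>h\<in>I. w = h + v)" for w
    by (auto simp: coset_def) (metis diff_add_cancel)
  then show ?thesis by (auto simp: a_r_coset_def' laurent_module_def)
qed

lemma carrier_Q: "carrier Q = coset ` N"
proof -
  have "carrier Q = (\<Union>v\<in>N. {a_r_coset (laurent_module N \<rho>) I v})"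
    by (simp add: lie_quotient_def A_RCOSETS_def RCOSETS_def a_r_coset_def laurent_module_def)
  then show ?thesis unfolding a_r_coset_eq_coset by blast
qed

lemma set_add_iff: "w \<in> set_add (laurent_module N \<rho>) A B \<longleftrightarrow> (\<exists>u\<in>A. \<exists>v\<in>B. w = u + v)"
  by (auto simp: set_add_def' laurent_module_def)

text \<open>Any nonempty part of a coset is completed to the whole coset by adding \<open>I\<close>;
  hence the operations of \<open>lie_quotient\<close> are the induced ones.\<close>

lemma add_I_coset:
  assumes "A \<subseteq> coset v" "u \<in> A"
  shows "set_add (laurent_module N \<rho>) A I = coset v"
proof (intro Set.set_eqI iffI)
  fix w assume "w \<in> set_add (laurent_module N \<rho>) A I"
  then obtain x y where "x \<in> A" "y \<in> I" "w = x + y" by (auto simp: set_add_iff)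
  then have "x - v \<in> I" "w - v = (x - v) + y" using assms by (auto simp: coset_def)
  then show "w \<in> coset v" using lin_subspace_add[OF I, of "x - v" y] \<open>y \<in> I\<close> by (simp add: coset_def algebra_simps)
next
  fix w assume "w \<in> coset v"
  then have "w - v \<in> I" "u - v \<in> I" using assms by (auto simp: coset_def)
  then have "w - u \<in> I" using lin_subspace_diff[OF I, of "w - v" "u - v"] by simp
  moreover have "w = u + (w - u)" by simp
  ultimately show "w \<in> set_add (laurent_module N \<rho>) A I" using assms(2) unfolding set_add_iff by blast
qed

lemma add_Q: "coset u \<oplus>\<^bsub>Q\<^esub> coset v = coset (u + v)"
proof (intro Set.set_eqI iffI)
  fix w assume "w \<in> coset u \<oplus>\<^bsub>Q\<^esub> coset v"
  then obtain x y where "x - u \<in> I" "y - v \<in> I" "w = x + y"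
    by (auto simp: lie_quotient_def set_add_iff coset_def)
  then show "w \<in> coset (u + v)" using lin_subspace_add[OF I, of "x - u" "y - v"]
    by (simp add: coset_def algebra_simps)
next
  fix w assume "w \<in> coset (u + v)"
  then have "(w - v) - u \<in> I" by (simp add: coset_def algebra_simps)
  moreover have "v - v \<in> I" "w = (w - v) + v" using lin_subspace_0[OF I] by auto
  ultimately show "w \<in> coset u \<oplus>\<^bsub>Q\<^esub> coset v"
    unfolding lie_quotient_def by (auto simp: set_add_iff coset_def)
qed

lemma zero_Q: "\<zero>\<^bsub>Q\<^esub> = coset 0" by (simp add: coset_0 lie_quotient_def)

lemma in_coset: "v \<in> coset v" using lin_subspace_0[OF I] by (simp add: coset_def)

lemma smult_Q: "c \<odot>\<^bsub>Q\<^esub> coset v = coset (const c * v)"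
proof -
  have "const c * w \<in> coset (const c * v)" if "w \<in> coset v" for w
    using lin_subspace_const[OF I, of "w - v" c] that by (simp add: coset_def algebra_simps)
  then show ?thesis
    unfolding lie_quotient_def using in_coset[of v]
    by (auto simp: laurent_module_def[of N \<rho>] intro!: add_I_coset[unfolded laurent_module_def])
qed

lemma act_Q: "act Q x (coset v) = coset (\<rho> x v)"
proof -
  have "\<rho> x w \<in> coset (\<rho> x v)" if "w \<in> coset v" for w
    using \<rho>_I[of "w - v" x] that by (simp add: coset_def lin_op_diff[OF \<rho>_lin])
  then show ?thesis
    unfolding lie_quotient_def using in_coset[of v]
    by (auto simp: laurent_module_def[of N \<rho>] intro!: add_I_coset[unfolded laurent_module_def])
qed

lemmas Q_simps = add_Q zero_Q smult_Q act_Q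

lemma in_carrier_Q: "v \<in> N \<Longrightarrow> coset v \<in> carrier Q" by (simp add: carrier_Q)

lemma carrier_Q_E: "A \<in> carrier Q \<Longrightarrow> (\<And>v. v \<in> N \<Longrightarrow> A = coset v \<Longrightarrow> P) \<Longrightarrow> P"
  by (auto simp: carrier_Q)

lemma abelian_group_Q: "abelian_group Q"
proof (rule abelian_groupI)
  fix x assume "x \<in> carrier Q"
  then obtain v where v: "v \<in> N" "x = coset v" by (auto simp: carrier_Q)
  show "\<exists>y\<in>carrier Q. y \<oplus>\<^bsub>Q\<^esub> x = \<zero>\<^bsub>Q\<^esub>"
    by (rule bexI[of _ "coset (- v)"]) (auto simp: v Q_simps intro!: in_carrier_Q lin_subspace_minus[OF N])
qed (auto simp: carrier_Q Q_simps add_ac intro!: imageI lin_subspace_add[OF N] lin_subspace_0[OF N])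

lemma carrier_CC: "carrier CC = UNIV" and add_CC: "x \<oplus>\<^bsub>CC\<^esub> y = x + y"
  and mult_CC: "x \<otimes>\<^bsub>CC\<^esub> y = x * y" and one_CC: "\<one>\<^bsub>CC\<^esub> = 1"
  by (simp_all add: ring_of_type_algebra_def)

lemma module_Q: "Module.module CC Q"
  by (rule moduleI[OF cring_from_type_algebra abelian_group_Q])
    (auto simp: carrier_Q Q_simps add_CC mult_CC one_CC const_arith distrib_left distrib_right mult.assoc intro!: imageI lin_subspace_const[OF N])

lemma minus_Q: "u \<in> N \<Longrightarrow> v \<in> N \<Longrightarrow> coset u \<ominus>\<^bsub>Q\<^esub> coset v = coset (u - v)"
proof -
  assume "u \<in> N" "v \<in> N"
  interpret Q: abelian_group Q by (rule abelian_group_Q)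
  have "\<ominus>\<^bsub>Q\<^esub> coset v = coset (- v)"
    by (rule Q.minus_equality) (auto simp: Q_simps \<open>v \<in> N\<close> intro!: in_carrier_Q lin_subspace_minus[OF N])
  then show ?thesis by (simp add: a_minus_def add_Q)
qed

lemma lie_module_Q: "lie_module CC affine_sl2 Q"
proof (rule lie_module.intro[OF module_Q])
  have sl2: "x \<oplus>\<^bsub>affine_sl2\<^esub> y = x + y" "bracket affine_sl2 x y = affine_bracket x y"
    "c \<odot>\<^bsub>affine_sl2\<^esub> x = affine_smult c x" for x y c
    by (simp_all add: affine_sl2_def)
  show "lie_module_axioms CC affine_sl2 Q"
    by unfold_locales
      (elim carrier_Q_E; simp add: sl2 Q_simps minus_Q \<rho>_N \<rho>_add \<rho>_smult \<rho>_bracket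
        lin_op_simps[OF \<rho>_lin] in_carrier_Q del: affine_smult.simps affine_bracket.simps)+
qed

section \<open>Submodules of the quotient as invariant spaces between \<open>I\<close> and
  \<open>N\<close>\<close>

definition invariant_mod_I :: "laurent set \<Rightarrow> bool" where
  "invariant_mod_I W \<longleftrightarrow> lin_subspace W \<and> I \<subseteq> W \<and> W \<subseteq> N \<and> (\<forall>x\<in>carrier affine_sl2. \<forall>w\<in>W. \<rho> x w \<in> W)"

lemma mem_coset_image: "invariant_mod_I W \<Longrightarrow> coset v \<in> coset ` W \<longleftrightarrow> v \<in> W"
  using lin_subspace_cong[of W] by (auto simp: invariant_mod_I_def coset_eq_iff)

lemma coset_image_eq_iff:
  assumes "invariant_mod_I W" "invariant_mod_I W'"
  shows "coset ` W = coset ` W' \<longleftrightarrow> W = W'"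
proof
  assume "coset ` W = coset ` W'"
  moreover have "W = {v. coset v \<in> coset ` W}" "W' = {v. coset v \<in> coset ` W'}"
    using mem_coset_image assms by auto
  ultimately show "W = W'" by (simp only:)
qed (rule arg_cong)

lemma submodule_coset_image:
  assumes W: "invariant_mod_I W"
  shows "lie_submodule (coset ` W) CC affine_sl2 Q"
proof -
  interpret Q: abelian_group Q by (rule abelian_group_Q)
  have c: "lin_subspace W" and WN: "W \<subseteq> N" and inv: "\<And>x w. x \<in> carrier affine_sl2 \<Longrightarrow> w \<in> W \<Longrightarrow> \<rho> x w \<in> W"
    using W by (auto simp: invariant_mod_I_def)
  have neg: "\<ominus>\<^bsub>Q\<^esub> coset v = coset (- v)" if "v \<in> W" for v
    by (rule Q.minus_equality) (use that WN in \<open>auto simp: Q_simps intro!: in_carrier_Q lin_subspace_minus[OF N]\<close>)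
  have "subgroup (coset ` W) (add_monoid Q)"
    by unfold_locales
      (use WN neg in \<open>auto simp: carrier_Q Q_simps a_inv_def intro!: imageI lin_subspace_intros[OF c]\<close>)
  then have "submodule (coset ` W) CC Q"
    by (intro submodule.intro submodule_axioms.intro) (auto simp: Q_simps intro!: imageI lin_subspace_intros[OF c])
  then show ?thesis
    by (auto simp: lie_submodule_def Q_simps inv)
qed

lemma zero_image: "{\<zero>\<^bsub>Q\<^esub>} = coset ` I"
proof -
  have "coset v = coset 0" if "v \<in> I" for v using that by (simp add: coset_eq_iff)
  then show ?thesis using lin_subspace_0[OF I] unfolding zero_Q by blast
qed

text \<open>Correspondence theorem: the image under \<open>coset\<close> of an intermediate
  invariant space is a submodule, and the preimage of a submodule is such a space.\<close>

lemma irreducible_Q_iff: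
  "irreducible_lie_module CC affine_sl2 Q \<longleftrightarrow> N \<noteq> I \<and> (\<forall>W. invariant_mod_I W \<longrightarrow> W = I \<or> W = N)"
proof (intro iffI conjI allI impI)
  assume irr: "irreducible_lie_module CC affine_sl2 Q"
  have sI: "invariant_mod_I I" and sN: "invariant_mod_I N"
    by (auto simp: invariant_mod_I_def I N IN \<rho>_I \<rho>_N)
  have zero: "{\<zero>\<^bsub>Q\<^esub>} = coset ` I" 
    by (rule zero_image)
  show "N \<noteq> I" using irr by (auto simp: irreducible_lie_module_def zero carrier_Q)
  fix W assume W: "invariant_mod_I W"
  then have "coset ` W = coset ` I \<or> coset ` W = coset ` N"
    using irr submodule_coset_image[OF W] by (simp add: irreducible_lie_module_def zero carrier_Q)
  then show "W = I \<or> W = N"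
    by (simp add: coset_image_eq_iff W sI sN)
next
  assume *: "N \<noteq> I \<and> (\<forall>W. invariant_mod_I W \<longrightarrow> W = I \<or> W = N)"
  have zero: "{\<zero>\<^bsub>Q\<^esub>} = coset ` I" 
    by (rule zero_image)
  have sI: "invariant_mod_I I" and sN: "invariant_mod_I N"
    by (auto simp: invariant_mod_I_def I N IN \<rho>_I \<rho>_N)
  show "irreducible_lie_module CC affine_sl2 Q"
    unfolding irreducible_lie_module_def zero carrier_Q
  proof (intro conjI allI impI lie_module_Q)
    show "coset ` N \<noteq> coset ` I" using * by (simp add: coset_image_eq_iff sI sN)
    fix U assume U: "lie_submodule U CC affine_sl2 Q"
    define W where "W = {v \<in> N. coset v \<in> U}"
    have sm: "submodule U CC Q" and act: "\<And>x w. x \<in> carrier affine_sl2 \<Longrightarrow> w \<in> U \<Longrightarrow> act Q x w \<in> U"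
      using U by (auto simp: lie_submodule_def)
    have sg: "subgroup U (add_monoid Q)" using sm by (rule submodule.axioms)
    have sub: "U \<subseteq> coset ` N" using subgroup.subset[OF sg] by (simp add: carrier_Q)
    have z: "coset 0 \<in> U" using subgroup.one_closed[OF sg] by (simp add: zero_Q)
    have add: "coset (u + v) \<in> U" if "coset u \<in> U" "coset v \<in> U" for u v
      using subgroup.m_closed[OF sg that] by (simp add: add_Q)
    have sc: "coset (const c * v) \<in> U" if "coset v \<in> U" for c v
      using submodule.smult_closed[OF sm _ that, of c] by (simp add: smult_Q carrier_CC)
    have "coset v \<in> U" if "v \<in> I" for v
    proof -
      have "coset v = coset 0" using that by (simp add: coset_eq_iff)
      then show ?thesis using z by (simp only:)
    qed
    then have IW: "I \<subseteq> W" using IN by (auto simp: W_def)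
    have "lin_subspace W"
      unfolding lin_subspace_def
    proof (intro conjI ballI allI)
      show "0 \<in> W" using z by (simp add: W_def lin_subspace_0[OF N])
      show "p + q \<in> W" if "p \<in> W" "q \<in> W" for p q
        using that add by (simp add: W_def lin_subspace_add[OF N])
      show "const c * p \<in> W" if "p \<in> W" for c p
        using that sc by (simp add: W_def lin_subspace_const[OF N])
    qed
    moreover have "\<rho> x w \<in> W" if "x \<in> carrier affine_sl2" "w \<in> W" for x w
      using act[of x "coset w"] that unfolding act_Q by (simp add: W_def \<rho>_N)
    ultimately have "invariant_mod_I W"
      using IW by (auto simp: invariant_mod_I_def W_def)
    then have "W = I \<or> W = N" using * by blast
    moreover have "U = coset ` W"
    proof
      show "U \<subseteq> coset ` W" using sub unfolding W_def by blast
    qed (auto simp: W_def)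
    ultimately show "U = coset ` I \<or> U = coset ` N" by metis
  qed
qed

end

section \<open>The representation of the affine Lie algebra\<close>

definition monom_span :: "(var \<Rightarrow>\<^sub>0 int) set \<Rightarrow> laurent set" where
  "monom_span A = {p. kys p \<subseteq> A}"

lemma monom_span_lookup: "p \<in> monom_span A \<longleftrightarrow> (\<forall>\<nu>. lk p \<nu> \<noteq> 0 \<longrightarrow> \<nu> \<in> A)"
  by (auto simp: monom_span_def in_keys_iff)

lemma lin_subspace_monom_span: "lin_subspace (monom_span A)"
  by (auto simp: lin_subspace_def monom_span_lookup lookup_add) (metis add.right_neutral)

lemma monom_span_mono: "A \<subseteq> B \<Longrightarrow> monom_span A \<subseteq> monom_span B" by (auto simp: monom_span_def)

lemma monom_in_monom_span: "c \<noteq> 0 \<Longrightarrow> sgl \<nu> c \<in> monom_span A \<longleftrightarrow> \<nu> \<in> A" by (simp add: monom_span_def)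

lemma gen_monom_span:
  "(\<And>\<nu>. \<nu> \<in> A \<Longrightarrow> \<nu> + sgl v 1 \<in> A) \<Longrightarrow> p \<in> monom_span A \<Longrightarrow> gen v * p \<in> monom_span A"
  unfolding monom_span_lookup lookup_gen_mult by (metis diff_add_cancel)

text \<open>A monomial with exponent \<open>0\<close> at \<open>v\<close> is killed by the
  derivative. So differentiation never turns exponent \<open>0\<close> into \<open>-1\<close>, and
  spaces defined by sign conditions can be closed under it.\<close>

lemma pdiff_monom_span:
  "(\<And>\<nu>. \<nu> \<in> A \<Longrightarrow> lk \<nu> v \<noteq> 0 \<Longrightarrow> \<nu> - sgl v 1 \<in> A) \<Longrightarrow> p \<in> monom_span A \<Longrightarrow> pdiff v p \<in> monom_span A"
  unfolding monom_span_lookup lookup_pdiff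
proof (intro allI impI)
  fix \<nu> assume *: "\<And>\<nu>. \<nu> \<in> A \<Longrightarrow> lk \<nu> v \<noteq> 0 \<Longrightarrow> \<nu> - sgl v 1 \<in> A"
    "\<forall>\<nu>. lk p \<nu> \<noteq> 0 \<longrightarrow> \<nu> \<in> A" "of_int (lk \<nu> v + 1) * lk p (\<nu> + sgl v 1) \<noteq> 0"
  then have "\<nu> + sgl v 1 \<in> A" "lk (\<nu> + sgl v 1) v \<noteq> 0"
    by (auto simp: lookup_add simp del: of_int_add)
  then show "\<nu> \<in> A" using *(1)[of "\<nu> + sgl v 1"] by simp
qed

lemma diff_sum_in_lin_subspace:
  assumes "lin_subspace W" "\<And>v p. p \<in> W \<Longrightarrow> pdiff v p \<in> W" "\<And>m q. q \<in> W \<Longrightarrow> F m q \<in> W" "p \<in> W"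
  shows "diff_sum U F p \<in> W"
  unfolding diff_sum_def using assms by (intro lin_subspace_Sum_any) auto

lemma when_in_lin_subspace: "lin_subspace W \<Longrightarrow> p \<in> W \<Longrightarrow> (p when b) \<in> W"
  by (simp add: when_def lin_subspace_0)

section \<open>Spaces preserved by all operators of the realization\<close>

context free_field
begin

text \<open>Closure under derivatives and under the variables that occur as coefficients; it is
  applied to \<open>N\<close> and to \<open>I\<close>. The y-variables enter with the factor
  \<open>a\<close>, hence the guard.\<close>

definition stable :: "laurent set \<Rightarrow> bool" where
  "stable W \<longleftrightarrow> lin_subspace W \<and> (\<forall>p\<in>W. (\<forall>v. pdiff v p \<in> W) \<and> (\<forall>n. gen (Xv n) * p \<in> W)
     \<and> (a \<noteq> 0 \<longrightarrow> (\<forall>n>0. gen (Yv n) * p \<in> W)))"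

context
  fixes W assumes W: "stable W"
begin

lemma W_lin_subspace: "lin_subspace W" using W by (simp add: stable_def)
lemma W_pdiff: "p \<in> W \<Longrightarrow> pdiff v p \<in> W" using W by (simp add: stable_def)
lemma W_gen_X: "p \<in> W \<Longrightarrow> gen (Xv n) * p \<in> W" using W by (simp add: stable_def)
lemma W_gen_Y: "p \<in> W \<Longrightarrow> n > 0 \<Longrightarrow> const a * (gen (Yv n) * p) \<in> W"
proof (cases "a = 0")
  case True then show ?thesis using lin_subspace_0[OF W_lin_subspace] by simp
next
  case False
  moreover assume "p \<in> W" "n > 0"
  ultimately show ?thesis using W by (auto simp: stable_def intro!: lin_subspace_const)
qed

lemmas W_intros = lin_subspace_intros[OF W_lin_subspace] W_pdiff W_gen_X

lemma W_deriv_x: "p \<in> W \<Longrightarrow> deriv_x n p \<in> W"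
  unfolding deriv_x_def by (rule diff_sum_in_lin_subspace) (auto intro: W_lin_subspace W_intros)
lemma W_De: "p \<in> W \<Longrightarrow> De n p \<in> W"
  unfolding De_def by (rule diff_sum_in_lin_subspace) (auto intro: W_lin_subspace W_intros W_deriv_x)
lemma W_Bq: "p \<in> W \<Longrightarrow> Bq n p \<in> W"
  unfolding Bq_def by (rule diff_sum_in_lin_subspace) (auto intro: W_lin_subspace W_intros)
lemma W_Ek: "p \<in> W \<Longrightarrow> Ek n p \<in> W"
  unfolding Ek_def by (rule diff_sum_in_lin_subspace) (auto intro!: W_lin_subspace W_intros when_in_lin_subspace)
lemma W_Dx: "p \<in> W \<Longrightarrow> Dx p \<in> W"
  unfolding Dx_def by (rule diff_sum_in_lin_subspace) (auto intro!: W_lin_subspace W_intros simp: mult.assoc)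
lemma W_Ey: "p \<in> W \<Longrightarrow> const a * Ey n p \<in> W"
proof (cases "a = 0")
  case False
  then have "gen (Yv n) * p \<in> W" if "n > 0" "p \<in> W" for n p using that W by (simp add: stable_def)
  then have "Ey n p \<in> W" if "p \<in> W" unfolding Ey_def
    using that by (intro diff_sum_in_lin_subspace) (auto intro!: W_lin_subspace W_intros simp: when_def)
  then show "p \<in> W \<Longrightarrow> const a * Ey n p \<in> W" by (rule lin_subspace_const[OF W_lin_subspace])
qed (simp add: lin_subspace_0 W_lin_subspace)
lemma W_Dy: "p \<in> W \<Longrightarrow> const a * Dy p \<in> W"
proof (cases "a = 0")
  case False
  then have "gen (Yv n) * p \<in> W" if "n > 0" "p \<in> W" for n p using that W by (simp add: stable_def)
  then have "Dy p \<in> W" if "p \<in> W" unfolding Dy_def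
    using that by (intro diff_sum_in_lin_subspace) (auto intro!: W_lin_subspace W_intros simp: when_def mult.assoc)
  then show "p \<in> W \<Longrightarrow> const a * Dy p \<in> W" by (rule lin_subspace_const[OF W_lin_subspace])
qed (simp add: lin_subspace_0 W_lin_subspace)

lemma W_H: "p \<in> W \<Longrightarrow> H n p \<in> W"
proof -
  assume p: "p \<in> W"
  have 1: "- (const 2 * deriv_x n p) \<in> W" by (intro W_intros W_deriv_x p)
  have 2: "(const a * (gen (Yv (nat (- n))) * p) when n < 0) \<in> W"
    using W_gen_Y[OF p, of "nat (- n)"] lin_subspace_0[OF W_lin_subspace] by (simp add: when_def)
  have 3: "(const (2 * of_int n * K) * pdiff (Yv (nat n)) p when n > 0) \<in> W"
    by (intro when_in_lin_subspace W_lin_subspace W_intros p)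
  have 4: "(const J * p when n = 0) \<in> W"
    by (intro when_in_lin_subspace W_lin_subspace W_intros p)
  show ?thesis
    using lin_subspace_add[OF W_lin_subspace lin_subspace_add[OF W_lin_subspace lin_subspace_add[OF W_lin_subspace 1 2] 3] 4]
    by (simp add: H_def mult.assoc)
qed

lemma W_E: "p \<in> W \<Longrightarrow> E n p \<in> W"
  unfolding E_def by (intro lin_subspace_add[OF W_lin_subspace] lin_subspace_minus[OF W_lin_subspace] lin_subspace_const[OF W_lin_subspace] W_De W_Ek W_Ey W_pdiff)

lemma W_D: "p \<in> W \<Longrightarrow> D p \<in> W"
  unfolding D_def by (intro lin_subspace_diff[OF W_lin_subspace] W_Dx W_Dy)

end

section \<open>The action of a general element and the Lie algebra relations\<close>

definition loop_op :: "int \<Rightarrow> complex^2^2 \<Rightarrow> laurent \<Rightarrow> laurent" where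
  "loop_op n A v = const (A $ 1 $ 2) * E n v + const (A $ 2 $ 1) * f_op n v + const (A $ 1 $ 1) * H n v"

definition loop_rep :: "(int \<Rightarrow>\<^sub>0 complex^2^2) \<Rightarrow> laurent \<Rightarrow> laurent" where
  "loop_rep b v = (\<Sum>n\<in>kys b. loop_op n (lk b n) v)"

definition rep :: "affine \<Rightarrow> laurent \<Rightarrow> laurent" where
  "rep = lin_ext E f_op H (\<lambda>v. const K * v) D"

lemma rep_eq: "rep (b, p, q) v = loop_rep b v + const p * (const K * v) + const q * D v"
  by (simp add: rep_def loop_rep_def loop_op_def)

lemma loop_op_0: "loop_op n 0 v = 0" by (simp add: loop_op_def)
lemma loop_op_add: "loop_op n (A + B) v = loop_op n A v + loop_op n B v"
  by (simp add: loop_op_def const_arith algebra_simps)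
lemma loop_op_mscale: "loop_op n (mscale c A) v = const c * loop_op n A v"
  by (simp add: loop_op_def mscale_def const_arith algebra_simps)
lemma lin_op_f_op: "lin_op (f_op n)" unfolding f_op_def [abs_def] by (rule lin_op_mult_left)
lemma lin_op_loop_op: "lin_op (loop_op n A)"
  unfolding loop_op_def [abs_def] by (intro lin_op_plus lin_op_mult lin_op_E lin_op_H lin_op_f_op)

lemma loop_rep_superset:
  assumes "finite A" "kys b \<subseteq> A"
  shows "loop_rep b v = (\<Sum>n\<in>A. loop_op n (lk b n) v)"
  unfolding loop_rep_def
  by (rule sum.mono_neutral_left[OF assms]) (auto simp: in_keys_iff loop_op_0)

lemma loop_rep_add: "loop_rep (b + c) v = loop_rep b v + loop_rep c v"
proof -
  have "loop_rep (b + c) v = (\<Sum>n\<in>kys b \<union> kys c. loop_op n (lk (b + c) n) v)"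
    by (rule loop_rep_superset) (auto simp: Poly_Mapping.keys_add)
  then show ?thesis
    using loop_rep_superset[of "kys b \<union> kys c" b v] loop_rep_superset[of "kys b \<union> kys c" c v]
    by (simp add: lookup_add loop_op_add sum.distrib)
qed

lemma loop_rep_0: "loop_rep 0 v = 0" by (simp add: loop_rep_def)
lemma loop_rep_diff: "loop_rep (b - c) v = loop_rep b v - loop_rep c v"
  using loop_rep_add[of "b - c" c v] by simp
lemma loop_rep_sum: "loop_rep (sum g A) v = (\<Sum>x\<in>A. loop_rep (g x) v)"
  by (induction A rule: infinite_finite_induct) (simp_all add: loop_rep_0 loop_rep_add)
lemma loop_rep_single: "loop_rep (sgl n A) v = loop_op n A v"
  by (subst loop_rep_superset[of "{n}"]) auto
lemma loop_rep_mscale: "loop_rep (Poly_Mapping.map (mscale c) b) v = const c * loop_rep b v"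
proof -
  have 0: "mscale c 0 = 0" by (simp add: mscale_def vec_eq_iff)
  then have lk: "lk (Poly_Mapping.map (mscale c) b) n = mscale c (lk b n)" for n
    by (simp add: Poly_Mapping.map.rep_eq when_def)
  have "loop_rep (Poly_Mapping.map (mscale c) b) v = (\<Sum>n\<in>kys b. loop_op n (lk (Poly_Mapping.map (mscale c) b) n) v)"
    by (rule loop_rep_superset) (auto simp: in_keys_iff lk 0)
  then show ?thesis
    by (simp add: lk loop_op_mscale loop_rep_def sum_distrib_left)
qed

lemma lin_op_loop_rep: "lin_op (loop_rep b)"
  unfolding lin_op_def loop_rep_def
  by (simp add: lin_op_add[OF lin_op_loop_op] lin_op_const[OF lin_op_loop_op] sum.distrib sum_distrib_left)

lemma lin_op_rep: "lin_op (rep x)"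
proof (cases x)
  case (fields b p q)
  have "rep x = (\<lambda>v. loop_rep b v + const p * (const K * v) + const q * D v)"
    by (rule ext) (simp add: fields rep_eq)
  then show ?thesis by (simp only:) (intro lin_op_plus lin_op_mult lin_op_loop_rep lin_op_D lin_op_id)
qed

lemma trace_2: "trace (A :: complex^2^2) = A $ 1 $ 1 + A $ 2 $ 2"
  by (simp add: trace_def sum_2)

text \<open>Tracelessness expresses the entry \<open>(2,2)\<close> by \<open>(1,1)\<close>, so both
  sides become combinations of the elementary relations for \<open>E\<close>, \<open>H\<close> and
  \<open>f_op\<close>.\<close>

lemma loop_op_bracket:
  assumes "trace A = 0" "trace B = 0"
  shows "loop_op m A (loop_op n B v) - loop_op n B (loop_op m A v)
    = loop_op (m + n) (A ** B - B ** A) v + const (of_int m * trace (A ** B) when m = - n) * (const K * v)"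
proof -
  have A: "A $ 2 $ 2 = - A $ 1 $ 1" and B: "B $ 2 $ 2 = - B $ 1 $ 1"
    using assms by (simp_all add: trace_2 eq_neg_iff_add_eq_0 add.commute)
  have mm: "(P ** Q) $ i $ j = P $ i $ 1 * Q $ 1 $ j + P $ i $ 2 * Q $ 2 $ j"
    for P Q :: "complex^2^2" and i j
    by (simp add: matrix_matrix_mult_def sum_2)
  \<comment> \<open>The central contribution, present only for \<open>n = - m\<close>. There
    \<open>nc\<close> trades \<open>n\<close> for \<open>- m\<close>, so that all relations carry
    the same central term.\<close>
  define c where "c = (const K * v when m + n = 0)"
  have nc: "const (of_int n) * c = - (const (of_int m) * c)"
    by (auto simp: c_def when_def add_eq_0_iff const_arith)
  have eqs: "E m (gen (Xv n) * v) = gen (Xv n) * E m v + H (m + n) v + const (of_int m) * c"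
    "E n (gen (Xv m) * v) = gen (Xv m) * E n v + H (m + n) v - const (of_int m) * c"
    "H m (gen (Xv n) * v) = gen (Xv n) * H m v - 2 * (gen (Xv (m + n)) * v)"
    "H n (gen (Xv m) * v) = gen (Xv m) * H n v - 2 * (gen (Xv (m + n)) * v)"
    "H m (E n v) = E n (H m v) + 2 * E (m + n) v" "H n (E m v) = E m (H n v) + 2 * E (m + n) v"
    "H m (H n v) = H n (H m v) + 2 * (const (of_int m) * c)" "E m (E n v) = E n (E m v)"
    unfolding diff_conv_add_uminus nc[symmetric]
    by (auto simp: gen_rules H_E H_H[of m n] E_E[of m n] c_def add.commute[of n m] when_def const_arith;
        simp add: algebra_simps)+
  have tr: "const (of_int m * t when m = - n) * (const K * v) = const t * (const (of_int m) * c)" for t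
    by (auto simp: c_def when_def const_arith algebra_simps)
  show ?thesis
    unfolding loop_op_def trace_2 mm vector_minus_component A B tr
    by (simp add: f_op_def op_simps eqs const_arith mult.left_commute[of "gen _" "const _"]; simp add: algebra_simps)
qed

lemma D_loop_op: "D (loop_op n A v) = loop_op n A (D v) + const (of_int n) * loop_op n A v"
  by (simp add: loop_op_def f_op_def op_simps D_E D_H D_gen_X; simp add: algebra_simps)

lemma D_loop_rep: "D (loop_rep b v) = loop_rep b (D v) + loop_rep (loop_deriv b) v"
  unfolding loop_deriv_def loop_rep_sum loop_rep_single loop_op_mscale
  by (simp add: loop_rep_def lin_op_sum[OF lin_op_D] D_loop_op sum.distrib)

lemma loop_rep_bracket:
  assumes "\<forall>n. trace (lk b n) = 0" "\<forall>n. trace (lk c n) = 0"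
  shows "loop_rep b (loop_rep c v) - loop_rep c (loop_rep b v)
    = loop_rep (loop_bracket b c) v + const (loop_cocycle b c) * (const K * v)"
proof -
  have "loop_rep b (loop_rep c v) = (\<Sum>m\<in>kys b. \<Sum>n\<in>kys c. loop_op m (lk b m) (loop_op n (lk c n) v))"
    by (simp add: loop_rep_def lin_op_sum[OF lin_op_loop_op])
  moreover have "loop_rep c (loop_rep b v) = (\<Sum>m\<in>kys b. \<Sum>n\<in>kys c. loop_op n (lk c n) (loop_op m (lk b m) v))"
    unfolding loop_rep_def lin_op_sum[OF lin_op_loop_op] by (rule sum.swap)
  moreover have "const (sum g A) = (\<Sum>x\<in>A. const (g x))" for g :: "int \<Rightarrow> complex" and A
    by (induction A rule: infinite_finite_induct) (simp_all add: const_add)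
  ultimately show ?thesis
    using loop_op_bracket assms
    by (simp add: loop_bracket_def loop_cocycle_def loop_rep_sum loop_rep_single sum_distrib_right
        flip: sum_subtractf sum.distrib)
qed

lemma rep_add: "rep (x + y) v = rep x v + rep y v"
  by (cases x; cases y) (simp add: rep_eq loop_rep_add const_add; simp add: algebra_simps)

lemma rep_smult: "rep (affine_smult c x) v = const c * rep x v"
  by (cases x) (simp add: rep_eq loop_rep_mscale const_mult; simp add: algebra_simps)

lemma rep_bracket:
  assumes "x \<in> carrier affine_sl2" "y \<in> carrier affine_sl2"
  shows "rep (affine_bracket x y) v = rep x (rep y v) - rep y (rep x v)"
proof (cases x; cases y)
  fix b p q c r s assume x: "x = (b, p, q)" and y: "y = (c, r, s)"
  have "loop_rep b (loop_rep c v) - loop_rep c (loop_rep b v)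
    = loop_rep (loop_bracket b c) v + const (loop_cocycle b c) * (const K * v)"
    using assms by (intro loop_rep_bracket) (simp_all add: x y affine_sl2_def)
  then have "loop_rep (loop_bracket b c) v
     = loop_rep b (loop_rep c v) - loop_rep c (loop_rep b v) - const (loop_cocycle b c) * (const K * v)"
    by (simp add: algebra_simps)
  then show ?thesis
    by (simp add: x y rep_eq loop_rep_add loop_rep_diff loop_rep_mscale D_loop_rep op_simps lin_op_simps[OF lin_op_loop_rep];
        simp add: algebra_simps)
qed

lemma subquotient_rep:
  assumes N: "stable N" and I: "stable I" and IN: "I \<subseteq> N"
  shows "subquotient N I rep"
proof
  have *: "rep x p \<in> W" if W: "stable W" and p: "p \<in> W" for W x p
  proof (cases x)
    case (fields b r q)
    have "loop_op n A p \<in> W" for n A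
      unfolding loop_op_def f_op_def using W p
      by (intro lin_subspace_add lin_subspace_const W_lin_subspace W_E W_H W_gen_X)
    then show ?thesis unfolding fields rep_eq loop_rep_def using W p
      by (intro lin_subspace_add lin_subspace_const lin_subspace_sum W_lin_subspace W_D)
  qed
  show "p \<in> N \<Longrightarrow> rep x p \<in> N" "p \<in> I \<Longrightarrow> rep x p \<in> I" for x p using * N I by auto
qed (use assms in \<open>auto intro: W_lin_subspace simp: lin_op_rep rep_add rep_smult rep_bracket
       simp del: affine_smult.simps affine_bracket.simps\<close>)

lemma loop_op_elementary:
  shows "loop_op n (\<chi> i j. if i = 1 \<and> j = 2 then 1 else 0) v = E n v"
    and "loop_op n (\<chi> i j. if i = 2 \<and> j = 1 then 1 else 0) v = gen (Xv n) * v"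
    and "loop_op n (\<chi> i j. if i = j then (if i = 1 then 1 else - 1) else 0) v = H n v"
  by (simp_all add: loop_op_def f_op_def)

text \<open>\<open>c\<close> is absent because it acts by the scalar \<open>K\<close>, which
  preserves every linear subspace.\<close>

definition inv_op :: "laurent set \<Rightarrow> bool" where
  "inv_op W \<longleftrightarrow> (\<forall>w\<in>W. (\<forall>n. E n w \<in> W \<and> gen (Xv n) * w \<in> W \<and> H n w \<in> W) \<and> D w \<in> W)"

lemma inv_op_iff:
  assumes "lin_subspace W"
  shows "(\<forall>x\<in>carrier affine_sl2. \<forall>w\<in>W. rep x w \<in> W) \<longleftrightarrow> inv_op W"
proof
  assume inv: "\<forall>x\<in>carrier affine_sl2. \<forall>w\<in>W. rep x w \<in> W"
  have loop_op: "loop_op n A w \<in> W" if "trace A = 0" "w \<in> W" for n A w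
  proof -
    have "(sgl n A, 0, 0) \<in> carrier affine_sl2"
      using that(1) by (auto simp: affine_sl2_def lookup_single when_def trace_2)
    then have "rep (sgl n A, 0, 0) w \<in> W" using inv that(2) by blast
    then show ?thesis by (simp add: rep_eq loop_rep_single)
  qed
  have D: "D w \<in> W" if "w \<in> W" for w
  proof -
    have "(0, 0, 1) \<in> carrier affine_sl2" by (simp add: affine_sl2_def trace_2)
    then have "rep (0, 0, 1) w \<in> W" using inv that by blast
    then show ?thesis by (simp add: rep_eq loop_rep_0)
  qed
  show "inv_op W"
    unfolding inv_op_def loop_op_elementary[symmetric]
    by (intro ballI conjI allI loop_op D) (simp_all add: trace_2)
next
  assume inv: "inv_op W"
  show "\<forall>x\<in>carrier affine_sl2. \<forall>w\<in>W. rep x w \<in> W"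
  proof safe
    fix b :: "int \<Rightarrow>\<^sub>0 complex^2^2" and p q w assume "w \<in> W"
    then show "rep (b, p, q) w \<in> W"
      unfolding rep_eq loop_rep_def loop_op_def f_op_def using inv
      by (intro lin_subspace_add lin_subspace_const lin_subspace_sum assms) (auto simp: inv_op_def)
  qed
qed

end

section \<open>Monomial bases of the modules\<close>

definition restrict_to :: "(var \<Rightarrow>\<^sub>0 int) set \<Rightarrow> laurent \<Rightarrow> laurent" where
  "restrict_to A p = (\<Sum>\<nu>\<in>kys p \<inter> A. sgl \<nu> (lk p \<nu>))"

lemma lookup_restrict_to: "lk (restrict_to A p) \<nu> = (if \<nu> \<in> A then lk p \<nu> else 0)"
proof -
  have "lk (restrict_to A p) \<nu> = (\<Sum>\<mu>\<in>kys p \<inter> A. if \<mu> = \<nu> then lk p \<mu> else 0)"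
    unfolding restrict_to_def lookup_sum by (rule sum.cong) (auto simp: lookup_single when_def)
  then show ?thesis by (simp add: in_keys_iff)
qed

text \<open>The product of \<open>T - s\<close> over the eigenvalues \<open>s \<noteq> t\<close>
  occurring in \<open>p\<close> kills every component but the one for \<open>t\<close>, which it
  scales by the nonzero product of the \<open>t - s\<close>.\<close>

lemma diagonal_restrict_to:
  assumes W: "lin_subspace W" and T: "\<And>p. p \<in> W \<Longrightarrow> T p \<in> W"
    and diag: "\<And>p \<nu>. lk (T p) \<nu> = \<tau> \<nu> * lk p \<nu>" and p: "p \<in> W"
  shows "restrict_to {\<nu>. \<tau> \<nu> = t} p \<in> W"
proof -
  have "\<exists>q\<in>W. \<forall>\<nu>. lk q \<nu> = (\<Prod>s\<in>F. \<tau> \<nu> - s) * lk p \<nu>" if "finite F" for F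
    using that
  proof induction
    case empty then show ?case using p by (intro bexI[of _ p]) auto
  next
    case (insert s F)
    then obtain q where q: "q \<in> W" "\<And>\<nu>. lk q \<nu> = (\<Prod>s\<in>F. \<tau> \<nu> - s) * lk p \<nu>" by blast
    have "T q - const s * q \<in> W" by (intro lin_subspace_diff lin_subspace_const W T q(1))
    moreover have "lk (T q - const s * q) \<nu> = (\<Prod>s\<in>insert s F. \<tau> \<nu> - s) * lk p \<nu>" for \<nu>
      using insert.hyps by (simp add: lookup_minus diag q(2); simp add: algebra_simps)
    ultimately show ?case by blast
  qed
  from this[of "\<tau> ` kys p - {t}"] obtain q where q: "q \<in> W"
    "\<And>\<nu>. lk q \<nu> = (\<Prod>s\<in>\<tau> ` kys p - {t}. \<tau> \<nu> - s) * lk p \<nu>" by auto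
  define c where "c = (\<Prod>s\<in>\<tau> ` kys p - {t}. t - s)"
  have c: "c \<noteq> 0" by (simp add: c_def)
  have "lk q \<nu> = lk (const c * restrict_to {\<nu>. \<tau> \<nu> = t} p) \<nu>" for \<nu>
  proof (cases "\<tau> \<nu> = t")
    case False
    then have "lk q \<nu> = 0" unfolding q(2) by (cases "lk p \<nu> = 0") (auto simp: in_keys_iff)
    then show ?thesis using False by (simp add: lookup_restrict_to)
  qed (simp add: q(2) c_def lookup_restrict_to)
  then have "q = const c * restrict_to {\<nu>. \<tau> \<nu> = t} p" by (rule poly_mapping_eqI)
  then show ?thesis using q(1) lin_subspace_const_iff[OF W c] by simp
qed

definition xdeg :: "(var \<Rightarrow>\<^sub>0 int) \<Rightarrow> int" where
  "xdeg \<nu> = Sum_any (\<lambda>m. lk \<nu> (Xv m))"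

lemma finite_X_support: "finite {m. lk \<nu> (Xv m) \<noteq> 0}"
  by (rule finite_subset[OF _ finite_vimageI[OF finite_keys inj_Xv, of \<nu>]]) (auto simp: in_keys_iff)

text \<open>\<open>deriv_x 0\<close> is the Euler operator of the x-variables.\<close>

lemma lookup_deriv_x_0: "lk (deriv_x 0 p) \<nu> = of_int (xdeg \<nu>) * lk p \<nu>"
proof -
  have mon: "deriv_x 0 (monom \<mu>) = const (of_int (xdeg \<mu>)) * monom \<mu>" for \<mu>
  proof -
    let ?A = "{m. lk \<mu> (Xv m) \<noteq> 0}"
    have "deriv_x 0 (monom \<mu>) = Sum_any (\<lambda>m. sgl \<mu> (of_int (lk \<mu> (Xv m))))"
      unfolding deriv_x_def diff_sum_def by simp
    also have "\<dots> = (\<Sum>m\<in>?A. sgl \<mu> (of_int (lk \<mu> (Xv m))))"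
      by (rule Sum_any.expand_superset[OF finite_X_support]) (auto simp: single_zero)
    also have "\<dots> = sgl \<mu> (of_int (\<Sum>m\<in>?A. lk \<mu> (Xv m)))"
      by (rule poly_mapping_eqI) (simp add: lookup_sum lookup_single when_def)
    also have "(\<Sum>m\<in>?A. lk \<mu> (Xv m)) = xdeg \<mu>"
      by (simp add: xdeg_def Sum_any.expand_set)
    finally show ?thesis by (simp add: const_mult_single)
  qed
  have "deriv_x 0 p = deriv_x 0 (\<Sum>\<mu>\<in>kys p. const (lk p \<mu>) * monom \<mu>)" using laurent_expansion[of p] by simp
  also have "\<dots> = (\<Sum>\<mu>\<in>kys p. const (lk p \<mu>) * (const (of_int (xdeg \<mu>)) * monom \<mu>))"
    by (simp add: lin_op_sum[OF lin_op_deriv_x] lin_op_const[OF lin_op_deriv_x] mon)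
  also have "lk \<dots> \<nu> = (\<Sum>\<mu>\<in>kys p. if \<mu> = \<nu> then of_int (xdeg \<mu>) * lk p \<mu> else 0)"
    unfolding lookup_sum by (rule sum.cong) (auto simp: lookup_single when_def)
  finally show ?thesis by (simp add: in_keys_iff)
qed

text \<open>One setting for \<open>M_S\<close>, \<open>M_iS\<close> and \<open>M_i\<close>:
  \<open>P\<close> holds the variables that may be inverted, and \<open>a\<close> decides whether
  y-variables are present.\<close>

locale laurent_space = free_field +
  fixes P :: "var set"
  assumes finite_P: "finite P" and P_V: "P \<subseteq> range Xv \<union> {Yv k |k. k > 0 \<and> a \<noteq> 0}"
begin

definition V :: "var set" where "V = range Xv \<union> {Yv k |k. k > 0 \<and> a \<noteq> 0}"
definition exps_N :: "(var \<Rightarrow>\<^sub>0 int) set" where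
  "exps_N = {\<nu>. \<forall>v. (lk \<nu> v \<noteq> 0 \<longrightarrow> v \<in> V) \<and> (lk \<nu> v < 0 \<longrightarrow> v \<in> P)}"
text \<open>Exponents of the basis monomials of \<open>N / I\<close>: a monomial falls into
  \<open>I\<close> as soon as one polar variable has a nonnegative exponent. For
  \<open>P = {}\<close> this gives \<open>I = {0}\<close>.\<close>

definition exps_M :: "(var \<Rightarrow>\<^sub>0 int) set" where
  "exps_M = {\<nu> \<in> exps_N. \<forall>v\<in>P. lk \<nu> v < 0}"
abbreviation N :: "laurent set" where "N \<equiv> monom_span exps_N"
abbreviation I :: "laurent set" where "I \<equiv> monom_span (exps_N - exps_M)"

lemma PV: "v \<in> P \<Longrightarrow> v \<in> V" using P_V by (auto simp: V_def)

lemma exps_N_D: "\<nu> \<in> exps_N \<Longrightarrow> lk \<nu> v \<noteq> 0 \<Longrightarrow> v \<in> V" "\<nu> \<in> exps_N \<Longrightarrow> lk \<nu> v < 0 \<Longrightarrow> v \<in> P"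
  by (simp_all add: exps_N_def)

lemma lookup_up: "lk (\<nu> + sgl v 1) w = (if w = v then lk \<nu> w + 1 else lk \<nu> w :: int)"
  by (simp add: lookup_add lookup_single)
lemma lookup_down: "lk (\<nu> - sgl v 1) w = (if w = v then lk \<nu> w - 1 else lk \<nu> w :: int)"
  by (simp add: lookup_minus lookup_single)

lemma exps_N_add:
  assumes "\<nu> \<in> exps_N" "v \<in> V"
  shows "\<nu> + sgl v 1 \<in> exps_N"
  unfolding exps_N_def
proof (intro CollectI allI conjI impI)
  fix w
  show "lk (\<nu> + sgl v 1) w \<noteq> 0 \<Longrightarrow> w \<in> V"
    using assms exps_N_D(1)[of \<nu> w] by (cases "w = v") (simp_all add: lookup_up)
  show "lk (\<nu> + sgl v 1) w < 0 \<Longrightarrow> w \<in> P"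
    using exps_N_D(2)[OF assms(1), of w] by (cases "w = v") (simp_all add: lookup_up)
qed

lemma exps_N_diff:
  assumes "\<nu> \<in> exps_N" "lk \<nu> v > 0 \<or> v \<in> P"
  shows "\<nu> - sgl v 1 \<in> exps_N"
  unfolding exps_N_def
proof (intro CollectI allI conjI impI)
  fix w
  have "v \<in> V" using assms PV exps_N_D(1)[OF assms(1), of v] by auto
  then show "lk (\<nu> - sgl v 1) w \<noteq> 0 \<Longrightarrow> w \<in> V"
    using exps_N_D(1)[OF assms(1), of w] by (cases "w = v") (simp_all add: lookup_down)
  show "lk (\<nu> - sgl v 1) w < 0 \<Longrightarrow> w \<in> P"
    using exps_N_D(2)[OF assms(1), of w] assms(2) by (cases "w = v") (auto simp: lookup_down)
qed

lemma exps_N_pdiff: "\<nu> \<in> exps_N \<Longrightarrow> lk \<nu> v \<noteq> 0 \<Longrightarrow> \<nu> - sgl v 1 \<in> exps_N"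
  using exps_N_diff[of \<nu> v] exps_N_D(2)[of \<nu> v] by linarith

lemma exps_N_exps_M_iff: "\<nu> \<in> exps_N - exps_M \<longleftrightarrow> \<nu> \<in> exps_N \<and> (\<exists>v\<in>P. 0 \<le> lk \<nu> v)"
  by (auto simp: exps_M_def not_less)

lemma stable_N: "stable N"
  unfolding stable_def
proof (intro conjI ballI allI impI lin_subspace_monom_span)
  fix p assume p: "p \<in> N"
  show "pdiff v p \<in> N" for v
    by (rule pdiff_monom_span[OF exps_N_pdiff p])
  show "gen (Xv n) * p \<in> N" for n
    by (rule gen_monom_span[OF exps_N_add p]) (auto simp: V_def)
  show "gen (Yv n) * p \<in> N" if "a \<noteq> 0" "n > 0" for n
    by (rule gen_monom_span[OF exps_N_add p]) (use that in \<open>auto simp: V_def\<close>)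
qed

lemma stable_I: "stable I"
  unfolding stable_def
proof (intro conjI ballI allI impI lin_subspace_monom_span)
  fix p assume p: "p \<in> I"
  have g: "\<nu> + sgl v 1 \<in> exps_N - exps_M" if nv: "\<nu> \<in> exps_N - exps_M" "v \<in> V" for \<nu> v
  proof -
    obtain w where "\<nu> \<in> exps_N" "w \<in> P" "lk \<nu> w \<ge> 0" using nv(1) unfolding exps_N_exps_M_iff by blast
    then show ?thesis unfolding exps_N_exps_M_iff using exps_N_add nv(2)
      by (intro conjI bexI[of _ w]) (auto simp: lookup_up)
  qed
  have d: "\<nu> - sgl v 1 \<in> exps_N - exps_M" if nv: "\<nu> \<in> exps_N - exps_M" "lk \<nu> v \<noteq> 0" for \<nu> v
  proof -
    obtain w where "\<nu> \<in> exps_N" "w \<in> P" "lk \<nu> w \<ge> 0" using nv(1) unfolding exps_N_exps_M_iff by blast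
    then show ?thesis unfolding exps_N_exps_M_iff using exps_N_pdiff nv(2)
      by (intro conjI bexI[of _ w]) (auto simp: lookup_down)
  qed
  show "pdiff v p \<in> I" for v
    by (rule pdiff_monom_span[OF d p])
  show "gen (Xv n) * p \<in> I" for n
    by (rule gen_monom_span[OF g p]) (auto simp: V_def)
  show "gen (Yv n) * p \<in> I" if "a \<noteq> 0" "n > 0" for n
    by (rule gen_monom_span[OF g p]) (use that in \<open>auto simp: V_def\<close>)
qed

sublocale sq: subquotient N I rep
  by (rule subquotient_rep[OF stable_N stable_I]) (auto intro!: monom_span_mono)

lemma I_iff: "p \<in> N \<Longrightarrow> p \<in> I \<longleftrightarrow> (\<forall>\<nu>\<in>exps_M. lk p \<nu> = 0)"
  by (auto simp: monom_span_lookup)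

lemma restrict_to_exps_M: "p \<in> N \<Longrightarrow> p - restrict_to exps_M p \<in> I" "restrict_to exps_M p \<in> monom_span exps_M"
  by (auto simp: monom_span_lookup lookup_minus lookup_restrict_to split: if_splits)

lemma exps_M_exps_N: "\<nu> \<in> exps_M \<Longrightarrow> \<nu> \<in> exps_N" by (simp add: exps_M_def)

text \<open>For exponents in \<open>exps_M\<close>, the distance from the ground value, which is
  \<open>-1\<close> at a polar variable and \<open>0\<close> elsewhere. \<open>excess\<close> totals
  it over \<open>U\<close>, and \<open>lower\<close> goes one step towards the ground value.\<close>

definition excess1 :: "(var \<Rightarrow>\<^sub>0 int) \<Rightarrow> var \<Rightarrow> nat" where
  "excess1 \<nu> v = (if v \<in> P then nat (- lk \<nu> v - 1) else nat (lk \<nu> v))"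
definition excess :: "var set \<Rightarrow> (var \<Rightarrow>\<^sub>0 int) \<Rightarrow> nat" where
  "excess U \<nu> = Sum_any (\<lambda>v. if v \<in> U then excess1 \<nu> v else 0)"
definition lower :: "var \<Rightarrow> (var \<Rightarrow>\<^sub>0 int) \<Rightarrow> (var \<Rightarrow>\<^sub>0 int)" where
  "lower v \<nu> = (if v \<in> P then \<nu> + sgl v 1 else \<nu> - sgl v 1)"

lemma finite_excess: "finite {v. (if v \<in> U then excess1 \<nu> v else 0) \<noteq> 0}"
  by (rule finite_subset[of _ "P \<union> kys \<nu>"]) (auto simp: finite_P excess1_def in_keys_iff split: if_splits)

lemma excess_eq_0: "excess U \<nu> = 0 \<longleftrightarrow> (\<forall>v\<in>U. excess1 \<nu> v = 0)"
  unfolding excess_def by (subst Sum_any_eq_zero_iff[OF finite_excess]) (auto simp: fun_eq_iff)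

lemma lower_exps_M:
  assumes "\<nu> \<in> exps_M" "excess1 \<nu> v > 0"
  shows "lower v \<nu> \<in> exps_M"
proof (cases "v \<in> P")
  case True
  then have "lk \<nu> v < -1" using assms(2) by (simp add: excess1_def)
  then show ?thesis using exps_N_add[of \<nu> v] PV[OF True] assms(1) True
    by (simp add: exps_M_def lower_def lookup_up)
next
  case False
  then show ?thesis using exps_N_diff[of \<nu> v] assms
    by (auto simp: exps_M_def lower_def lookup_down excess1_def)
qed

lemma excess1_lower: "excess1 \<nu> v > 0 \<Longrightarrow> excess1 \<nu> w = excess1 (lower v \<nu>) w + (1 when w = v)"
  by (cases "w = v") (auto simp: excess1_def lower_def lookup_up lookup_down)

lemma excess_lower:
  assumes "\<nu> \<in> exps_M" "excess1 \<nu> v > 0" "v \<in> U"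
  shows "excess U \<nu> = Suc (excess U (lower v \<nu>))"
proof -
  have fin1: "finite {w. ((1 :: nat) when w = v) \<noteq> 0}"
    by (rule finite_subset[of _ "{v}"]) (auto simp: when_def)
  have "excess U \<nu> = Sum_any (\<lambda>w. (if w \<in> U then excess1 (lower v \<nu>) w else 0) + (1 when w = v))"
    unfolding excess_def by (rule Sum_any.cong) (use assms(3) excess1_lower[OF assms(2)] in \<open>auto simp: when_def\<close>)
  also have "\<dots> = excess U (lower v \<nu>) + 1"
    unfolding excess_def by (subst Sum_any.distrib[OF finite_excess fin1]) simp
  finally show ?thesis by simp
qed

text \<open>In \<open>N / I\<close> multiplication by a polar variable plays the part that
  differentiation plays for the others: it moves a basis monomial one step down and kills it at the
  ground value. \<open>raise_op\<close> exchanges the two.\<close>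

definition lower_op :: "var \<Rightarrow> laurent \<Rightarrow> laurent" where
  "lower_op v p = (if v \<in> P then gen v * p else pdiff v p)"

lemma lookup_lower_op:
  assumes "\<nu> \<in> exps_M" "excess1 \<nu> v > 0"
  shows "\<exists>c. c \<noteq> 0 \<and> (\<forall>p. lk (lower_op v p) (lower v \<nu>) = c * lk p \<nu>)"
proof (cases "v \<in> P")
  case True
  then show ?thesis by (intro exI[of _ 1]) (simp add: lower_op_def lower_def)
next
  case False
  then have "of_int (lk \<nu> v) \<noteq> (0::complex)" using assms(2) by (simp add: excess1_def)
  moreover have "lk (lower_op v p) (lower v \<nu>) = of_int (lk \<nu> v) * lk p \<nu>" for p
    using False by (simp add: lower_op_def lower_def lookup_pdiff lookup_minus)
  ultimately show ?thesis by blast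
qed

definition raise_op :: "var \<Rightarrow> laurent \<Rightarrow> laurent" where
  "raise_op v p = (if v \<in> P then pdiff v p else gen v * p)"

lemma raise_op_lower:
  assumes "\<nu> \<in> exps_M" "excess1 \<nu> v > 0"
  shows "\<exists>c. c \<noteq> 0 \<and> raise_op v (monom (lower v \<nu>)) = const c * monom \<nu>"
proof (cases "v \<in> P")
  case True
  then have "lk \<nu> v + 1 \<noteq> 0" using assms(2) by (simp add: excess1_def)
  then have "of_int (lk \<nu> v + 1) \<noteq> (0 :: complex)" by (simp del: of_int_add)
  moreover have "raise_op v (monom (lower v \<nu>)) = const (of_int (lk \<nu> v + 1)) * monom \<nu>"
    using True by (simp add: raise_op_def lower_def lookup_add const_mult_single)
  ultimately show ?thesis by blast
next
  case False
  then show ?thesis by (intro exI[of _ 1]) (simp add: raise_op_def lower_def)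
qed

text \<open>Induction on the excess: a monomial with positive excess at \<open>v\<close> is, up to a
  nonzero factor, \<open>raise_op v\<close> of the monomial one step below it.\<close>

lemma raise_all:
  assumes W: "lin_subspace W" and A: "A \<subseteq> exps_M"
    and low: "\<And>v \<nu>. v \<in> U \<Longrightarrow> \<nu> \<in> A \<Longrightarrow> excess1 \<nu> v > 0 \<Longrightarrow> lower v \<nu> \<in> A"
    and raise: "\<And>v p. v \<in> U \<Longrightarrow> p \<in> W \<Longrightarrow> p \<in> monom_span A \<Longrightarrow> raise_op v p \<in> W"
    and base: "\<And>\<nu>. \<nu> \<in> A \<Longrightarrow> excess U \<nu> = 0 \<Longrightarrow> monom \<nu> \<in> W"
    and \<nu>: "\<nu> \<in> A"
  shows "monom \<nu> \<in> W"
  using \<nu>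
proof (induction "excess U \<nu>" arbitrary: \<nu>)
  case 0 then show ?case using base by simp
next
  case (Suc n)
  then obtain v where v: "v \<in> U" "excess1 \<nu> v > 0" using excess_eq_0[of U \<nu>] by auto
  have \<nu>: "\<nu> \<in> exps_M" using Suc A by blast
  have "lower v \<nu> \<in> A" using low v Suc by blast
  moreover have "excess U (lower v \<nu>) = n" using excess_lower[OF \<nu> v(2,1)] Suc by simp
  ultimately have "monom (lower v \<nu>) \<in> W" "monom (lower v \<nu>) \<in> monom_span A"
    using Suc by (auto simp: monom_in_monom_span)
  then have "raise_op v (monom (lower v \<nu>)) \<in> W" by (intro raise v)
  then show ?case using raise_op_lower[OF \<nu> v(2)] lin_subspace_const_iff[OF W] by auto
qed

text \<open>A \<open>lower_op\<close> at a variable where some monomial of \<open>p\<close> has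
  positive excess lowers the excess of every surviving monomial by one and leaves a nonzero vector.
  Once all excesses are zero, \<open>uniq\<close> forces a multiple of one monomial.\<close>

lemma lower_all:
  assumes W: "lin_subspace W" and A: "A \<subseteq> exps_M" and IW: "I \<subseteq> W"
    and low: "\<And>v \<nu>. v \<in> U \<Longrightarrow> \<nu> \<in> A \<Longrightarrow> excess1 \<nu> v > 0 \<Longrightarrow> lower v \<nu> \<in> A"
    and up: "\<And>v \<nu>. v \<in> U \<Longrightarrow> \<nu> \<in> exps_M \<Longrightarrow> excess1 \<nu> v > 0 \<Longrightarrow> lower v \<nu> \<in> A \<Longrightarrow> \<nu> \<in> A"
    and loop_op: "\<And>v p. v \<in> U \<Longrightarrow> p \<in> W \<Longrightarrow> p \<in> monom_span A \<Longrightarrow> lower_op v p \<in> W"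
    and UV: "U \<subseteq> V"
    and uniq: "\<And>\<mu> \<nu>. \<mu> \<in> A \<Longrightarrow> \<nu> \<in> A \<Longrightarrow> excess U \<mu> = 0 \<Longrightarrow> excess U \<nu> = 0 \<Longrightarrow> \<mu> = \<nu>"
    and p: "p \<in> W" "p \<in> monom_span A" "p \<noteq> 0"
  shows "\<exists>\<nu>\<in>A. excess U \<nu> = 0 \<and> monom \<nu> \<in> W"
proof -
  have "\<exists>\<nu>\<in>A. excess U \<nu> = 0 \<and> monom \<nu> \<in> W" 
    if "p \<in> W" "p \<in> monom_span A" "p \<noteq> 0" "\<And>\<nu>. \<nu> \<in> kys p \<Longrightarrow> excess U \<nu> \<le> n" for n p
    using that
  proof (induction n arbitrary: p)
    case 0
    obtain \<nu> where \<nu>: "lk p \<nu> \<noteq> 0" using 0(3) by (metis poly_mapping_eqI lookup_zero)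
    have key: "\<mu> \<in> A \<and> excess U \<mu> = 0" if "lk p \<mu> \<noteq> 0" for \<mu>
      using 0 that by (auto simp: monom_span_lookup in_keys_iff)
    have "p = const (lk p \<nu>) * monom \<nu>"
    proof (rule poly_mapping_eqI)
      fix \<mu> show "lk p \<mu> = lk (const (lk p \<nu>) * monom \<nu>) \<mu>"
        using uniq[OF _ _ _ _, of \<nu> \<mu>] key[of \<mu>] key[OF \<nu>]
        by (cases "lk p \<mu> = 0") (auto simp: lookup_single when_def)
    qed
    then have "monom \<nu> \<in> W" using lin_subspace_const_iff[OF W \<nu>] 0(1) by metis
    then show ?case using key[OF \<nu>] by blast
  next
    case (Suc n)
    show ?case
    proof (cases "\<forall>\<nu>\<in>kys p. excess U \<nu> \<le> n")
      case True then show ?thesis using Suc by blast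
    next
      case False
      then obtain \<nu> where \<nu>: "lk p \<nu> \<noteq> 0" "excess U \<nu> \<noteq> 0" by (auto simp: in_keys_iff)
      then obtain v where v: "v \<in> U" "excess1 \<nu> v > 0" using excess_eq_0[of U \<nu>] by auto
      \<comment> \<open>\<open>lower_op\<close> may push monomials into \<open>I\<close>; dropping
        them changes the vector by an element of \<open>I\<close>, hence of
        \<open>W\<close>.\<close>
      define q where "q = restrict_to exps_M (lower_op v p)"
      have \<nu>A: "\<nu> \<in> A" using \<nu>(1) Suc(3) by (auto simp: monom_span_lookup)
      have pN: "p \<in> N" using Suc(3) A exps_M_exps_N by (auto simp: monom_span_lookup)
      have "lower_op v p \<in> N"
        using stable_N v(1) UV pN by (auto simp: lower_op_def stable_def V_def)
      moreover have "lower_op v p \<in> W" by (intro loop_op v Suc)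
      ultimately have "q \<in> W"
        using lin_subspace_cong[OF W, of "lower_op v p" q] restrict_to_exps_M[of "lower_op v p"] IW q_def by blast
      have keyq: "\<exists>\<mu>'\<in>kys p. \<mu> = lower v \<mu>' \<and> excess1 \<mu>' v > 0 \<and> \<mu>' \<in> exps_M" if "lk q \<mu> \<noteq> 0" for \<mu>
      proof -
        have \<mu>: "\<mu> \<in> exps_M" "lk (lower_op v p) \<mu> \<noteq> 0"
          using that by (auto simp: q_def lookup_restrict_to split: if_splits)
        show ?thesis
        proof (cases "v \<in> P")
          case True
          have "lk p (\<mu> - sgl v 1) \<noteq> 0" using \<mu> True by (simp add: lower_op_def)
          moreover have "excess1 (\<mu> - sgl v 1) v > 0"
            using \<mu>(1) True by (auto simp: exps_M_def excess1_def lookup_minus)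
          ultimately show ?thesis using True Suc(3) A
            by (intro bexI[of _ "\<mu> - sgl v 1"]) (auto simp: lower_def in_keys_iff monom_span_lookup)
        next
          case False
          have "lk p (\<mu> + sgl v 1) \<noteq> 0" using \<mu> False by (simp add: lower_op_def lookup_pdiff)
          moreover have "excess1 (\<mu> + sgl v 1) v > 0"
            using \<mu>(1) False by (force simp: exps_M_def exps_N_def excess1_def lookup_add)
          ultimately show ?thesis using False Suc(3) A
            by (intro bexI[of _ "\<mu> + sgl v 1"]) (auto simp: lower_def in_keys_iff monom_span_lookup)
        qed
      qed
      have "q \<in> monom_span A"
        unfolding monom_span_lookup using keyq low v(1) Suc(3) by (fastforce simp: monom_span_def)
      moreover have "q \<noteq> 0"
      proof -
        have "\<nu> \<in> exps_M" using \<nu>A A by blast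
        then have "lk q (lower v \<nu>) \<noteq> 0"
          using lookup_lower_op[OF _ v(2)] \<nu>(1) lower_exps_M[OF _ v(2)] by (auto simp: q_def lookup_restrict_to)
        then show ?thesis by auto
      qed
      moreover have "excess U \<mu> \<le> n" if \<mu>: "\<mu> \<in> kys q" for \<mu>
      proof -
        obtain \<mu>' where \<mu>': "\<mu>' \<in> kys p" "\<mu> = lower v \<mu>'" "excess1 \<mu>' v > 0" "\<mu>' \<in> exps_M"
          using keyq[of \<mu>] \<mu> unfolding in_keys_iff by blast
        then show ?thesis using excess_lower[OF \<mu>'(4,3) v(1)] Suc(5)[OF \<mu>'(1)] by simp
      qed
      ultimately show ?thesis using Suc.IH \<open>q \<in> W\<close> by blast
    qed
  qed
  from this[OF p, of "Max (excess U ` kys p)"] show ?thesis by simp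
qed

end

section \<open>The irreducible modules without a polar \<open>x\<close>-variable\<close>

abbreviation x_pow :: "int \<Rightarrow> int \<Rightarrow> laurent" where "x_pow i n \<equiv> monom (sgl (Xv i) n)"

lemma gen_x_pow: "gen (Xv i) * (x_pow i n * q) = x_pow i (n + 1) * q"
  by (simp add: single_add flip: mult.assoc)

lemma gen_cancel: "gen v * p = 0 \<longleftrightarrow> p = 0"
proof
  assume "gen v * p = 0"
  then have "monom (- sgl v 1) * (gen v * p) = 0" by simp
  then show "p = 0" by (simp add: gen_def mult_single flip: mult.assoc)
qed simp

text \<open>Two-sided induction, the downward step cancelling the variable. Identities for integral
  powers of \<open>x_i\<close> become a check at \<open>m = 0\<close> and a recursion.\<close>

lemma shift_eq_0:
  fixes F :: "int \<Rightarrow> laurent"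
  assumes "\<And>m. F (m + 1) = gen v * F m" "F 0 = 0"
  shows "F m = 0"
proof (induction m rule: int_induct[where k = 0])
  case base show ?case by (rule assms(2))
next
  case (step1 m) then show ?case using assms(1)[of m] by simp
next
  case (step2 m) then show ?case using assms(1)[of "m - 1"] by (simp add: gen_cancel)
qed

lemma lookup_gen_power: "lk (gen v ^ n * p) \<nu> = lk p (\<nu> - sgl v (int n))"
  by (induction n arbitrary: \<nu>) (simp_all add: mult.assoc single_add diff_diff_add add.commute)

definition Xfree :: "laurent \<Rightarrow> bool" where "Xfree q \<longleftrightarrow> (\<forall>m. pdiff (Xv m) q = 0)"

section \<open>The \<open>sl_2\<close> relations on powers of \<open>x_i\<close>, and
  weights\<close>

context free_field
begin

text \<open>The bracket of \<open>e_(-i)\<close> and \<open>f_i\<close>, that is, the Cartan element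
  of their copy of \<open>sl_2\<close>.\<close>

definition H_shift :: "int \<Rightarrow> laurent \<Rightarrow> laurent" where "H_shift i p = H 0 p - const (of_int i * K) * p"

lemma E_gen_i: "E (- i) (gen (Xv i) * p) = gen (Xv i) * E (- i) p + H_shift i p"
  by (simp add: E_gen_X H_shift_def const_arith; simp add: algebra_simps)

lemma x_pow_shift:
  "x_pow i (m + 1) * r = gen (Xv i) * (gen (Xv i) * (x_pow i (m - 1) * r))"
  "x_pow i m * r = gen (Xv i) * (x_pow i (m - 1) * r)"
  unfolding gen_x_pow by simp_all

lemma H_x_pow: "H n (x_pow i m * q) = x_pow i m * H n q - const (2 * of_int m) * (gen (Xv (n + i)) * (x_pow i (m - 1) * q))"
proof -
  define F where "F m = H n (x_pow i m * q) - x_pow i m * H n q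
    + const (2 * of_int m) * (gen (Xv (n + i)) * (x_pow i (m - 1) * q))" for m
  have "F (m + 1) = gen (Xv i) * F m" for m
  proof -
    \<comment> \<open>An opaque name keeps the simplifier from merging the power with the variables
      in front of it.\<close>
    define A where "A = x_pow i (m - 1)"
    show ?thesis
      unfolding F_def add_diff_cancel_right' x_pow_shift[where m = m] A_def[symmetric]
      by (simp add: H_gen_X const_arith; simp add: algebra_simps)
  qed
  moreover have "F 0 = 0" by (simp add: F_def)
  ultimately have "F m = 0" by (rule shift_eq_0)
  then show ?thesis by (simp add: F_def algebra_simps)
qed

lemma H_shift_x_pow: "H_shift i (x_pow i m * q) = x_pow i m * H_shift i q - const (2 * of_int m) * (x_pow i m * q)"
proof -
  have "H 0 (x_pow i m * q) = x_pow i m * H 0 q - const (2 * of_int m) * (x_pow i m * q)"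
    using H_x_pow[of 0 i m q] by (simp only: add_0_left x_pow_shift(2)[symmetric])
  moreover define A where "A = x_pow i m"
  ultimately show ?thesis unfolding H_shift_def A_def[symmetric] by (simp add: algebra_simps)
qed

text \<open>The usual \<open>sl_2\<close> formula for moving \<open>e\<close> past a power of
  \<open>f\<close>, here for negative powers as well.\<close>

lemma E_x_pow: "E (- i) (x_pow i m * q) = x_pow i m * E (- i) q + const (of_int m) * (x_pow i (m - 1) * H_shift i q)
    - const (of_int (m * (m - 1))) * (x_pow i (m - 1) * q)"
proof -
  define F where "F m = E (- i) (x_pow i m * q) - x_pow i m * E (- i) q - const (of_int m) * (x_pow i (m - 1) * H_shift i q)
    + const (of_int (m * (m - 1))) * (x_pow i (m - 1) * q)" for m
  have "F (m + 1) = gen (Xv i) * F m" for m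
  proof -
    define A where "A = x_pow i (m - 1)"
    have h: "H_shift i (gen (Xv i) * (A * q)) = gen (Xv i) * (A * H_shift i q) - const (2 * of_int m) * (gen (Xv i) * (A * q))"
      using H_shift_x_pow[of i m q] unfolding x_pow_shift(2)[where m = m] A_def[symmetric] .
    show ?thesis
      unfolding F_def add_diff_cancel_right' x_pow_shift[where m = m] A_def[symmetric]
      by (simp add: E_gen_i[of i "gen (Xv i) * (A * q)"] h const_arith; simp add: algebra_simps)
  qed
  moreover have "F 0 = 0" by (simp add: F_def)
  ultimately have "F m = 0" by (rule shift_eq_0)
  then show ?thesis by (simp add: F_def algebra_simps)
qed

lemma Xfree_deriv_x: "Xfree q \<Longrightarrow> deriv_x n q = 0"
  by (simp add: deriv_x_def diff_sum_def Xfree_def)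

text \<open>Every term of \<open>E n\<close> contains a derivative by an x-variable.\<close>

lemma Xfree_E: "Xfree q \<Longrightarrow> E n q = 0"
proof -
  assume q: "Xfree q"
  have "De n q = 0" using q by (simp add: De_def diff_sum_def Xfree_def lin_op_0[OF lin_op_deriv_x])
  moreover have "Ey n q = 0" using q by (simp add: Ey_def diff_sum_def Xfree_def)
  moreover have "Ek n q = 0" using q by (simp add: Ek_def diff_sum_def Xfree_def pdiff_commute[of "Xv _" "Yv _"])
  ultimately show "E n q = 0" using q by (simp add: E_def Xfree_def)
qed

lemma Xfree_H:
  "Xfree q \<Longrightarrow> H n q = (const a * gen (Yv (nat (- n))) * q when n < 0)
     + (const (2 * of_int n * K) * pdiff (Yv (nat n)) q when n > 0) + (const J * q when n = 0)"
  by (simp add: H_def Xfree_deriv_x)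

lemma lookup_H_0: "lk (H 0 p) \<nu> = (J - 2 * of_int (xdeg \<nu>)) * lk p \<nu>"
proof -
  have "H 0 p = const (- 2) * deriv_x 0 p + const J * p" by (simp add: H_def const_minus)
  then show ?thesis by (simp only: lookup_add lookup_const_mult lookup_deriv_x_0) (simp add: algebra_simps)
qed

definition h_weight :: "complex \<Rightarrow> laurent \<Rightarrow> bool" where "h_weight c p \<longleftrightarrow> H 0 p = const c * p"

lemma h_weight_iff: "h_weight c p \<longleftrightarrow> (\<forall>\<nu>. lk p \<nu> \<noteq> 0 \<longrightarrow> J - 2 * of_int (xdeg \<nu>) = c)"
  unfolding h_weight_def poly_mapping_eq_iff fun_eq_iff by (auto simp: lookup_H_0)

lemma h_weight_E: "h_weight c p \<Longrightarrow> h_weight (c + 2) (E n p)"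
  by (simp add: h_weight_def H_E op_simps const_arith; simp add: algebra_simps)
lemma h_weight_H: "h_weight c p \<Longrightarrow> h_weight c (H n p)"
  using H_H[of 0 n p] by (simp add: h_weight_def op_simps when_def)
lemma h_weight_X: "h_weight c p \<Longrightarrow> h_weight (c - 2) (gen (Xv n) * p)"
  by (simp add: h_weight_def H_gen_X op_simps const_arith; simp add: algebra_simps)
lemma h_weight_diff: "h_weight c p \<Longrightarrow> h_weight c q \<Longrightarrow> h_weight c (p - q)"
  by (simp add: h_weight_def op_simps; simp add: algebra_simps)
lemma h_weight_const: "h_weight c p \<Longrightarrow> h_weight c (const r * p)"
  by (simp add: h_weight_def op_simps; simp add: algebra_simps)

end

lemma xdeg_eq_sum: "xdeg \<nu> = (\<Sum>m | lk \<nu> (Xv m) \<noteq> 0. lk \<nu> (Xv m))"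
  unfolding xdeg_def Sum_any.expand_set by (rule refl)

lemma xdeg_nonneg: "(\<And>m. lk \<nu> (Xv m) \<ge> 0) \<Longrightarrow> xdeg \<nu> \<ge> 0"
  unfolding xdeg_eq_sum by (rule sum_nonneg)

lemma xdeg_eq_0D:
  assumes nn: "\<And>m. lk \<nu> (Xv m) \<ge> 0" and 0: "xdeg \<nu> = 0"
  shows "lk \<nu> (Xv m) = 0"
proof (rule ccontr)
  assume nz: "lk \<nu> (Xv m) \<noteq> 0"
  then have "lk \<nu> (Xv m) \<le> (\<Sum>m | lk \<nu> (Xv m) \<noteq> 0. lk \<nu> (Xv m))"
    by (intro member_le_sum finite_X_support) (simp_all add: nn)
  then show False using nn[of m] 0 xdeg_eq_sum[of \<nu>] nz by linarith
qed

section \<open>Generating the whole module from ground vectors; the case without a polar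
  x-variable\<close>

context laurent_space
begin

lemma irreducible_iff:
  "irreducible_lie_module CC affine_sl2 (lie_quotient (laurent_module N rep) I) \<longleftrightarrow>
    (\<forall>W. lin_subspace W \<longrightarrow> I \<subseteq> W \<longrightarrow> W \<subseteq> N \<longrightarrow> inv_op W \<longrightarrow> W = I \<or> W = N)"
proof -
  \<comment> \<open>The ground exponent; its monomial lies in \<open>N\<close> but not in
    \<open>I\<close>, so the quotient is nonzero.\<close>
  define \<nu>0 where "\<nu>0 = - (\<Sum>v\<in>P. sgl v (1::int))"
  have lk: "lk \<nu>0 w = (if w \<in> P then - 1 else 0)" for w
    by (simp add: \<nu>0_def lookup_sum lookup_single when_def finite_P)
  have "\<nu>0 \<in> exps_M" by (auto simp: exps_M_def exps_N_def lk PV)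
  then have "monom \<nu>0 \<in> N" "monom \<nu>0 \<notin> I" by (simp_all add: monom_in_monom_span exps_M_exps_N)
  then have "N \<noteq> I" by blast
  then show ?thesis
    unfolding sq.irreducible_Q_iff sq.invariant_mod_I_def using inv_op_iff by blast
qed

lemma exps_M_X_nonneg: "\<nu> \<in> exps_M \<Longrightarrow> Xv m \<notin> P \<Longrightarrow> lk \<nu> (Xv m) \<ge> 0"
  using exps_N_D(2)[OF exps_M_exps_N, of \<nu> "Xv m"] by force

lemma N_subset:
  assumes W: "lin_subspace W" "I \<subseteq> W" "\<And>\<nu>. \<nu> \<in> exps_M \<Longrightarrow> monom \<nu> \<in> W"
  shows "N \<subseteq> W"
proof
  fix p assume p: "p \<in> N"
  have "monom \<nu> \<in> W" if "\<nu> \<in> kys p" for \<nu>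
  proof (cases "\<nu> \<in> exps_M")
    case False
    then have "monom \<nu> \<in> I" using that p by (auto simp: monom_in_monom_span monom_span_def)
    then show ?thesis using W(2) by blast
  qed (rule W(3))
  then have "(\<Sum>\<nu>\<in>kys p. const (lk p \<nu>) * monom \<nu>) \<in> W"
    by (intro lin_subspace_sum lin_subspace_const W(1))
  then show "p \<in> W" using laurent_expansion[of p] by simp
qed

definition exps_ground :: "(var \<Rightarrow>\<^sub>0 int) set" where
  "exps_ground = {\<nu> \<in> exps_M. \<forall>m. excess1 \<nu> (Xv m) = 0}"
definition Y_vars :: "var set" where "Y_vars = V - range Xv"

lemma exps_ground_exps_M: "exps_ground \<subseteq> exps_M" by (auto simp: exps_ground_def)

lemma excess1_lower_Y: "v \<in> Y_vars \<Longrightarrow> excess1 (lower v \<nu>) (Xv m) = excess1 \<nu> (Xv m)"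
  by (auto simp: Y_vars_def excess1_def lower_def lookup_up lookup_down)

lemma excess1_eq_0_exps_M: "\<nu> \<in> exps_M \<Longrightarrow> excess1 \<nu> v = 0 \<longleftrightarrow> lk \<nu> v = (if v \<in> P then - 1 else 0)"
  using exps_N_D(2)[OF exps_M_exps_N, of \<nu> v] by (force simp: excess1_def exps_M_def)

lemma exps_ground_uniq:
  assumes "\<mu> \<in> exps_ground" "\<nu> \<in> exps_ground" "excess Y_vars \<mu> = 0" "excess Y_vars \<nu> = 0"
  shows "\<mu> = \<nu>"
proof -
  have "lk \<mu> v = (if v \<in> P then - 1 else 0)" if "\<mu> \<in> exps_ground" "excess Y_vars \<mu> = 0" for \<mu> v
  proof (cases "v \<in> V")
    case True
    have "excess1 \<mu> v = 0"
    proof (cases "v \<in> range Xv")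
      case False then show ?thesis using that(2) True by (simp add: excess_eq_0 Y_vars_def)
    qed (use that(1) in \<open>auto simp: exps_ground_def\<close>)
    then show ?thesis using excess1_eq_0_exps_M that(1) by (simp add: exps_ground_def)
  next
    case False
    then show ?thesis using exps_N_D(1)[OF exps_M_exps_N, of \<mu> v] PV that(1) by (auto simp: exps_ground_def)
  qed
  then show ?thesis using assms by (intro poly_mapping_eqI) simp
qed

text \<open>Irreducibility of the y-part: lowering takes \<open>p\<close> to the unique monomial at
  the ground value in all variables, and raising reaches all of \<open>exps_ground\<close> from
  there.\<close>

lemma exps_ground_all:
  assumes W: "lin_subspace W" "I \<subseteq> W"
    and closed: "\<And>v p. v \<in> Y_vars \<Longrightarrow> p \<in> W \<Longrightarrow> p \<in> monom_span exps_ground \<Longrightarrow> gen v * p \<in> W \<and> pdiff v p \<in> W"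
    and p: "p \<in> W" "p \<in> monom_span exps_ground" "p \<noteq> 0" and \<nu>: "\<nu> \<in> exps_ground"
  shows "monom \<nu> \<in> W"
proof -
  have low: "lower v \<nu> \<in> exps_ground" if "v \<in> Y_vars" "\<nu> \<in> exps_ground" "excess1 \<nu> v > 0" for v \<nu>
    using that lower_exps_M excess1_lower_Y by (simp add: exps_ground_def)
  obtain \<mu> where \<mu>: "\<mu> \<in> exps_ground" "excess Y_vars \<mu> = 0" "monom \<mu> \<in> W"
    using lower_all[OF W(1) exps_ground_exps_M W(2), of Y_vars p] low closed exps_ground_uniq p
    by (force simp: lower_op_def exps_ground_def excess1_lower_Y Y_vars_def)
  show ?thesis
  proof (rule raise_all[OF W(1) exps_ground_exps_M, of Y_vars])
    show "monom \<nu>' \<in> W" if "\<nu>' \<in> exps_ground" "excess Y_vars \<nu>' = 0" for \<nu>'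
      using exps_ground_uniq[OF that(1) \<mu>(1) that(2) \<mu>(2)] \<mu>(3) by simp
  qed (use low closed \<nu> in \<open>auto simp: raise_op_def\<close>)
qed

text \<open>The \<open>f_n\<close> multiply by the nonpolar x-variables, so it remains to treat
  monomials without them.\<close>

lemma X_all:
  assumes W: "lin_subspace W" "inv_op W"
    and base: "\<And>\<nu>. \<nu> \<in> exps_M \<Longrightarrow> (\<And>m. Xv m \<notin> P \<Longrightarrow> lk \<nu> (Xv m) = 0) \<Longrightarrow> monom \<nu> \<in> W"
    and \<nu>: "\<nu> \<in> exps_M"
  shows "monom \<nu> \<in> W"
proof (rule raise_all[OF W(1) order_refl, of "range Xv - P"])
  show "raise_op v p \<in> W" if "v \<in> range Xv - P" "p \<in> W" for v p
    using that W(2) by (auto simp: raise_op_def inv_op_def)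
  show "monom \<nu> \<in> W" if "\<nu> \<in> exps_M" "excess (range Xv - P) \<nu> = 0" for \<nu>
    by (rule base) (use that excess1_eq_0_exps_M in \<open>auto simp: excess_eq_0\<close>)
qed (use \<nu> lower_exps_M in auto)

text \<open>\<open>h_0\<close> is diagonal on monomials. Take its eigencomponent for the degree of a
  monomial of \<open>p\<close> that survives modulo \<open>I\<close>.\<close>

lemma h_weight_component:
  assumes W: "lin_subspace W" "inv_op W" and p: "p \<in> W" "p \<in> N" "p \<notin> I"
  shows "\<exists>\<delta> q. q \<in> W \<and> q \<in> N \<and> q \<notin> I \<and> h_weight (J - 2 * of_int \<delta>) q"
proof -
  obtain \<nu> where \<nu>: "\<nu> \<in> exps_M" "lk p \<nu> \<noteq> 0" using p I_iff by blast
  define t where "t = J - 2 * of_int (xdeg \<nu>)"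
  define q where "q = restrict_to {\<mu>. J - 2 * of_int (xdeg \<mu>) = t} p"
  have "q \<in> W" unfolding q_def
    by (rule diagonal_restrict_to[where T = "H 0", OF W(1)]) (use W(2) p lookup_H_0 in \<open>auto simp: inv_op_def\<close>)
  moreover have qN: "q \<in> N" using p(2) by (auto simp: monom_span_lookup q_def lookup_restrict_to split: if_splits)
  moreover have "lk q \<nu> \<noteq> 0" using \<nu> by (simp add: q_def lookup_restrict_to t_def)
  then have "q \<notin> I" using I_iff[OF qN] \<nu> by blast
  moreover have "h_weight t q" by (auto simp: h_weight_iff q_def lookup_restrict_to split: if_splits)
  ultimately show ?thesis unfolding t_def by blast
qed

lemma pdiff_X_not_I:
  assumes "p \<in> N" "\<nu> \<in> exps_M" "lk p \<nu> \<noteq> 0" "lk \<nu> (Xv j) > 0" "Xv j \<notin> P"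
  shows "pdiff (Xv j) p \<notin> I"
proof -
  have "\<nu> - sgl (Xv j) 1 \<in> exps_M"
    using exps_N_diff[of \<nu> "Xv j"] assms by (auto simp: exps_M_def lookup_down)
  moreover have "lk (pdiff (Xv j) p) (\<nu> - sgl (Xv j) 1) \<noteq> 0"
    using assms by (simp add: lookup_pdiff lookup_minus)
  ultimately show ?thesis by (auto simp: monom_span_lookup)
qed

lemma obtain_fresh_Y:
  fixes F :: "nat set"
  assumes "finite G" "finite F"
  obtains n where "n > 0" "Yv n \<notin> G" "n \<notin> F"
proof -
  have "finite (insert 0 (F \<union> Yv -` G))"
    using assms finite_vimageI[OF assms(1) inj_Yv] by simp
  then obtain n where "n \<notin> insert 0 (F \<union> Yv -` G)" using ex_new_if_finite infinite_UNIV_nat by blast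
  then show ?thesis using that by auto
qed

lemma restrict_to_exps_M_in:
  assumes "lin_subspace W" "I \<subseteq> W" "W \<subseteq> N" "p \<in> W"
  shows "restrict_to exps_M p \<in> W"
  using lin_subspace_cong[OF assms(1), of p "restrict_to exps_M p"] restrict_to_exps_M(1)[of p] assms by blast

lemma restrict_to_exps_M_neq_0: "p \<in> N \<Longrightarrow> p \<notin> I \<Longrightarrow> restrict_to exps_M p \<noteq> 0"
  using restrict_to_exps_M(1)[of p] by auto

lemma irreducible_no_X:
  assumes K: "K \<noteq> 0" and P: "P \<inter> range Xv = {}"
    and W: "lin_subspace W" "I \<subseteq> W" "W \<subseteq> N" "inv_op W" and WI: "W \<noteq> I"
  shows "W = N"
proof -
  have ca: "const a = 1" using K a_cases by auto
  have nX: "Xv m \<notin> P" for m using P by blast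
  \<comment> \<open>Induction on the x-degree \<open>\<delta>\<close> down to zero, where
    \<open>h_0\<close> has eigenvalue \<open>J\<close>.\<close>
  have hom0: "\<exists>q\<in>W. q \<notin> I \<and> h_weight J q" if "q \<in> W" "q \<notin> I" "h_weight (J - 2 * of_int \<delta>) q" for q \<delta>
    using that
  proof (induction "nat \<delta>" arbitrary: q \<delta> rule: less_induct)
    case less
    have qN: "q \<in> N" using less.prems W(3) by blast
    obtain \<nu> where \<nu>: "\<nu> \<in> exps_M" "lk q \<nu> \<noteq> 0" using less.prems qN I_iff by blast
    have deg: "xdeg \<nu> = \<delta>" using less.prems(3) \<nu>(2) by (auto simp: h_weight_iff)
    have nn: "lk \<nu> (Xv m) \<ge> 0" for m using exps_M_X_nonneg \<nu> nX by blast
    show ?case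
    proof (cases "\<delta> = 0")
      case True then show ?thesis using less.prems by auto
    next
      case False
      have "\<exists>j. lk \<nu> (Xv j) \<noteq> 0"
      proof (rule ccontr)
        assume "\<nexists>j. lk \<nu> (Xv j) \<noteq> 0" then have "xdeg \<nu> = 0" by (simp add: xdeg_def)
        then show False using False deg by simp
      qed
      then obtain j where j: "lk \<nu> (Xv j) > 0" using nn by (metis order_le_less)
      have dj: "pdiff (Xv j) q \<notin> I" by (rule pdiff_X_not_I[OF qN \<nu> j nX])
      obtain n where n: "n > 0" "Yv n \<notin> laurent_vars q"
        using obtain_fresh_Y[OF finite_laurent_vars finite.emptyI] by metis
      \<comment> \<open>The index is chosen so that differentiating by the fresh \<open>y_n\<close>
        turns \<open>q'\<close> into \<open>pdiff (Xv j) q\<close>, which is not in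
        \<open>I\<close>.\<close>
      define q' where "q' = E (- int n - j) q"
      have "pdiff (Yv n) q' = pdiff (Xv j) q"
        unfolding q'_def pdiff_Y_E using n by (simp add: pdiff_eq_0 op_simps ca)
      then have "q' \<notin> I" using dj W_pdiff[OF stable_I, of q' "Yv n"] by auto
      moreover have "q' \<in> W" using W(4) less.prems by (auto simp: inv_op_def q'_def)
      moreover have "h_weight (J - 2 * of_int (\<delta> - 1)) q'"
        using h_weight_E[OF less.prems(3), of "- int n - j"] by (simp add: q'_def algebra_simps)
      moreover have "nat (\<delta> - 1) < nat \<delta>" using xdeg_nonneg[of \<nu>] nn deg False by simp
      ultimately show ?thesis using less.hyps by blast
    qed
  qed
  obtain p where p: "p \<in> W" "p \<in> N" "p \<notin> I" using WI W by blast
  obtain q where q: "q \<in> W" "q \<notin> I" "h_weight J q"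
    using h_weight_component[OF W(1,4) p] hom0 by blast
  have qN: "q \<in> N" using q W by blast
  \<comment> \<open>Weight \<open>J\<close> means x-degree zero; without polar x-variables the
    exponents are nonnegative, so they all vanish.\<close>
  have rA: "restrict_to exps_M q \<in> monom_span exps_ground"
    unfolding monom_span_lookup
  proof (intro allI impI)
    fix \<nu> assume "lk (restrict_to exps_M q) \<nu> \<noteq> 0"
    then have \<nu>: "\<nu> \<in> exps_M" "lk q \<nu> \<noteq> 0" by (auto simp: lookup_restrict_to split: if_splits)
    have "xdeg \<nu> = 0" using q(3) \<nu>(2) by (auto simp: h_weight_iff)
    then have "lk \<nu> (Xv m) = 0" for m using xdeg_eq_0D[of \<nu>] exps_M_X_nonneg[OF \<nu>(1) nX] by blast
    then show "\<nu> \<in> exps_ground" using \<nu>(1) nX by (simp add: exps_ground_def excess1_def)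
  qed
  have closed: "gen v * r \<in> W \<and> pdiff v r \<in> W" if v: "v \<in> Y_vars" and r: "r \<in> W" "r \<in> monom_span exps_ground" for v r
  proof -
    obtain k where k: "v = Yv k" "k > 0" using v by (auto simp: Y_vars_def V_def)
    have "lk \<nu> (Xv m) = 0" if "lk r \<nu> \<noteq> 0" for \<nu> m
      using r(2) that excess1_eq_0_exps_M[of \<nu> "Xv m"] nX by (auto simp: monom_span_lookup exps_ground_def)
    then have "pdiff (Xv m) r = 0" for m
      by (intro pdiff_eq_0) (auto simp: laurent_vars_def in_keys_iff)
    then have X: "Xfree r" by (simp add: Xfree_def)
    \<comment> \<open>On x-free vectors these are multiplication by \<open>y_k\<close> and
      \<open>2 k K\<close> times the derivative by \<open>y_k\<close>; here
      \<open>K \<noteq> 0\<close> enters.\<close>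
    have "H (- int k) r \<in> W" "H (int k) r \<in> W" using W(4) r by (auto simp: inv_op_def)
    then show ?thesis using k K
      by (simp add: Xfree_H[OF X] ca lin_subspace_const_iff[OF W(1)])
  qed
  have "monom \<nu> \<in> W" if "\<nu> \<in> exps_ground" for \<nu>
    using exps_ground_all[OF W(1,2) closed restrict_to_exps_M_in[OF W(1-3) q(1)] rA restrict_to_exps_M_neq_0[OF qN q(2)] that] .
  moreover have "\<nu> \<in> exps_ground" if "\<nu> \<in> exps_M" "\<And>m. Xv m \<notin> P \<Longrightarrow> lk \<nu> (Xv m) = 0" for \<nu>
    using that nX by (simp add: exps_ground_def excess1_def)
  ultimately have "monom \<nu> \<in> W" if "\<nu> \<in> exps_M" for \<nu>
    using X_all[OF W(1,4) _ that] by blast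
  then show ?thesis using N_subset[OF W(1,2)] W(3) by blast
qed

end

section \<open>A polar \<open>x\<close>-variable: the non-integral case\<close>

text \<open>\<open>De\<close> regrouped by the sum \<open>q\<close> of the two derivative indices,
  which expresses \<open>E n\<close> through the operators \<open>Bq\<close>.\<close>

definition DB :: "int \<Rightarrow> laurent \<Rightarrow> laurent" where
  "DB n p = Sum_any (\<lambda>q. gen (Xv (q + n)) * Bq q p)"

lemma finite_Bq: "finite {q. Bq q p \<noteq> 0}"
proof -
  let ?S = "{m. pdiff (Xv m) p \<noteq> 0}"
  have "{q. Bq q p \<noteq> 0} \<subseteq> (\<lambda>(k, l). k + l) ` (?S \<times> ?S)"
  proof
    fix q assume "q \<in> {q. Bq q p \<noteq> 0}"
    then obtain k where "pdiff (Xv (q - k)) (pdiff (Xv k) p) \<noteq> 0"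
      unfolding Bq_def diff_sum_def using Sum_any.not_neutral_obtains_not_neutral by blast
    then have "pdiff (Xv k) p \<noteq> 0" "pdiff (Xv (q - k)) p \<noteq> 0"
      using pdiff_commute[of "Xv k" "Xv (q - k)" p] by auto
    then show "q \<in> (\<lambda>(k, l). k + l) ` (?S \<times> ?S)"
      by (intro image_eqI[of _ _ "(k, q - k)"]) auto
  qed
  then show ?thesis by (rule finite_subset) (intro finite_imageI finite_cartesian_product finite_pdiff inj_Xv)
qed

lemma finite_gen_Bq: "finite {q. gen (f q) * Bq q p \<noteq> 0}"
  by (rule finite_subset[OF _ finite_Bq[of p]]) auto

lemma De_eq_DB: "De n p = DB n p"
proof (rule lin_op_eq_by_gens[where S = "De n" and T = "DB n"])
  show "lin_op (DB n)" unfolding DB_def [abs_def]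
    by (intro lin_op_Sum_anyI lin_op_mult lin_op_Bq finite_gen_Bq)
  show "De n 1 = DB n 1" by (simp add: DB_def Bq_1 De_1)
  fix v q
  show "De n (gen v * q) - gen v * De n q = DB n (gen v * q) - gen v * DB n q"
  proof (cases v)
    case (Yv k)
    then show ?thesis
      by (simp add: DB_def De_gen_Y Bq_gen_Y Sum_any_right_distrib[OF finite_gen_Bq] mult.left_commute)
  next
    case (Xv j)
    have fin: "finite {r. gen (Xv (r + n)) * (2 * pdiff (Xv (r - j)) q) \<noteq> 0}"
      by (rule finite_subset[OF _ finite_pdiff[of "\<lambda>r. Xv (r - j)" q]]) (auto simp: inj_def)
    have fin': "finite {r. gen (Xv j) * (gen (Xv (r + n)) * Bq r q) \<noteq> 0}"
      by (rule finite_subset[OF _ finite_Bq[of q]]) auto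
    have "DB n (gen v * q) = Sum_any (\<lambda>r. gen (Xv j) * (gen (Xv (r + n)) * Bq r q)
        + gen (Xv (r + n)) * (2 * pdiff (Xv (r - j)) q))"
      unfolding DB_def Xv Bq_gen_X by (simp add: distrib_left mult.left_commute)
    also have "\<dots> = gen (Xv j) * DB n q + Sum_any (\<lambda>r. gen (Xv (r + n)) * (2 * pdiff (Xv (r - j)) q))"
      unfolding DB_def Sum_any.distrib[OF fin' fin] Sum_any_right_distrib[OF finite_gen_Bq] ..
    also have "Sum_any (\<lambda>r. gen (Xv (r + n)) * (2 * pdiff (Xv (r - j)) q))
        = Sum_any (\<lambda>m. 2 * (gen (Xv (m + (n + j))) * pdiff (Xv m) q))"
      by (rule Sum_any.reindex_cong[of "\<lambda>m. m + j"]) (auto intro!: o_bij[of "\<lambda>m. m - j"] simp: algebra_simps)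
    also have "\<dots> = 2 * deriv_x (n + j) q"
      unfolding deriv_x_def diff_sum_def
      by (rule Sum_any_right_distrib[symmetric]) (rule finite_diff_sum[of Xv "\<lambda>m q. gen (Xv (m + (n + j))) * q"], simp_all add: lin_op_mult_left)
    finally show ?thesis by (simp add: Xv De_gen_X)
  qed
qed (rule lin_op_De)

lemma xdeg_split:
  assumes "lk \<nu> (Xv i) = - 1"
  shows "xdeg \<nu> = - 1 + (\<Sum>m\<in>{m. lk \<nu> (Xv m) \<noteq> 0} - {i}. lk \<nu> (Xv m))"
  unfolding xdeg_eq_sum by (subst sum.remove[of _ i]) (use assms finite_X_support in auto)

context free_field
begin

text \<open>On a vector \<open>p\<close> of weight \<open>l\<close> with \<open>f\<^sub>i p = 0\<close>, up to the scalar \<open>l (l + 1)\<close>, the projection of \<open>e\<^sub>n p\<close> to the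
  kernel of \<open>f\<^sub>i\<close> along the image of \<open>e\<^sub>-\<^sub>i\<close>.\<close>

definition proj_E :: "int \<Rightarrow> complex \<Rightarrow> int \<Rightarrow> laurent \<Rightarrow> laurent" where
  "proj_E i l n p = const (l * (l + 1)) * E n p - const (l + 1) * H (n + i) (E (- i) p)
     - gen (Xv (2 * i + n)) * E (- i) (E (- i) p)"

lemma proj_E_stable: "stable W \<Longrightarrow> p \<in> W \<Longrightarrow> proj_E i l n p \<in> W"
  unfolding proj_E_def by (intro lin_subspace_diff lin_subspace_const W_lin_subspace W_E W_H W_gen_X)

lemma proj_E_inv_op: "lin_subspace W \<Longrightarrow> inv_op W \<Longrightarrow> p \<in> W \<Longrightarrow> proj_E i l n p \<in> W"
  unfolding proj_E_def by (intro lin_subspace_diff lin_subspace_const) (auto simp: inv_op_def)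

lemma H_shift_E: "H_shift i (E n p) = E n (H_shift i p) + 2 * E n p"
  by (simp add: H_shift_def H_E op_simps)

text \<open>The coefficients of \<open>proj_E\<close> are those for which the commutator terms with
  \<open>x_i\<close> cancel on a vector of weight \<open>l\<close>; \<open>n \<noteq> - i\<close>
  excludes the central term. Hence \<open>proj_E\<close> preserves annihilation by
  \<open>x_i\<close> modulo \<open>I\<close>.\<close>

lemma gen_proj_E:
  assumes "H_shift i p = const l * p" "n \<noteq> - i"
  shows "gen (Xv i) * proj_E i l n p = proj_E i l n (gen (Xv i) * p)"
proof -
  have "H_shift i (E (- i) p) = const (l + 2) * E (- i) p"
    by (simp add: H_shift_E assms(1) op_simps const_arith distrib_right)
  moreover have "n + i \<noteq> 0" using assms(2) by auto
  moreover have "2 * i + n = n + i + i" by simp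
  ultimately show ?thesis
    by (simp add: proj_E_def E_gen_i E_gen_X[of n i] H_gen_X op_simps assms(1) const_arith H_E; simp add: algebra_simps)
qed

lemma h_weight_proj_E: "h_weight c p \<Longrightarrow> h_weight (c + 2) (proj_E i l n p)"
proof -
  assume p: "h_weight c p"
  have "h_weight (c + 2 + 2 - 2) (gen (Xv (2 * i + n)) * E (- i) (E (- i) p))"
    by (intro h_weight_X h_weight_E p)
  then show ?thesis unfolding proj_E_def
    by (intro h_weight_diff h_weight_const h_weight_E h_weight_H p) (simp add: add.commute)
qed

lemma H_shift_Xfree: "Xfree q \<Longrightarrow> H_shift i q = const (J - of_int i * K) * q"
  by (simp add: H_shift_def Xfree_H const_diff algebra_simps)

text \<open>An x-free vector is a highest weight vector of weight \<open>J - iK\<close> for the copy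
  of \<open>sl_2\<close>. For \<open>m < 0\<close> the factor vanishes only if
  \<open>J - iK = m - 1\<close>, which is how integrality decides irreducibility.\<close>

lemma E_x_pow_Xfree:
  assumes "Xfree q"
  shows "E (- i) (x_pow i m * q) = const (of_int m * (J - of_int i * K - of_int m + 1)) * (x_pow i (m - 1) * q)"
  unfolding E_x_pow Xfree_E[OF assms] H_shift_Xfree[OF assms]
  by (simp add: const_arith; simp add: algebra_simps)

end

lemma Xfree_monom: "(\<And>m. lk \<nu> (Xv m) = 0) \<Longrightarrow> Xfree (monom \<nu>)"
  by (simp add: Xfree_def)

text \<open>\<open>K_or\<close> keeps the two cases of the theorem: nonzero central charge, or no
  y-variables.\<close>

locale nonintegral_weight = laurent_space +
  fixes i :: int
  assumes P_X: "P \<inter> range Xv = {Xv i}" and J_nonint: "J - of_int i * K \<notin> \<int>" and K_or: "K \<noteq> 0 \<or> a = 0"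
begin

lemma iP: "Xv m \<in> P \<longleftrightarrow> m = i" using P_X by auto

lemma nonint: "J - of_int i * K + of_int z \<noteq> 0"
proof
  assume "J - of_int i * K + of_int z = 0"
  then have "J - of_int i * K = of_int (- z)" by (simp add: algebra_simps eq_neg_iff_add_eq_0)
  then show False using J_nonint by simp
qed

text \<open>With an exponent below \<open>-1\<close> at \<open>x_i\<close>, the product with
  \<open>x_i\<close> would still have negative exponents on all of \<open>P\<close> and so not lie
  in \<open>I\<close>.\<close>

lemma ann_key:
  assumes "p \<in> N" "gen (Xv i) * p \<in> I" "\<nu> \<in> exps_M" "lk p \<nu> \<noteq> 0"
  shows "lk \<nu> (Xv i) = - 1"
proof -
  have "lk (gen (Xv i) * p) (\<nu> + sgl (Xv i) 1) \<noteq> 0" using assms(4) by simp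
  then have "\<nu> + sgl (Xv i) 1 \<notin> exps_M" using assms(2) by (auto simp: monom_span_lookup simp del: lookup_gen_mult)
  moreover have "\<nu> + sgl (Xv i) 1 \<in> exps_N" using exps_N_add[OF exps_M_exps_N[OF assms(3)], of "Xv i"] by (simp add: V_def)
  ultimately have "\<exists>v\<in>P. lk (\<nu> + sgl (Xv i) 1) v \<ge> 0" using exps_N_exps_M_iff by blast
  then have "lk \<nu> (Xv i) + 1 \<ge> 0" using assms(3) by (force simp: exps_M_def lookup_up split: if_splits)
  moreover have "lk \<nu> (Xv i) < 0" using assms(3) iP by (simp add: exps_M_def)
  ultimately show ?thesis by simp
qed

lemma exps_M_nn: "\<nu> \<in> exps_M \<Longrightarrow> m \<noteq> i \<Longrightarrow> lk \<nu> (Xv m) \<ge> 0"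
  using exps_M_X_nonneg iP by blast

text \<open>Repeated use of \<open>proj_E\<close> lowers the degree until no derivative by an
  \<open>x_j\<close> with \<open>j \<noteq> i\<close> survives modulo \<open>I\<close>; what is left
  lies over \<open>exps_ground\<close>. By \<open>step\<close>, as long as such a derivative
  survives some \<open>proj_E\<close> stays outside \<open>I\<close>; this is proved separately for
  \<open>K \<noteq> 0\<close> and \<open>K = 0\<close>.\<close>

lemma reduce:
  assumes W: "lin_subspace W" "I \<subseteq> W" "W \<subseteq> N" "inv_op W" and WI: "W \<noteq> I"
    and step: "\<And>p \<delta>. p \<in> W \<Longrightarrow> p \<notin> I \<Longrightarrow> gen (Xv i) * p \<in> I \<Longrightarrow> h_weight (J - 2 * of_int \<delta>) p
      \<Longrightarrow> (\<exists>j. j \<noteq> i \<and> pdiff (Xv j) p \<notin> I)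
      \<Longrightarrow> (\<And>n. n \<noteq> - i \<Longrightarrow> proj_E i (J - of_int i * K - 2 * of_int \<delta>) n p \<in> I) \<Longrightarrow> False"
  shows "\<exists>p\<in>W. p \<in> monom_span exps_ground \<and> p \<noteq> 0"
proof -
  have start: "\<exists>q \<delta>. q \<in> W \<and> q \<notin> I \<and> gen (Xv i) * q \<in> I \<and> h_weight (J - 2 * of_int \<delta>) q"
  proof -
    obtain p where p: "p \<in> W" "p \<in> N" "p \<notin> I" using WI W by blast
    obtain q \<delta> where q: "q \<in> W" "q \<in> N" "q \<notin> I" "h_weight (J - 2 * of_int \<delta>) q"
      using h_weight_component[OF W(1,4) p] by blast
    have pw: "(gen (Xv i) ^ r * q) \<in> W \<and> h_weight (J - 2 * of_int (\<delta> + int r)) (gen (Xv i) ^ r * q)" for r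
    proof (induction r)
      case (Suc r)
      then have "gen (Xv i) * (gen (Xv i) ^ r * q) \<in> W" using W(4) by (simp add: inv_op_def)
      moreover have "J - 2 * of_int (\<delta> + int (Suc r)) = J - 2 * of_int (\<delta> + int r) - 2"
        by (simp add: algebra_simps)
      ultimately show ?case
        using h_weight_X[of "J - 2 * of_int (\<delta> + int r)" "gen (Xv i) ^ r * q" i] Suc
        by (simp only: power_Suc mult.assoc)
    qed (use q in simp)
    \<comment> \<open>No pole of \<open>q\<close> in \<open>x_i\<close> is deeper than
      \<open>B\<close>, so \<open>x_i^B q\<close> lies in \<open>I\<close>.\<close>
    define B where "B = Max (insert 0 ((\<lambda>\<nu>. nat (- lk \<nu> (Xv i))) ` kys q))"
    have "gen (Xv i) ^ B * q \<in> I"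
    proof -
      have N: "gen (Xv i) ^ B * q \<in> N" using pw W(3) by blast
      have "lk (gen (Xv i) ^ B * q) \<nu> = 0" if "\<nu> \<in> exps_M" for \<nu>
      proof (rule ccontr)
        assume nz: "lk (gen (Xv i) ^ B * q) \<nu> \<noteq> 0"
        define \<mu> where "\<mu> = \<nu> - sgl (Xv i) (int B)"
        have "\<mu> \<in> kys q" using nz by (simp add: lookup_gen_power in_keys_iff \<mu>_def)
        then have "nat (- lk \<mu> (Xv i)) \<le> B" unfolding B_def by (intro Max_ge) auto
        then have "lk \<nu> (Xv i) \<ge> 0" by (simp add: \<mu>_def lookup_minus)
        then show False using that iP by (force simp: exps_M_def)
      qed
      then show ?thesis using I_iff[OF N] by blast
    qed
    then have ex: "\<exists>r. gen (Xv i) ^ r * q \<in> I" by blast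
    \<comment> \<open>The power just before the first one in \<open>I\<close> gives a vector outside
      \<open>I\<close> that \<open>x_i\<close> annihilates modulo \<open>I\<close>.\<close>
    define r where "r = (LEAST r. gen (Xv i) ^ r * q \<in> I)"
    have r: "gen (Xv i) ^ r * q \<in> I" unfolding r_def by (rule LeastI_ex[OF ex])
    have "r \<noteq> 0" using r q(3) by (intro notI) simp
    then obtain s where s: "r = Suc s" by (cases r) auto
    have "gen (Xv i) ^ s * q \<notin> I" using not_less_Least[of s "\<lambda>r. gen (Xv i) ^ r * q \<in> I"] s r_def by auto
    moreover have "gen (Xv i) * (gen (Xv i) ^ s * q) \<in> I" using r s by (simp add: mult.assoc)
    ultimately show ?thesis using pw[of s] by blast
  qed
  have base: "\<exists>p\<in>W. p \<in> monom_span exps_ground \<and> p \<noteq> 0"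
    if q: "q \<in> W" "q \<notin> I" "gen (Xv i) * q \<in> I" "h_weight (J - 2 * of_int \<delta>) q"
      and nd: "\<not> (\<exists>j. j \<noteq> i \<and> pdiff (Xv j) q \<notin> I)" for q \<delta>
  proof -
    have qN: "q \<in> N" using q W by blast
    have "restrict_to exps_M q \<in> monom_span exps_ground"
      unfolding monom_span_lookup
    proof (intro allI impI)
      fix \<nu> assume "lk (restrict_to exps_M q) \<nu> \<noteq> 0"
      then have \<nu>: "\<nu> \<in> exps_M" "lk q \<nu> \<noteq> 0" by (auto simp: lookup_restrict_to split: if_splits)
      have "excess1 \<nu> (Xv m) = 0" for m
      proof (cases "m = i")
        case True then show ?thesis using ann_key[OF qN q(3) \<nu>] iP by (simp add: excess1_def)
      next
        case False
        then have "\<not> lk \<nu> (Xv m) > 0" using pdiff_X_not_I[OF qN \<nu>, of m] nd iP by blast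
        then show ?thesis using False iP by (simp add: excess1_def)
      qed
      then show "\<nu> \<in> exps_ground" using \<nu>(1) by (simp add: exps_ground_def)
    qed
    then show ?thesis using restrict_to_exps_M_in[OF W(1-3) q(1)] restrict_to_exps_M_neq_0[OF qN q(2)] by blast
  qed
  have "\<exists>p\<in>W. p \<in> monom_span exps_ground \<and> p \<noteq> 0"
    if "q \<in> W" "q \<notin> I" "gen (Xv i) * q \<in> I" "h_weight (J - 2 * of_int \<delta>) q" for q \<delta>
    using that
  \<comment> \<open>The exponent at \<open>x_i\<close> is \<open>-1\<close> by
    \<open>ann_key\<close>, so \<open>\<delta> + 1\<close> is the degree in the other x-variables.
    It is positive while a derivative by one of them survives.\<close>
  proof (induction "nat (\<delta> + 1)" arbitrary: q \<delta> rule: less_induct)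
    case less
    have qN: "q \<in> N" using less.prems W by blast
    show ?case
    proof (cases "\<exists>j. j \<noteq> i \<and> pdiff (Xv j) q \<notin> I")
      case True
      define l where "l = J - of_int i * K - 2 * of_int \<delta>"
      obtain n where n: "n \<noteq> - i" "proj_E i l n q \<notin> I"
        using step[OF less.prems True] unfolding l_def by blast
      have "H_shift i q = const l * q"
        using less.prems(4) by (simp add: H_shift_def h_weight_def l_def const_arith algebra_simps)
      then have "gen (Xv i) * proj_E i l n q \<in> I"
        using gen_proj_E n(1) proj_E_stable[OF stable_I less.prems(3)] by simp
      moreover have "proj_E i l n q \<in> W" by (rule proj_E_inv_op[OF W(1,4) less.prems(1)])
      moreover have "h_weight (J - 2 * of_int (\<delta> - 1)) (proj_E i l n q)"
        using h_weight_proj_E[OF less.prems(4)] by (simp add: algebra_simps)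
      moreover have "nat (\<delta> - 1 + 1) < nat (\<delta> + 1)"
      proof -
        obtain j where j: "j \<noteq> i" "pdiff (Xv j) q \<notin> I" using True by blast
        obtain \<mu> where \<mu>: "\<mu> \<in> exps_M" "lk (pdiff (Xv j) q) \<mu> \<noteq> 0"
          using j(2) I_iff[OF W_pdiff[OF stable_N qN]] by blast
        define \<nu> where "\<nu> = \<mu> + sgl (Xv j) 1"
        have q\<nu>: "lk q \<nu> \<noteq> 0" using \<mu>(2) by (simp add: lookup_pdiff \<nu>_def)
        then have "\<nu> \<in> exps_N" using qN by (auto simp: monom_span_lookup)
        then have \<nu>: "\<nu> \<in> exps_M" using \<mu>(1) iP[of j] j(1) by (auto simp: exps_M_def \<nu>_def lookup_up)
        have "lk \<nu> (Xv j) > 0" using exps_M_nn[OF \<mu>(1) j(1)] by (simp add: \<nu>_def lookup_up)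
        moreover have "lk \<nu> (Xv j) \<le> (\<Sum>m\<in>{m. lk \<nu> (Xv m) \<noteq> 0} - {i}. lk \<nu> (Xv m))"
          using exps_M_nn[OF \<nu>] j(1) calculation
          by (intro member_le_sum finite_Diff finite_X_support) auto
        moreover have "xdeg \<nu> = \<delta>" using less.prems(4) q\<nu> by (auto simp: h_weight_iff)
        ultimately show ?thesis using xdeg_split[OF ann_key[OF qN less.prems(3) \<nu> q\<nu>]] by simp
      qed
      ultimately show ?thesis using less.hyps n(2) by blast
    next
      case False
      then show ?thesis using base[OF less.prems] by blast
    qed
  qed
  then show ?thesis using start by blast
qed

lemma J_lam: "J - of_int i * K - 2 * of_int \<delta> + of_int z \<noteq> 0"
  using nonint[of "z - 2 * \<delta>"] by (simp add: algebra_simps)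

text \<open>Differentiating \<open>proj_E\<close> by a fresh y-variable isolates
  \<open>l (l + 1)\<close> times the derivative of \<open>p\<close> by \<open>x_j\<close>.\<close>

lemma step_charged:
  assumes K: "K \<noteq> 0" and p: "p \<in> N" and ex: "\<exists>j. j \<noteq> i \<and> pdiff (Xv j) p \<notin> I"
    and u: "\<And>n. n \<noteq> - i \<Longrightarrow> proj_E i (J - of_int i * K - 2 * of_int \<delta>) n p \<in> I"
  shows False
proof -
  define l where "l = J - of_int i * K - 2 * of_int \<delta>"
  have l: "l + of_int z \<noteq> 0" for z using J_lam by (simp add: l_def)
  have ca: "const a = 1" using K a_cases by auto
  obtain j where j: "j \<noteq> i" "pdiff (Xv j) p \<notin> I" using ex by blast
  obtain n where n: "n > 0" "Yv n \<notin> laurent_vars p \<union> laurent_vars (E (- i) p) \<union> laurent_vars (E (- i) (E (- i) p))" "n \<notin> {nat (i - j)}"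
    using obtain_fresh_Y[of "laurent_vars p \<union> laurent_vars (E (- i) p) \<union> laurent_vars (E (- i) (E (- i) p))" "{nat (i - j)}"]
    by (auto simp: finite_laurent_vars)
  \<comment> \<open>Avoiding \<open>n = i - j\<close> ensures \<open>m \<noteq> - i\<close>, and
    \<open>j \<noteq> i\<close> prevents \<open>h_(m+i)\<close> from multiplying by
    \<open>y_n\<close>.\<close>
  define m where "m = - int n - j"
  have m: "m \<noteq> - i" "m + i \<noteq> - int n" using n(1,3) j(1) by (auto simp: m_def)
  have z: "pdiff (Yv n) p = 0" "pdiff (Yv n) (E (- i) p) = 0" "pdiff (Yv n) (E (- i) (E (- i) p)) = 0"
    using n(2) by (auto intro!: pdiff_eq_0)
  have z': "pdiff (Yv n) (E m p) = pdiff (Xv j) p"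
    unfolding pdiff_Y_E z(1) using n(1) by (simp add: op_simps ca m_def)
  have z'': "pdiff (Yv n) (H (m + i) (E (- i) p)) = 0"
    unfolding pdiff_Y_H z(2) using m(2) by (simp add: op_simps)
  have "pdiff (Yv n) (proj_E i l m p) = const (l * (l + 1)) * pdiff (Xv j) p"
    by (simp add: proj_E_def pdiff_simps z z' z'' pdiff_gen_mult)
  then have "const (l * (l + 1)) * pdiff (Xv j) p \<in> I"
    using W_pdiff[OF stable_I u[OF m(1)], of "Yv n"] by (simp add: l_def)
  moreover have "l * (l + 1) \<noteq> 0" using l[of 0] l[of 1] by simp
  ultimately show False using lin_subspace_const_iff[OF lin_subspace_monom_span] j(2) by blast
qed

lemma obtain_fresh_X:
  assumes "finite G" "finite F"
  obtains n :: int where "Xv n \<notin> G" "n \<notin> F"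
proof -
  have "finite (F \<union> Xv -` G)"
    using assms finite_vimageI[OF assms(1) inj_Xv] by simp
  then obtain n where "n \<notin> F \<union> Xv -` G" using ex_new_if_finite infinite_UNIV_int by blast
  then show ?thesis using that by auto
qed

text \<open>Without y-variables, derivatives by fresh x-variables are used instead. They determine
  \<open>e p\<close>, \<open>e (e p)\<close> and the \<open>Bq q p\<close> modulo \<open>I\<close>
  through derivatives of \<open>p\<close>; substituted into \<open>proj_E\<close>, they leave
  \<open>l (l + 1) J\<close> times the derivative by \<open>x_j\<close>.\<close>

lemma step_neutral:
  assumes a0: "a = 0" and p: "p \<in> N" and ann: "gen (Xv i) * p \<in> I" and hp: "h_weight (J - 2 * of_int \<delta>) p"
    and ex: "\<exists>j. j \<noteq> i \<and> pdiff (Xv j) p \<notin> I"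
    and u: "\<And>n. n \<noteq> - i \<Longrightarrow> proj_E i (J - of_int i * K - 2 * of_int \<delta>) n p \<in> I"
  shows False
proof -
  have K0: "K = 0" using a0 a_cases by auto
  define l where "l = J - 2 * of_int \<delta>"
  have l: "l + of_int z \<noteq> 0" for z using J_lam[of \<delta> z] by (simp add: l_def K0)
  have cK: "const (of_int i * K) = 0" using K0 by simp
  have J0: "J \<noteq> 0" using nonint[of 0] by (simp add: K0)
  note cI = lin_subspace_monom_span[of "exps_N - exps_M"]
  note I_ops = lin_subspace_add[OF cI] lin_subspace_diff[OF cI] lin_subspace_const[OF cI] lin_subspace_numeral[OF cI] W_pdiff[OF stable_I]
    W_E[OF stable_I] W_gen_X[OF stable_I] W_Bq[OF stable_I] W_H[OF stable_I]
  define e where "e = E (- i)"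
  let ?d = "\<lambda>j. pdiff (Xv j)"
  have Hip: "H_shift i p = const l * p" using hp cK by (simp add: H_shift_def h_weight_def l_def)
  have xe: "gen (Xv i) * e p = e (gen (Xv i) * p) - const l * p"
    by (simp add: e_def E_gen_i Hip)
  have ed: "?d j (e q) = e (?d j q) - Bq (i + j) q" for j q
    by (simp add: e_def pdiff_X_E add.commute)
  have EB: "E n q = const J * ?d (- n) q - Sum_any (\<lambda>j. gen (Xv (j + n)) * Bq j q)" for n q
    unfolding E_def by (simp add: K0 a0 De_eq_DB DB_def)
  have HB: "H (n + i) q = - 2 * deriv_x (n + i) q" if "n \<noteq> - i" for n q
    using that unfolding H_def by (simp add: K0 a0 when_def eq_neg_iff_add_eq_0)
  \<comment> \<open>Differentiate \<open>proj_E\<close> by a fresh \<open>x_m\<close> with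
    \<open>m = n + q\<close>. Its last term contributes only if \<open>x_m\<close> is the factor
    \<open>x_(2i+n)\<close>, that is, for \<open>q = 2 * i\<close>.\<close>
  have R: "2 * (const (l + 1) * ?d (q - i) (e p)) - const (l * (l + 1)) * Bq q p - (e (e p) when q = 2 * i) \<in> I" for q
  proof -
    obtain m where m: "Xv m \<notin> laurent_vars p \<union> laurent_vars (e p) \<union> laurent_vars (e (e p))" "m \<notin> {q - i}"
      using obtain_fresh_X[of "laurent_vars p \<union> laurent_vars (e p) \<union> laurent_vars (e (e p))" "{q - i}"]
      by (auto simp: finite_laurent_vars)
    define n where "n = m - q"
    have n: "n \<noteq> - i" using m(2) by (auto simp: n_def)
    have z: "?d m p = 0" "?d m (e p) = 0" "?d m (e (e p)) = 0"
      using m(1) by (auto intro!: pdiff_eq_0)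
    have e1: "?d m (E n p) = - Bq q p"
      unfolding pdiff_X_E z(1) by (simp add: op_simps n_def)
    have e2: "?d m (H (n + i) (e p)) = - 2 * ?d (q - i) (e p)"
      unfolding pdiff_X_H z(2) by (simp add: op_simps n_def algebra_simps)
    have e3: "?d m (gen (Xv (2 * i + n)) * e (e p)) = (e (e p) when q = 2 * i)"
      unfolding pdiff_gen_mult z(3) by (auto simp: n_def when_def)
    have "?d m (proj_E i l n p) = 2 * (const (l + 1) * ?d (q - i) (e p)) - const (l * (l + 1)) * Bq q p - (e (e p) when q = 2 * i)"
      unfolding proj_E_def e_def[symmetric] pdiff_simps e1 e2 e3 by (simp add: algebra_simps)
    moreover have "proj_E i l n p \<in> I" using u[OF n] by (simp add: l_def K0)
    ultimately show ?thesis using W_pdiff[OF stable_I, of "proj_E i l n p" "Xv m"] by simp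
  qed
  define G where "G j = 2 * ?d j (e p) - const l * Bq (i + j) p" for j
  have GI: "G j \<in> I" if "j \<noteq> i" for j
  proof -
    have "const (l + 1) * G j \<in> I"
      using R[of "i + j"] that by (simp add: G_def const_mult; simp add: algebra_simps)
    then show ?thesis using lin_subspace_const_iff[OF cI] l[of 1] by simp
  qed
  \<comment> \<open>The sum of all \<open>x_j G j\<close> is evaluated with the Euler operator and
    with \<open>EB\<close>. Its terms with \<open>j \<noteq> i\<close> lie in \<open>I\<close>, and
    the term \<open>j = i\<close> is rewritten through \<open>x_i p\<close>, which lies in
    \<open>I\<close>.\<close>
  have T1: "e p - const l * ?d i p \<in> I"
  proof -
    have f1: "finite {j. gen (Xv j) * ?d j q \<noteq> 0}" for q
      by (rule finite_subset[OF _ finite_pdiff[OF inj_Xv, of q]]) auto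
    have f2: "finite {j. gen (Xv j) * Bq (i + j) q \<noteq> 0}" for q
    proof (rule finite_subset[OF _ finite_vimageI[OF finite_Bq[of q], of "\<lambda>j. i + j"]])
    qed (auto simp: inj_def)
    have f1': "finite {j. 2 * (gen (Xv j) * ?d j (e p)) \<noteq> 0}"
      by (rule finite_subset[OF _ f1[of "e p"]]) auto
    have f2': "finite {j. - const l * (gen (Xv j) * Bq (i + j) p) \<noteq> 0}"
      by (rule finite_subset[OF _ f2[of p]]) auto
    have "Sum_any (\<lambda>j. gen (Xv j) * G j)
        = Sum_any (\<lambda>j. 2 * (gen (Xv j) * ?d j (e p)) + - const l * (gen (Xv j) * Bq (i + j) p))"
      by (rule Sum_any.cong) (simp add: G_def algebra_simps)
    also have "\<dots> = 2 * Sum_any (\<lambda>j. gen (Xv j) * ?d j (e p)) + - const l * Sum_any (\<lambda>j. gen (Xv j) * Bq (i + j) p)"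
      unfolding Sum_any.distrib[OF f1' f2'] Sum_any_right_distrib[OF f1] Sum_any_right_distrib[OF f2] ..
    also have "Sum_any (\<lambda>j. gen (Xv j) * ?d j (e p)) = deriv_x 0 (e p)"
      by (simp add: deriv_x_def diff_sum_def)
    also have "Sum_any (\<lambda>j. gen (Xv j) * Bq (i + j) p) = Sum_any (\<lambda>j. gen (Xv (j + - i)) * Bq j p)"
      by (rule Sum_any.reindex_cong[of "\<lambda>j. j - i"]) (auto intro!: o_bij[of "\<lambda>j. j + i"])
    also have "\<dots> = const J * ?d i p - e p"
      by (simp add: e_def EB)
    finally have sum: "Sum_any (\<lambda>j. gen (Xv j) * G j) = 2 * deriv_x 0 (e p) + - const l * (const J * ?d i p - e p)" .
    have "h_weight (l + 2) (e p)" unfolding e_def l_def by (rule h_weight_E[OF hp])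
    then have dh: "2 * deriv_x 0 (e p) = const (J - l - 2) * e p"
      by (simp add: h_weight_def H_def const_arith algebra_simps)
    have fG: "finite {j. gen (Xv j) * G j \<noteq> 0}"
      by (rule finite_subset[OF _ finite_UnI[OF f1' f2']]) (auto simp: G_def algebra_simps)
    have "Sum_any (\<lambda>j. gen (Xv j) * G j) = Sum_any (\<lambda>j. (if j = i then 0 else gen (Xv j) * G j) + (gen (Xv i) * G i when j = i))"
      by (rule Sum_any.cong) (auto simp: when_def)
    also have "\<dots> = Sum_any (\<lambda>j. if j = i then 0 else gen (Xv j) * G j) + gen (Xv i) * G i"
    proof (subst Sum_any.distrib)
      show "finite {j. (if j = i then 0 else gen (Xv j) * G j) \<noteq> 0}"
        by (rule finite_subset[OF _ fG]) auto
      show "finite {j. (gen (Xv i) * G i when j = i) \<noteq> 0}"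
        by (rule finite_subset[of _ "{i}"]) auto
    qed simp
    also have "gen (Xv i) * G i = 2 * ?d i (e (gen (Xv i) * p)) - const l * Bq (2 * i) (gen (Xv i) * p) - 2 * e p"
    proof -
      have "?d i (gen (Xv i) * e p) = ?d i (e (gen (Xv i) * p)) - const l * ?d i p"
        unfolding xe by (simp add: pdiff_simps)
      then have d: "gen (Xv i) * ?d i (e p) = ?d i (e (gen (Xv i) * p)) - const l * ?d i p - e p"
        by (simp add: pdiff_gen_mult[of _ _ "e p"]; simp add: algebra_simps)
      have b: "gen (Xv i) * Bq (2 * i) p = Bq (2 * i) (gen (Xv i) * p) - 2 * ?d i p"
        by (simp add: Bq_gen_X)
      have "gen (Xv i) * G i = 2 * (gen (Xv i) * ?d i (e p)) - const l * (gen (Xv i) * Bq (2 * i) p)"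
        by (simp add: G_def algebra_simps flip: mult_2)
      then show ?thesis unfolding d b by (simp add: algebra_simps)
    qed
    \<comment> \<open>The multiples of \<open>e p\<close> add up to \<open>J e p\<close>, and
      \<open>J\<close> is nonzero because it is not an integer.\<close>
    finally have eq: "const J * (e p - const l * ?d i p)
        = Sum_any (\<lambda>j. if j = i then 0 else gen (Xv j) * G j)
          + (2 * ?d i (e (gen (Xv i) * p)) - const l * Bq (2 * i) (gen (Xv i) * p))"
      unfolding sum dh by (simp add: const_arith algebra_simps)
    have "Sum_any (\<lambda>j. if j = i then 0 else gen (Xv j) * G j) \<in> I"
      by (rule lin_subspace_Sum_any[OF cI]) (auto intro: lin_subspace_0[OF cI] GI W_gen_X[OF stable_I])
    then have "const J * (e p - const l * ?d i p) \<in> I"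
      unfolding eq using ann by (auto intro!: I_ops simp: e_def)
    then show ?thesis using lin_subspace_const_iff[OF cI J0] by blast
  qed
  \<comment> \<open>Differentiate \<open>T1\<close> by \<open>x_j\<close> and compare with
    \<open>G j\<close>.\<close>
  have C: "Bq (i + j) p - 2 * ?d j (?d i p) \<in> I" if "j \<noteq> i" for j
  proof -
    have "const l * (Bq (i + j) p - 2 * ?d j (?d i p)) = 2 * ?d j (e p - const l * ?d i p) - G j"
      by (simp add: G_def pdiff_simps algebra_simps)
    also have "\<dots> \<in> I" by (intro I_ops T1 GI that)
    finally show ?thesis using lin_subspace_const_iff[OF cI] l[of 0] by simp
  qed
  \<comment> \<open>Apply both \<open>e\<close> and the derivative by \<open>x_i\<close> to
    \<open>T1\<close>; their commutator on \<open>p\<close> is \<open>Bq (2 * i) p\<close>.\<close>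
  have ee: "e (e p) - const l * (const l * ?d i (?d i p) + Bq (2 * i) p) \<in> I"
  proof -
    have "e (e p) - const l * (const l * ?d i (?d i p) + Bq (2 * i) p)
        = e (e p - const l * ?d i p) + const l * ?d i (e p - const l * ?d i p)"
      using ed[of i p] by (simp add: e_def op_simps; simp add: algebra_simps)
    also have "\<dots> \<in> I" using T1 by (auto intro!: I_ops simp: e_def)
    finally show ?thesis .
  qed
  \<comment> \<open>Insert \<open>T1\<close> and \<open>ee\<close> into \<open>R\<close> at
    \<open>q = 2 * i\<close>; the factor \<open>l (l + 2)\<close> remains.\<close>
  have Ci: "Bq (2 * i) p - ?d i (?d i p) \<in> I"
  proof -
    have r: "2 * (const (l + 1) * ?d i (e p)) - const (l * (l + 1)) * Bq (2 * i) p - e (e p) \<in> I"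
      using R[of "2 * i"] by simp
    have "const (l * (l + 2)) * (Bq (2 * i) p - ?d i (?d i p))
        = 2 * (const (l + 1) * ?d i (e p - const l * ?d i p))
          - (2 * (const (l + 1) * ?d i (e p)) - const (l * (l + 1)) * Bq (2 * i) p - e (e p))
          - (e (e p) - const l * (const l * ?d i (?d i p) + Bq (2 * i) p))"
      by (simp add: pdiff_simps const_arith; simp add: algebra_simps)
    also have "\<dots> \<in> I" by (intro I_ops T1 r ee)
    finally show ?thesis using lin_subspace_const_iff[OF cI] l[of 0] l[of 2] by simp
  qed
  \<comment> \<open>In \<open>EB\<close>, replace each \<open>Bq\<close> by second derivatives of
    \<open>p\<close>, using \<open>C\<close> for \<open>j \<noteq> i\<close> and \<open>Ci\<close>
    for \<open>j = i\<close>; \<open>g\<close> collects the errors.\<close>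
  have En: "E n p - (H (n + i) (?d i p) + gen (Xv (2 * i + n)) * ?d i (?d i p) + const J * ?d (- n) p) \<in> I"
    if n: "n \<noteq> - i" for n
  proof -
    define g where "g j = gen (Xv (i + j + n)) * (if j = i then ?d i (?d i p) - Bq (2 * i) p else 2 * ?d j (?d i p) - Bq (i + j) p)" for j
    have f1: "finite {j. gen (Xv (i + j + n)) * Bq (i + j) p \<noteq> 0}"
      by (rule finite_subset[OF _ finite_vimageI[OF finite_Bq[of p], of "\<lambda>j. i + j"]]) (auto simp: inj_def)
    have f2: "finite {j. gen (Xv (j + (n + i))) * ?d j (?d i p) \<noteq> 0}"
      by (rule finite_subset[OF _ finite_pdiff[OF inj_Xv, of "?d i p"]]) auto
    have f1': "finite {j. - (gen (Xv (i + j + n)) * Bq (i + j) p) \<noteq> 0}" using f1 by simp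
    have f2': "finite {j. 2 * (gen (Xv (j + (n + i))) * ?d j (?d i p)) \<noteq> 0}"
      by (rule finite_subset[OF _ f2]) auto
    have f3: "finite {j. (- (gen (Xv (2 * i + n)) * ?d i (?d i p)) when j = i) \<noteq> 0}"
      by (rule finite_subset[of _ "{i}"]) auto
    have f12: "finite {j. - (gen (Xv (i + j + n)) * Bq (i + j) p) + 2 * (gen (Xv (j + (n + i))) * ?d j (?d i p)) \<noteq> 0}"
      by (rule finite_subset[OF _ finite_UnI[OF f1' f2']]) auto
    have "Sum_any g = Sum_any (\<lambda>j. (- (gen (Xv (i + j + n)) * Bq (i + j) p) + 2 * (gen (Xv (j + (n + i))) * ?d j (?d i p)))
        + (- (gen (Xv (2 * i + n)) * ?d i (?d i p)) when j = i))"
    proof (rule Sum_any.cong)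
      fix j show "g j = (- (gen (Xv (i + j + n)) * Bq (i + j) p) + 2 * (gen (Xv (j + (n + i))) * ?d j (?d i p)))
        + (- (gen (Xv (2 * i + n)) * ?d i (?d i p)) when j = i)"
        by (cases "j = i") (simp_all add: g_def algebra_simps flip: mult_2)
    qed
    also have "\<dots> = - Sum_any (\<lambda>j. gen (Xv (i + j + n)) * Bq (i + j) p) + 2 * deriv_x (n + i) (?d i p)
        - gen (Xv (2 * i + n)) * ?d i (?d i p)"
    proof -
      have "Sum_any (\<lambda>j. - (gen (Xv (i + j + n)) * Bq (i + j) p)) = - Sum_any (\<lambda>j. gen (Xv (i + j + n)) * Bq (i + j) p)"
        using Sum_any_right_distrib[OF f1, of "- 1"] by simp
      moreover have "Sum_any (\<lambda>j. 2 * (gen (Xv (j + (n + i))) * ?d j (?d i p))) = 2 * deriv_x (n + i) (?d i p)"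
        unfolding deriv_x_def diff_sum_def by (rule Sum_any_right_distrib[OF f2, symmetric])
      ultimately show ?thesis
        unfolding Sum_any.distrib[OF f12 f3] Sum_any.distrib[OF f1' f2'] by simp
    qed
    also have "Sum_any (\<lambda>j. gen (Xv (i + j + n)) * Bq (i + j) p) = Sum_any (\<lambda>j. gen (Xv (j + n)) * Bq j p)"
      by (rule Sum_any.reindex_cong[of "\<lambda>j. i + j", symmetric]) (auto intro!: o_bij[of "\<lambda>j. j - i"])
    finally have "E n p - (H (n + i) (?d i p) + gen (Xv (2 * i + n)) * ?d i (?d i p) + const J * ?d (- n) p) = Sum_any g"
      unfolding EB[of n] HB[OF n] by simp
    moreover have "g j \<in> I" for j
    proof (cases "j = i")
      case True
      have "- (Bq (2 * i) p - ?d i (?d i p)) \<in> I" by (rule lin_subspace_minus[OF cI Ci])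
      then show ?thesis using True by (auto simp: g_def intro!: W_gen_X[OF stable_I])
    next
      case False
      have "- (Bq (i + j) p - 2 * ?d j (?d i p)) \<in> I" by (rule lin_subspace_minus[OF cI C[OF False]])
      then show ?thesis using False by (auto simp: g_def intro!: W_gen_X[OF stable_I])
    qed
    then have "Sum_any g \<in> I" by (rule lin_subspace_Sum_any[OF cI])
    ultimately show ?thesis by simp
  qed
  obtain j where j: "j \<noteq> i" "?d j p \<notin> I" using ex by blast
  define n where "n = - j"
  have n: "n \<noteq> - i" using j by (simp add: n_def)
  have un: "proj_E i l n p \<in> I" using u[OF n] by (simp add: l_def K0)
  define x where "x = gen (Xv (2 * i + n))"
  have xI: "x * q \<in> I" if "q \<in> I" for q unfolding x_def by (rule W_gen_X[OF stable_I that])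
  define t where "t = E n p - (H (n + i) (?d i p) + x * ?d i (?d i p) + const J * ?d j p)"
  have t: "t \<in> I" using En[OF n] by (simp add: t_def x_def n_def)
  have Ht: "H (n + i) (e p - const l * ?d i p) = H (n + i) (e p) - const l * H (n + i) (?d i p)"
    by (simp add: op_simps)
  \<comment> \<open>Modulo \<open>I\<close>, \<open>e p\<close> and \<open>e (e p)\<close> are
    \<open>l\<close> and \<open>l (l + 1)\<close> times the first and second derivative by
    \<open>x_i\<close>. With \<open>En\<close> everything in \<open>proj_E\<close> then cancels
    except the term with \<open>J\<close>.\<close>
  have "const (l * (l + 1) * J) * ?d j p
      = proj_E i l n p - const (l * (l + 1)) * t + const (l + 1) * H (n + i) (e p - const l * ?d i p)
        + x * (e (e p) - const l * (const l * ?d i (?d i p) + Bq (2 * i) p))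
        + const l * (x * (Bq (2 * i) p - ?d i (?d i p)))"
    unfolding Ht unfolding proj_E_def t_def e_def[symmetric] x_def[symmetric]
    by (simp add: const_arith; simp add: algebra_simps)
  also have "\<dots> \<in> I" by (intro I_ops xI un t T1 ee Ci)
  finally have "const (l * (l + 1) * J) * ?d j p \<in> I" .
  moreover have "l * (l + 1) * J \<noteq> 0" using l[of 0] l[of 1] J0 by simp
  ultimately show False using lin_subspace_const_iff[OF cI] j(2) by blast
qed

lemma irreducible_polar:
  assumes W: "lin_subspace W" "I \<subseteq> W" "W \<subseteq> N" "inv_op W" and WI: "W \<noteq> I"
  shows "W = N"
proof -
  have "\<exists>p\<in>W. p \<in> monom_span exps_ground \<and> p \<noteq> 0"
  proof (rule reduce[OF W WI])
    fix p \<delta> assume *: "p \<in> W" "p \<notin> I" "gen (Xv i) * p \<in> I" "h_weight (J - 2 * of_int \<delta>) p"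
      "\<exists>j. j \<noteq> i \<and> pdiff (Xv j) p \<notin> I"
      "\<And>n. n \<noteq> - i \<Longrightarrow> proj_E i (J - of_int i * K - 2 * of_int \<delta>) n p \<in> I"
    then have "p \<in> N" using W(3) by blast
    then show False
    proof (cases "K = 0")
      case True
      then show ?thesis using step_neutral[OF _ \<open>p \<in> N\<close> *(3-6)] K_or by simp
    next
      case False
      then show ?thesis using step_charged[OF _ \<open>p \<in> N\<close> *(5,6)] by simp
    qed
  qed
  then obtain p where p: "p \<in> W" "p \<in> monom_span exps_ground" "p \<noteq> 0" by blast
  \<comment> \<open>Here \<open>r = x_i^-1 q\<close> with \<open>q\<close> x-free. Moving
    \<open>h_n\<close> past \<open>x_i^-1\<close> produces a multiple of
    \<open>x_(n+i) x_i^-2 q\<close>; since \<open>e_(-i)\<close> yields \<open>x_i^-2 q\<close>,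
    this error lies in \<open>W\<close> and can be subtracted.\<close>
  have closed: "gen v * r \<in> W \<and> pdiff v r \<in> W" if v: "v \<in> Y_vars" and r: "r \<in> W" "r \<in> monom_span exps_ground" for v r
  proof -
    obtain k where k: "v = Yv k" "k > 0" "a \<noteq> 0" using v by (auto simp: Y_vars_def V_def)
    then have K: "K \<noteq> 0" and ca: "const a = 1" using K_or a_cases by auto
    define q where "q = gen (Xv i) * r"
    have rq: "r = x_pow i (- 1) * q" unfolding q_def using gen_x_pow[of i "- 1" r] by (simp add: mult.left_commute)
    have key: "lk \<nu> (Xv m) = (if m = i then - 1 else 0)" if "lk r \<nu> \<noteq> 0" for \<nu> m
      using r(2) that excess1_eq_0_exps_M[of \<nu> "Xv m"] iP by (auto simp: monom_span_lookup exps_ground_def)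
    have "lk \<nu> (Xv m) = 0" if "lk q \<nu> \<noteq> 0" for \<nu> m
      using key[of "\<nu> - sgl (Xv i) 1" m] that by (auto simp: q_def lookup_down split: if_splits)
    then have "pdiff (Xv m) q = 0" for m
      by (intro pdiff_eq_0) (auto simp: laurent_vars_def in_keys_iff)
    then have q: "Xfree q" by (simp add: Xfree_def)
    have "E (- i) r \<in> W" using W(4) r by (auto simp: inv_op_def)
    then have "const (of_int (- 1) * (J - of_int i * K - of_int (- 1) + 1)) * (x_pow i (- 2) * q) \<in> W"
      unfolding rq E_x_pow_Xfree[OF q] by simp
    moreover have "of_int (- 1) * (J - of_int i * K - of_int (- 1) + 1) \<noteq> 0"
      using nonint[of 2] by (simp add: algebra_simps)
    ultimately have x2: "x_pow i (- 2) * q \<in> W"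
      using lin_subspace_const_iff[OF W(1)] by blast
    have "x_pow i (- 1) * H n q \<in> W" for n
    proof -
      have "H n r \<in> W" using W(4) r by (auto simp: inv_op_def)
      moreover have "gen (Xv (n + i)) * (x_pow i (- 2) * q) \<in> W" using W(4) x2 by (auto simp: inv_op_def)
      moreover have "x_pow i (- 1) * H n q = H n r + const (- 2) * (gen (Xv (n + i)) * (x_pow i (- 2) * q))"
        unfolding rq H_x_pow by (simp add: const_minus)
      ultimately show ?thesis by (simp only: lin_subspace_add[OF W(1)] lin_subspace_const[OF W(1)])
    qed
    from this[of "- int k"] this[of "int k"]
    have "x_pow i (- 1) * (gen v * q) \<in> W" "const (2 * of_nat k * K) * (x_pow i (- 1) * pdiff v q) \<in> W"
      using k by (simp_all add: Xfree_H[OF q] ca mult.left_commute)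
    then have "x_pow i (- 1) * (gen v * q) \<in> W" "x_pow i (- 1) * pdiff v q \<in> W"
      using lin_subspace_const_iff[OF W(1)] K k by simp_all
    moreover have "x_pow i (- 1) * (gen v * q) = gen v * r" unfolding rq by (rule mult.left_commute)
    moreover have "x_pow i (- 1) * pdiff v q = pdiff v r"
      using gen_x_pow[of i "- 1" "pdiff v r"] k by (simp add: q_def pdiff_gen_mult mult.left_commute)
    ultimately show ?thesis by simp
  qed
  have A0W: "monom \<nu> \<in> W" if "\<nu> \<in> exps_ground" for \<nu>
    using exps_ground_all[OF W(1,2) closed p that] .
  \<comment> \<open>\<open>e_(-i)\<close> deepens the pole in \<open>x_i\<close> one step at a time,
    starting from exponent \<open>-1\<close>; its factor is nonzero since \<open>J - iK\<close> is
    not an integer.\<close>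
  have xi: "monom \<nu> \<in> W" if "\<nu> \<in> exps_M" "\<And>m. Xv m \<notin> P \<Longrightarrow> lk \<nu> (Xv m) = 0" for \<nu>
    using that
  proof (induction "nat (- lk \<nu> (Xv i) - 1)" arbitrary: \<nu>)
    case 0
    then have "lk \<nu> (Xv i) = - 1" using iP[of i] by (force simp: exps_M_def)
    then have "\<nu> \<in> exps_ground" using 0 iP by (auto simp: exps_ground_def excess1_def)
    then show ?case by (rule A0W)
  next
    case (Suc n)
    define \<mu> where "\<mu> = \<nu> + sgl (Xv i) 1"
    define m where "m = lk \<mu> (Xv i)"
    have m: "m < 0" "m = lk \<nu> (Xv i) + 1" using Suc.hyps(2) by (auto simp: m_def \<mu>_def lookup_up)
    have "\<mu> \<in> exps_M"
      using exps_N_add[OF exps_M_exps_N[OF Suc.prems(1)], of "Xv i"] Suc.prems(1) m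
      by (auto simp: exps_M_def \<mu>_def lookup_up V_def)
    moreover have "lk \<mu> (Xv k) = 0" if "Xv k \<notin> P" for k
      using Suc.prems(2)[OF that] that iP by (auto simp: \<mu>_def lookup_up)
    moreover have "n = nat (- lk \<mu> (Xv i) - 1)" using Suc.hyps(2) m by (simp add: m_def)
    ultimately have \<mu>W: "monom \<mu> \<in> W" using Suc.hyps(1) by blast
    define q where "q = monom (\<mu> - sgl (Xv i) m)"
    have q: "Xfree q" unfolding q_def
    proof (rule Xfree_monom)
      fix k show "lk (\<mu> - sgl (Xv i) m) (Xv k) = 0"
        using Suc.prems(2)[of k] iP[of k] by (cases "k = i") (simp_all add: m_def lookup_minus \<mu>_def lookup_up lookup_single)
    qed
    have "monom \<mu> = x_pow i m * q" by (simp add: q_def mult_single)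
    then have "E (- i) (monom \<mu>) = const (of_int m * (J - of_int i * K - of_int m + 1)) * (x_pow i (m - 1) * q)"
      by (simp only: E_x_pow_Xfree[OF q])
    moreover have "x_pow i (m - 1) * q = monom \<nu>"
      by (simp add: q_def mult_single \<mu>_def single_diff)
    moreover have "E (- i) (monom \<mu>) \<in> W" using W(4) \<mu>W by (auto simp: inv_op_def)
    moreover have "J - of_int i * K - of_int m + 1 = J - of_int i * K + of_int (1 - m)" by simp
    then have "of_int m * (J - of_int i * K - of_int m + 1) \<noteq> 0"
      using m(1) nonint[of "1 - m"] by (simp only: mult_eq_0_iff of_int_eq_0_iff) simp
    ultimately show ?case using lin_subspace_const_iff[OF W(1)] by metis
  qed
  have "monom \<nu> \<in> W" if "\<nu> \<in> exps_M" for \<nu>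
    using X_all[OF W(1,4) xi that] .
  then show ?thesis using N_subset[OF W(1,2)] W(3) by blast
qed

end

section \<open>A polar \<open>x\<close>-variable: the integral case\<close>

context free_field
begin

lemma lin_op_E_pow: "lin_op (E m ^^ n)"
proof (induction n)
  case (Suc n)
  then show ?case using lin_op_comp[OF lin_op_E[of m] Suc] by (simp add: comp_def)
qed (simp add: id_def lin_op_id)

lemmas Ep_simps = lin_op_simps[OF lin_op_E_pow]

lemma E_pow_E: "(E m ^^ n) (E k p) = E k ((E m ^^ n) p)"
  by (induction n) (simp_all add: E_E[of m k])

lemma E_pow_stable: "stable W \<Longrightarrow> p \<in> W \<Longrightarrow> (E m ^^ n) p \<in> W"
  by (induction n) (simp_all add: W_E)

text \<open>The commutator of \<open>e_(-i)\<close> with \<open>h_m\<close> is a multiple of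
  \<open>e_(m-i)\<close>, which commutes with \<open>e_(-i)\<close>, so one more power
  suffices.\<close>

lemma E_pow_H:
  assumes "stable W" "(E (- i) ^^ n) p \<in> W"
  shows "(E (- i) ^^ Suc n) (H m p) \<in> W"
  using assms(2)
proof (induction n arbitrary: p)
  case 0 then show ?case using assms(1) by (simp add: W_E W_H)
next
  case (Suc n)
  have "E (- i) (H m p) = H m (E (- i) p) - 2 * E (m - i) p"
    using H_E[of m "- i" p] by simp
  then have "(E (- i) ^^ Suc (Suc n)) (H m p)
      = (E (- i) ^^ Suc n) (H m (E (- i) p)) - 2 * E (m - i) ((E (- i) ^^ Suc n) p)"
    by (simp only: funpow_Suc_right[of "Suc n"] comp_apply Ep_simps E_pow_E)
  also have "\<dots> \<in> W"
    using Suc by (intro lin_subspace_diff lin_subspace_numeral W_lin_subspace W_E assms(1)) (simp_all only: funpow_Suc_right comp_apply)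
  finally show ?case .
qed

text \<open>The commutator of \<open>e_(-i)\<close> with \<open>x_m\<close> is an \<open>h\<close>
  plus a scalar, so by \<open>E_pow_H\<close> two more powers suffice.\<close>

lemma E_pow_X:
  assumes "stable W" "(E (- i) ^^ n) p \<in> W"
  shows "(E (- i) ^^ (n + 2)) (gen (Xv m) * p) \<in> W"
  using assms(2)
proof (induction n arbitrary: p)
  case 0 then show ?case using assms(1) by (simp add: numeral_2_eq_2 W_E W_gen_X)
next
  case (Suc n)
  define c where "c = (if - i + m = 0 then K * of_int (- i) else 0)"
  have "E (- i) (gen (Xv m) * p) = gen (Xv m) * E (- i) p + H (- i + m) p + const c * p"
    by (simp add: E_gen_X c_def when_def)
  then have "(E (- i) ^^ Suc (Suc (Suc n))) (gen (Xv m) * p)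
      = (E (- i) ^^ Suc (Suc n)) (gen (Xv m) * E (- i) p) + (E (- i) ^^ Suc (Suc n)) (H (- i + m) p)
        + const c * (E (- i) ^^ Suc (Suc n)) p"
    by (simp only: funpow_Suc_right[of "Suc (Suc n)"] comp_apply Ep_simps)
  also have "(E (- i) ^^ Suc (Suc n)) p = E (- i) ((E (- i) ^^ Suc n) p)" by simp
  also have "(E (- i) ^^ Suc (Suc n)) (gen (Xv m) * E (- i) p) + (E (- i) ^^ Suc (Suc n)) (H (- i + m) p)
        + const c * \<dots> \<in> W"
  proof (intro lin_subspace_add lin_subspace_const W_lin_subspace W_E E_pow_H assms(1))
    have "(E (- i) ^^ n) (E (- i) p) \<in> W" using Suc.prems by (simp only: funpow_Suc_right comp_apply)
    then show "(E (- i) ^^ Suc (Suc n)) (gen (Xv m) * E (- i) p) \<in> W"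
      using Suc.IH[of "E (- i) p"] by (simp add: numeral_2_eq_2)
  qed (rule Suc.prems)+
  finally show ?case by (simp only: add_2_eq_Suc')
qed

text \<open>The commutator with \<open>D\<close> is a multiple of \<open>e_(-i)\<close> itself, so
  the same power works.\<close>

lemma E_pow_D:
  assumes "stable W" "(E (- i) ^^ n) p \<in> W"
  shows "(E (- i) ^^ n) (D p) \<in> W"
  using assms(2)
proof (induction n arbitrary: p)
  case 0 then show ?case using assms(1) by (simp add: W_D)
next
  case (Suc n)
  have "E (- i) (D p) = D (E (- i) p) + const (of_int i) * E (- i) p"
    using D_E[of "- i" p] by (simp add: const_minus)
  then have "(E (- i) ^^ Suc n) (D p) = (E (- i) ^^ n) (D (E (- i) p)) + const (of_int i) * (E (- i) ^^ Suc n) p"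
    by (simp only: funpow_Suc_right comp_apply Ep_simps)
  also have "\<dots> \<in> W"
    using Suc by (intro lin_subspace_add lin_subspace_const W_lin_subspace assms(1)) (simp_all only: funpow_Suc_right comp_apply)
  finally show ?case .
qed

lemma H_shift_gen: "H_shift i (gen (Xv m) * p) = gen (Xv m) * H_shift i p - 2 * (gen (Xv m) * p)"
  by (simp add: H_shift_def H_gen_X; simp add: algebra_simps)

end

locale integral_weight = laurent_space +
  fixes i z :: int
  assumes P_X: "P \<inter> range Xv = {Xv i}" and J_int: "J - of_int i * K = of_int z"
begin

text \<open>With exponent \<open>-1\<close> at each polar y-variable, the vectors
  \<open>x_i^m Y0\<close> with \<open>m < 0\<close> stay outside \<open>I\<close>.\<close>

definition y0 :: "var \<Rightarrow>\<^sub>0 int" where "y0 = - (\<Sum>v\<in>P - {Xv i}. sgl v 1)"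
definition Y0 :: laurent where "Y0 = monom y0"

lemma lookup_y0: "lk y0 w = (if w \<in> P - {Xv i} then - 1 else 0)"
  using finite_P unfolding y0_def lookup_uminus lookup_sum by (simp add: lookup_single when_def)

lemma P_Xv: "Xv m \<in> P \<longleftrightarrow> m = i" using P_X by auto

lemma V_X: "Xv m \<in> V" by (simp add: V_def)

lemma Xfree_Y0: "Xfree Y0"
  unfolding Y0_def by (rule Xfree_monom) (auto simp: lookup_y0 P_Xv)

lemma x_pow_Y0: "x_pow i m * Y0 = monom (sgl (Xv i) m + y0)"
  by (simp add: Y0_def mult_single)

lemma lookup_x_pow_y0: "lk (sgl (Xv i) m + y0) w = (if w = Xv i then m else if w \<in> P then - 1 else 0)"
  by (auto simp: lookup_add lookup_single lookup_y0)

lemma x_pow_Y0_exps_N: "sgl (Xv i) m + y0 \<in> exps_N"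
  unfolding exps_N_def using PV P_Xv V_X by (auto simp: lookup_x_pow_y0)

lemma x_pow_Y0_exps_M: "m < 0 \<Longrightarrow> sgl (Xv i) m + y0 \<in> exps_M"
  using x_pow_Y0_exps_N by (auto simp: exps_M_def lookup_x_pow_y0)

text \<open>The factor at exponent \<open>- r - n\<close> is
  \<open>- (r + n) (z + r + n + 1)\<close>, nonzero by the assumptions on \<open>r\<close>.\<close>

lemma E_not_nilpotent:
  assumes r: "r > 0" "r + z \<ge> 0"
  shows "\<exists>c. c \<noteq> 0 \<and> (E (- i) ^^ n) (x_pow i (- r) * Y0) = const c * (x_pow i (- r - int n) * Y0)"
proof (induction n)
  case 0 show ?case by (intro exI[of _ 1]) simp
next
  case (Suc n)
  then obtain c where c: "c \<noteq> 0" "(E (- i) ^^ n) (x_pow i (- r) * Y0) = const c * (x_pow i (- r - int n) * Y0)" by blast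
  define d where "d = c * (of_int (- r - int n) * (J - of_int i * K - of_int (- r - int n) + 1))"
  have "- r - int n \<noteq> 0" using r by simp
  moreover have "J - of_int i * K - of_int (- r - int n) + 1 = of_int (z + r + int n + 1)" by (simp add: J_int)
  moreover have "z + r + int n + 1 \<noteq> 0" using r by simp
  ultimately have "d \<noteq> 0" unfolding d_def using c(1) by (simp only: mult_eq_0_iff of_int_eq_0_iff) simp
  moreover have "(E (- i) ^^ Suc n) (x_pow i (- r) * Y0) = const d * (x_pow i (- r - int (Suc n)) * Y0)"
  proof -
    have "(E (- i) ^^ Suc n) (x_pow i (- r) * Y0) = const c * E (- i) (x_pow i (- r - int n) * Y0)"
      by (simp add: c(2) op_simps)
    also have "\<dots> = const d * (x_pow i (- r - int n - 1) * Y0)"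
      unfolding E_x_pow_Xfree[OF Xfree_Y0] by (simp only: d_def const_mult mult.assoc)
    finally show ?thesis by (simp add: algebra_simps)
  qed
  ultimately show ?case by blast
qed

text \<open>In the variables \<open>x\<^sub>i\<^sub>+\<^sub>b\<^sub>L\<close> with \<open>b > 0\<close> the terms of \<open>e\<^sub>-\<^sub>i\<close> and \<open>h\<^sub>b\<^sub>L\<close> that involve \<open>\<partial>y\<close> vanish on \<open>Y0\<close>.\<close>

definition L :: int where "L = 1 + Max (insert 0 (int ` {k. Yv k \<in> P}))"

lemma finite_YP: "finite {k. Yv k \<in> P}"
  using finite_vimageI[OF finite_P inj_Yv] by (simp add: vimage_def)

lemma L: "L > 0" "Yv (nat (int b * L)) \<notin> P" if "b \<ge> 1" for b
proof -
  have fin: "finite (insert 0 (int ` {k. Yv k \<in> P}))" using finite_YP by simp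
  have "0 \<le> Max (insert 0 (int ` {k. Yv k \<in> P}))" by (rule Max_ge[OF fin]) simp
  then show L: "L > 0" by (simp add: L_def)
  show "Yv (nat (int b * L)) \<notin> P"
  proof
    assume "Yv (nat (int b * L)) \<in> P"
    then have "int (nat (int b * L)) \<in> insert 0 (int ` {k. Yv k \<in> P})" by blast
    then have "int (nat (int b * L)) \<le> L - 1" using Max_ge[OF fin] by (simp only: L_def) simp
    then have "int b * L \<le> L - 1" by linarith
    moreover have "1 * L \<le> int b * L" using that L by (intro mult_right_mono) auto
    ultimately show False by simp
  qed
qed

text \<open>Forms of degree \<open>s\<close> in the variables \<open>x_(i+bL)\<close> with
  \<open>b \<ge> 1\<close>, times \<open>Y0\<close>. With these indices, commutators with
  \<open>e_(-i)\<close> only involve \<open>h_(bL)\<close> with \<open>b \<ge> 1\<close>.\<close>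

inductive QX :: "nat \<Rightarrow> laurent \<Rightarrow> bool" where
  Y0: "QX 0 Y0"
| X: "QX s p \<Longrightarrow> b \<ge> 1 \<Longrightarrow> QX (Suc s) (gen (Xv (i + int b * L)) * p)"
| zero: "QX s 0"
| add: "QX s p \<Longrightarrow> QX s q \<Longrightarrow> QX s (p + q)"
| const: "QX s p \<Longrightarrow> QX s (const c * p)"

lemma QX_H: "QX s p \<Longrightarrow> b \<ge> 1 \<Longrightarrow> QX s (H (int b * L) p) \<and> (s = 0 \<longrightarrow> H (int b * L) p = 0)"
proof (induction rule: QX.induct)
  case Y0
  have "pdiff (Yv (nat (int b * L))) Y0 = 0"
  proof (rule pdiff_eq_0)
    show "Yv (nat (int b * L)) \<notin> laurent_vars Y0"
      using L(2)[OF Y0] by (auto simp: laurent_vars_def Y0_def in_keys_iff lookup_y0 split: if_splits)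
  qed
  moreover have "int b * L > 0" "b \<noteq> 0" "L \<noteq> 0" using L(1)[OF Y0] Y0 by auto
  ultimately have "H (int b * L) Y0 = 0" by (simp add: Xfree_H[OF Xfree_Y0])
  then show ?case by (simp add: QX.zero)
next
  case (X s p b')
  have "QX (Suc s) (gen (Xv (i + int (b + b') * L)) * p)"
    using X by (intro QX.X) auto
  then have "QX (Suc s) (const (- 2) * (gen (Xv (i + int (b + b') * L)) * p))" by (rule QX.const)
  moreover have "QX (Suc s) (gen (Xv (i + int b' * L)) * H (int b * L) p)"
    using X by (intro QX.X) auto
  moreover have "H (int b * L) (gen (Xv (i + int b' * L)) * p) = gen (Xv (i + int b' * L)) * H (int b * L) p
      + const (- 2) * (gen (Xv (i + int (b + b') * L)) * p)"
    by (simp add: H_gen_X const_minus; simp add: algebra_simps)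
  ultimately show ?case by (simp only: QX.add) simp
qed (auto simp: op_simps intro: QX.intros)

text \<open>The commutator of \<open>e_(-i)\<close> with \<open>x_(i+bL)\<close> is
  \<open>h_(bL)\<close>, which preserves the degree, so one degree is lost. Since
  \<open>h_(bL)\<close> kills \<open>Y0\<close>, degree one is already sent to zero.\<close>

lemma QX_E: "QX s p \<Longrightarrow> (s \<le> 1 \<longrightarrow> E (- i) p = 0) \<and> (\<forall>t. s = Suc t \<longrightarrow> QX t (E (- i) p))"
proof (induction rule: QX.induct)
  case Y0 then show ?case by (simp add: Xfree_E[OF Xfree_Y0])
next
  case (X s p b)
  have "int b * L \<noteq> 0" using L(1)[OF X(2)] X(2) by simp
  then have e: "E (- i) (gen (Xv (i + int b * L)) * p) = gen (Xv (i + int b * L)) * E (- i) p + H (int b * L) p"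
    by (simp add: E_gen_X)
  show ?case
  proof (cases s)
    case 0
    then have "E (- i) (gen (Xv (i + int b * L)) * p) = 0"
      unfolding e using X QX_H[OF X(1,2)] by simp
    then show ?thesis using 0 QX.zero by simp
  next
    case (Suc t)
    then have "QX s (gen (Xv (i + int b * L)) * E (- i) p)" using X by (auto intro: QX.X)
    then show ?thesis unfolding e using QX_H[OF X(1,2)] Suc by (auto intro: QX.add)
  qed
qed (auto simp: op_simps intro: QX.intros)

lemma QX_x_pow_N: "QX s p \<Longrightarrow> x_pow i m * p \<in> N"
proof (induction rule: QX.induct)
  case Y0 show ?case unfolding x_pow_Y0 by (simp add: monom_in_monom_span x_pow_Y0_exps_N)
next
  case (X s p b) then show ?case using W_gen_X[OF stable_N] by (simp add: mult.left_commute[of "x_pow i m"] del: gen_mult_monom)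
qed (auto simp: distrib_left mult.left_commute[of "x_pow i m"] intro: lin_subspace_intros[OF lin_subspace_monom_span])

text \<open>Ensures that the exponent of \<open>x_i\<close> in a summand of
  \<open>singular_vec\<close> is that of its explicit power of \<open>x_i\<close>.\<close>

lemma QX_no_i: "QX s p \<Longrightarrow> pdiff (Xv i) p = 0"
proof (induction rule: QX.induct)
  case Y0 show ?case using Xfree_Y0 by (simp add: Xfree_def)
next
  case (X s p b)
  then show ?case using L(1)[OF X(2)] by (simp add: pdiff_gen_mult)
qed (auto simp: pdiff_simps)

lemma QX_lookup:
  assumes "QX s p" "lk p \<nu> \<noteq> 0"
  shows "lk \<nu> (Xv i) = 0"
proof -
  have "lk (pdiff (Xv i) p) (\<nu> - sgl (Xv i) 1) = 0" by (simp add: QX_no_i[OF assms(1)])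
  then show ?thesis using assms(2) by (simp add: lookup_pdiff lookup_minus)
qed

section \<open>The singular vector\<close>

definition start_deg :: nat where "start_deg = nat (max (z + 1) 1)"
text \<open>With \<open>s = start_deg\<close> and \<open>r = pole_deg\<close>, the value
  \<open>r = 2 s - 1 - z\<close> makes the factor in \<open>E_term\<close> vanish at
  \<open>n = 0\<close>, and \<open>s \<ge> z + 1\<close> gives \<open>r \<ge> s\<close>, so that
  \<open>q r = 0\<close>.\<close>

definition pole_deg :: nat where "pole_deg = nat (2 * int start_deg - 1 - z)"

lemma start_deg: "start_deg \<ge> 1" "int start_deg \<ge> z + 1" by (auto simp: start_deg_def)
lemma pole_deg: "int pole_deg = 2 * int start_deg - 1 - z" "pole_deg \<ge> start_deg" "pole_deg \<ge> 1" using start_deg by (auto simp: pole_deg_def)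

definition q :: "nat \<Rightarrow> laurent" where "q n = (E (- i) ^^ n) (gen (Xv (i + L)) ^ start_deg * Y0)"

lemma QX_q0: "QX s (gen (Xv (i + L)) ^ s * Y0)"
proof (induction s)
  case (Suc s)
  then show ?case using QX.X[of s _ 1] by (simp add: mult.assoc)
qed (simp add: QX.Y0)

lemma QX_q: "n \<le> start_deg \<Longrightarrow> QX (start_deg - n) (q n)"
proof (induction n)
  case 0 show ?case using QX_q0 by (simp add: q_def)
next
  case (Suc n)
  then have "QX (start_deg - n) (q n)" "start_deg - n = Suc (start_deg - Suc n)" by auto
  then show ?case using QX_E by (auto simp: q_def)
qed

lemma q_0: "n \<ge> start_deg \<Longrightarrow> q n = 0"
proof (induction n rule: dec_induct)
  case base
  obtain t where t: "start_deg = Suc t" using start_deg(1) by (cases start_deg) auto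
  have "QX 1 (q t)" using QX_q[of t] t by simp
  then have "E (- i) (q t) = 0" using QX_E by auto
  then show ?case by (simp add: t q_def)
qed (simp add: q_def op_simps)

lemma QX_q': "\<exists>s. QX s (q n)"
  using QX_q[of n] q_0[of n] QX.zero by (cases "n \<le> start_deg") auto

lemma H_shift_q: "H_shift i (q n) = const (of_int (z - 2 * int start_deg + 2 * int n)) * q n"
proof (induction n)
  case 0
  have "H_shift i (gen (Xv (i + L)) ^ s * Y0) = const (of_int (z - 2 * int s)) * (gen (Xv (i + L)) ^ s * Y0)" for s
  proof (induction s)
    case 0 show ?case using J_int by (simp add: H_shift_Xfree[OF Xfree_Y0])
  next
    case (Suc s) then show ?case by (simp add: mult.assoc H_shift_gen const_arith; simp add: algebra_simps)
  qed
  then show ?case by (simp add: q_def)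
next
  case (Suc n)
  have "q (Suc n) = E (- i) (q n)" by (simp add: q_def)
  then show ?case by (simp only: H_shift_E Suc E_simps) (simp add: const_arith; simp add: algebra_simps)
qed

text \<open>The recursion makes consecutive terms of \<open>e\<^sub>-\<^sub>i\<close> applied to \<open>singular_vec\<close> cancel; the last one vanishes since
  \<open>e\<^sub>-\<^sub>i\<close> lowers the degree in the \<open>x\<close>-variables.\<close>

fun singular_vec_coeff :: "nat \<Rightarrow> complex" where
  "singular_vec_coeff 0 = 1"
| "singular_vec_coeff (Suc n) = singular_vec_coeff n / (of_nat (Suc n) * of_int (int pole_deg - int n - 1))"

definition singular_vec :: laurent where
  "singular_vec = (\<Sum>n<pole_deg. const (singular_vec_coeff n) * (x_pow i (int n - int pole_deg) * q n))"

text \<open>With \<open>r = pole_deg\<close>, the weight of \<open>q n\<close> is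
  \<open>(n - r - 1) + n\<close>, which reduces the \<open>sl_2\<close> factor to
  \<open>(n - r) n\<close>. Thus the summand \<open>n = 0\<close> leaves no term that would have to
  be cancelled from below.\<close>

lemma E_term: "E (- i) (x_pow i (int n - int pole_deg) * q n)
    = x_pow i (int n - int pole_deg) * q (Suc n) + const (of_int ((int n - int pole_deg) * int n)) * (x_pow i (int n - int pole_deg - 1) * q n)"
proof -
  have c: "z - 2 * int start_deg + 2 * int n = (int n - int pole_deg - 1) + int n" using pole_deg(1) by simp
  have "q (Suc n) = E (- i) (q n)" by (simp add: q_def)
  then show ?thesis
    unfolding E_x_pow H_shift_q c by (simp add: const_arith; simp add: algebra_simps)
qed

lemma E_singular_vec: "E (- i) singular_vec = 0"
proof -
  have "E (- i) (\<Sum>n<Suc m. const (singular_vec_coeff n) * (x_pow i (int n - int pole_deg) * q n))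
     = const (singular_vec_coeff m) * (x_pow i (int m - int pole_deg) * q (Suc m))" if "m < pole_deg" for m
    using that
  proof (induction m)
    case 0 show ?case using E_term[of 0] by simp
  next
    case (Suc m)
    have "singular_vec_coeff (Suc m) * of_int ((int (Suc m) - int pole_deg) * int (Suc m)) = - singular_vec_coeff m"
    proof -
      have "of_int (int pole_deg - int m - 1) \<noteq> (0 :: complex)" using Suc.prems by (simp only: of_int_eq_0_iff)
      moreover have "of_nat (Suc m) \<noteq> (0 :: complex)" by (rule of_nat_neq_0)
      moreover have "of_int ((int (Suc m) - int pole_deg) * int (Suc m)) = - (of_nat (Suc m) * of_int (int pole_deg - int m - 1) :: complex)"
        by (simp add: algebra_simps)
      ultimately show ?thesis by (simp del: of_nat_Suc of_int_diff)
    qed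
    then have g: "const (singular_vec_coeff (Suc m)) * const (of_int ((int (Suc m) - int pole_deg) * int (Suc m))) = - const (singular_vec_coeff m)"
      by (simp only: const_mult[symmetric] const_minus[symmetric])
    have "int (Suc m) - int pole_deg - 1 = int m - int pole_deg" by simp
    then have "E (- i) (const (singular_vec_coeff (Suc m)) * (x_pow i (int (Suc m) - int pole_deg) * q (Suc m)))
       = const (singular_vec_coeff (Suc m)) * (x_pow i (int (Suc m) - int pole_deg) * q (Suc (Suc m)))
         + (const (singular_vec_coeff (Suc m)) * const (of_int ((int (Suc m) - int pole_deg) * int (Suc m)))) * (x_pow i (int m - int pole_deg) * q (Suc m))"
      unfolding E_simps E_term by (simp only: distrib_left mult.assoc)
    then show ?case
      using Suc unfolding g sum.lessThan_Suc[of _ "Suc m"] by (simp only: E_simps) simp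
  qed
  from this[of "pole_deg - 1"] have "E (- i) singular_vec = const (singular_vec_coeff (pole_deg - 1)) * (x_pow i (int (pole_deg - 1) - int pole_deg) * q (Suc (pole_deg - 1)))"
    using pole_deg(3) by (simp add: singular_vec_def)
  moreover have "q (Suc (pole_deg - 1)) = 0" using pole_deg by (intro q_0) simp
  ultimately show ?thesis by simp
qed

lemma singular_vec_N: "singular_vec \<in> N"
  unfolding singular_vec_def using QX_q' QX_x_pow_N by (intro lin_subspace_sum lin_subspace_const lin_subspace_monom_span) blast

lemma lookup_x_pow: "lk (x_pow j m * p) \<nu> = lk p (\<nu> - sgl (Xv j) m)"
proof -
  have "\<forall>\<nu>. lk (x_pow j m * p) \<nu> = lk p (\<nu> - sgl (Xv j) m)"
  proof (induction m rule: int_induct[where k = 0])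
    case base show ?case by simp
  next
    case (step1 m)
    have "x_pow j (m + 1) * p = gen (Xv j) * (x_pow j m * p)" by (simp only: gen_x_pow)
    then show ?case using step1 by (simp only: lookup_gen_mult) (simp add: single_add diff_diff_add add.commute)
  next
    case (step2 m)
    have "x_pow j m * p = gen (Xv j) * (x_pow j (m - 1) * p)" by (simp only: gen_x_pow diff_add_cancel)
    then have "lk (x_pow j (m - 1) * p) (\<nu> - sgl (Xv j) 1) = lk p (\<nu> - sgl (Xv j) m)" for \<nu>
      using step2 by (metis lookup_gen_mult)
    from this[of "_ + sgl (Xv j) 1"] show ?case by (simp add: single_diff algebra_simps)
  qed
  then show ?thesis by blast
qed

lemma singular_vec_I: "singular_vec \<notin> I"
proof
  assume s: "singular_vec \<in> I"
  \<comment> \<open>The monomial \<open>x_i^(-r) x_(i+L)^s Y0\<close>. Only the summand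
    \<open>n = 0\<close> contributes to it, the others having another exponent at
    \<open>x_i\<close>.\<close>
  define \<nu> where "\<nu> = (sgl (Xv i) (- int pole_deg) + y0) + sgl (Xv (i + L)) (int start_deg)"
  have L0: "L \<noteq> 0" using L(1)[of 1] by simp
  have lk\<nu>: "lk \<nu> w = (if w = Xv i then - int pole_deg else if w \<in> P then - 1 else if w = Xv (i + L) then int start_deg else 0)" for w
    using L0 P_Xv[of "i + L"] by (auto simp: \<nu>_def lookup_add lookup_y0 lookup_single)
  have "\<nu> \<in> exps_N" unfolding exps_N_def using PV P_Xv V_X by (auto simp: lk\<nu>)
  then have "\<nu> \<in> exps_M" using pole_deg(3) by (auto simp: exps_M_def lk\<nu>)
  then have "lk singular_vec \<nu> = 0" using s by (auto simp: monom_span_lookup)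
  moreover have "lk singular_vec \<nu> = (\<Sum>n<pole_deg. if n = 0 then 1 else 0)"
    unfolding singular_vec_def lookup_sum
  proof (rule sum.cong[OF refl])
    fix n
    show "lk (const (singular_vec_coeff n) * (x_pow i (int n - int pole_deg) * q n)) \<nu> = (if n = 0 then 1 else 0)"
    proof (cases "n = 0")
      case True
      then have "lk (const (singular_vec_coeff n) * (x_pow i (int n - int pole_deg) * q n)) \<nu>
          = lk Y0 (\<nu> - sgl (Xv i) (- int pole_deg) - sgl (Xv (i + L)) (int start_deg))"
        by (simp only: singular_vec_coeff.simps const_1 mult_1 lookup_x_pow q_def funpow_0 lookup_gen_power) simp
      also have "\<nu> - sgl (Xv i) (- int pole_deg) - sgl (Xv (i + L)) (int start_deg) = y0"
        by (simp add: \<nu>_def)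
      finally show ?thesis using True by (simp add: Y0_def)
    next
      case False
      obtain s where "QX s (q n)" using QX_q' by blast
      moreover have "lk (\<nu> - sgl (Xv i) (int n - int pole_deg)) (Xv i) \<noteq> 0"
        using False by (simp add: lookup_minus lk\<nu>)
      ultimately have "lk (q n) (\<nu> - sgl (Xv i) (int n - int pole_deg)) = 0" using QX_lookup by blast
      then show ?thesis using False by (simp only: lookup_const_mult lookup_x_pow) simp
    qed
  qed
  ultimately show False using pole_deg(3) by simp
qed

lemma reducible: "\<not> irreducible_lie_module CC affine_sl2 (lie_quotient (laurent_module N rep) I)"
proof -
  define W where "W = {p \<in> N. \<exists>n. (E (- i) ^^ n) p \<in> I}"
  \<comment> \<open>Brings two elements of \<open>W\<close> to a common power of
    \<open>e_(-i)\<close>.\<close>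
  have mono: "(E (- i) ^^ (n + m)) p \<in> I" if "(E (- i) ^^ n) p \<in> I" for n m :: nat and p
    using E_pow_stable[OF stable_I that, where m = "- i" and n = m] by (simp add: funpow_add add.commute[of n])
  have "lin_subspace W"
    unfolding lin_subspace_def
  proof (intro conjI ballI allI)
    show "0 \<in> W" using lin_subspace_0[OF lin_subspace_monom_span[of "exps_N - exps_M"]] by (auto simp: W_def lin_subspace_0[OF lin_subspace_monom_span] intro!: exI[of _ 0])
    fix p assume p: "p \<in> W"
    then obtain n where n: "(E (- i) ^^ n) p \<in> I" by (auto simp: W_def)
    show "const c * p \<in> W" for c
      using p n lin_subspace_const[OF lin_subspace_monom_span] unfolding W_def by (auto simp: Ep_simps)
    fix r assume r: "r \<in> W"
    then obtain m where m: "(E (- i) ^^ m) r \<in> I" by (auto simp: W_def)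
    have "(E (- i) ^^ (n + m)) (p + r) \<in> I"
      unfolding Ep_simps using mono[OF n, of m] mono[OF m, of n] by (intro lin_subspace_add[OF lin_subspace_monom_span]) (simp_all add: add.commute)
    then show "p + r \<in> W" using p r lin_subspace_add[OF lin_subspace_monom_span] unfolding W_def by blast
  qed
  moreover have "I \<subseteq> W"
    using monom_span_mono[of "exps_N - exps_M" exps_N] by (auto simp: W_def intro!: exI[of _ 0])
  moreover have "W \<subseteq> N" by (auto simp: W_def)
  moreover have "inv_op W"
    unfolding inv_op_def
  proof (intro ballI conjI allI)
    fix p assume "p \<in> W"
    then obtain n where p: "p \<in> N" "(E (- i) ^^ n) p \<in> I" by (auto simp: W_def)
    show "E m p \<in> W" for m
      using W_E[OF stable_N p(1)] W_E[OF stable_I p(2)] unfolding W_def by (auto simp: E_pow_E intro!: exI[of _ n])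
    show "gen (Xv m) * p \<in> W" for m
      using W_gen_X[OF stable_N p(1)] E_pow_X[OF stable_I p(2)] unfolding W_def by blast
    show "H m p \<in> W" for m
      using W_H[OF stable_N p(1)] E_pow_H[OF stable_I p(2)] unfolding W_def by blast
    show "D p \<in> W"
      using W_D[OF stable_N p(1)] E_pow_D[OF stable_I p(2)] unfolding W_def by blast
  qed
  moreover have "W \<noteq> I"
  proof -
    have "(E (- i) ^^ 1) singular_vec \<in> I" using lin_subspace_0[OF lin_subspace_monom_span] by (simp add: E_singular_vec)
    then have "singular_vec \<in> W" using singular_vec_N unfolding W_def by blast
    then show ?thesis using singular_vec_I by blast
  qed
  moreover have "W \<noteq> N"
  proof -
    \<comment> \<open>Large enough for both assumptions of \<open>E_not_nilpotent\<close>.\<close>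
    define r where "r = 1 + \<bar>z\<bar>"
    have r: "r > 0" "r + z \<ge> 0" by (auto simp: r_def)
    have "(E (- i) ^^ n) (x_pow i (- r) * Y0) \<notin> I" for n
    proof -
      obtain c where c: "c \<noteq> 0" "(E (- i) ^^ n) (x_pow i (- r) * Y0) = const c * (x_pow i (- r - int n) * Y0)"
        using E_not_nilpotent[OF r] by blast
      have "x_pow i (- r - int n) * Y0 \<notin> I"
        unfolding x_pow_Y0 using x_pow_Y0_exps_M[of "- r - int n"] r by (simp add: monom_in_monom_span)
      then show ?thesis unfolding c(2) using lin_subspace_const_iff[OF lin_subspace_monom_span c(1)] by blast
    qed
    then have "x_pow i (- r) * Y0 \<notin> W" by (auto simp: W_def)
    moreover have "x_pow i (- r) * Y0 \<in> N" using QX_x_pow_N[OF QX.Y0] .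
    ultimately show ?thesis by blast
  qed
  ultimately show ?thesis unfolding irreducible_iff by blast
qed

end

section \<open>The theorem\<close>

lemma laurent_polys_eq_monom_span:
  "laurent_polys A B = monom_span {\<nu>. \<forall>v. lk \<nu> v \<noteq> 0 \<longrightarrow> v \<in> B \<or> v \<in> A \<and> 0 \<le> lk \<nu> v}"
  by (auto simp: laurent_polys_def monom_span_def)

lemma monom_span_plus: "monom_span A + monom_span B = monom_span (A \<union> B)"
proof
  show "monom_span A + monom_span B \<subseteq> monom_span (A \<union> B)"
    using monom_span_mono[of A "A \<union> B"] monom_span_mono[of B "A \<union> B"]
    by (auto elim!: set_plus_elim intro!: lin_subspace_add[OF lin_subspace_monom_span])
  show "monom_span (A \<union> B) \<subseteq> monom_span A + monom_span B"
  proof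
    fix p assume p: "p \<in> monom_span (A \<union> B)"
    have "restrict_to A p \<in> monom_span A" "p - restrict_to A p \<in> monom_span B"
      using p by (auto simp: monom_span_lookup lookup_restrict_to lookup_minus split: if_splits)
    then have "restrict_to A p + (p - restrict_to A p) \<in> monom_span A + monom_span B" by (rule set_plus_intro)
    then show "p \<in> monom_span A + monom_span B" by simp
  qed
qed

lemma monom_span_sum: "finite S \<Longrightarrow> (\<Sum>k\<in>S. monom_span (A k)) = monom_span (\<Union>k\<in>S. A k)"
proof (induction rule: finite_induct)
  case empty
  then show ?case by (auto simp: monom_span_def set_zero keys_eq_empty)
next
  case (insert k S)
  then show ?case by (simp add: monom_span_plus)
qed

lemma free_field_1: "free_field 1 K" by unfold_locales simp
lemma free_field_0: "free_field 0 0" by unfold_locales simp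

lemma rep_Phi: "free_field.rep 1 K J = Phi K J"
proof -
  interpret free_field 1 K J by (rule free_field_1)
  have "E n p = e_op K J n p" for n p
    \<comment> \<open>In \<open>Ek\<close> the derivative by \<open>y_m\<close> acts before the one
      by \<open>x\<close>; in \<open>e_op\<close> the order is reversed.\<close>
    unfolding E_def e_op_def De_def diff_sum_def deriv_x_def Ey_def Ek_def
    by (simp add: add.assoc pdiff_commute[of "Yv _" "Xv _"])
  moreover have "H n p = h_op K J n p" for n p
    unfolding H_def h_op_def deriv_x_def diff_sum_def by simp
  moreover have "D p = d_op p" for p
    unfolding D_def d_op_def Dx_def Dy_def diff_sum_def by simp
  ultimately have "E = e_op K J" "H = h_op K J" "D = d_op" by (simp_all add: fun_eq_iff)
  then show ?thesis by (simp add: rep_def Phi_def)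
qed

lemma rep_Phi': "free_field.rep 0 0 J = Phi' J"
proof -
  interpret free_field 0 0 J by (rule free_field_0)
  have "E n p = e_op' J n p" for n p
    unfolding E_def e_op'_def De_def diff_sum_def deriv_x_def Ey_def Ek_def by (simp add: add.assoc)
  moreover have "H n p = h_op' J n p" for n p
    unfolding H_def h_op'_def deriv_x_def diff_sum_def by simp
  moreover have "D p = d_op' p" for p
    unfolding D_def d_op'_def Dx_def diff_sum_def by simp
  ultimately have "E = e_op' J" "H = h_op' J" "D = d_op'" by (simp_all add: fun_eq_iff)
  then show ?thesis by (simp add: rep_def Phi'_def)
qed

section \<open>The given spaces of Laurent polynomials as monomial spans\<close>

context laurent_space
begin

lemma laurent_polys_eq_N:
  assumes "A \<union> P = V"
  shows "laurent_polys A P = N"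
  unfolding laurent_polys_eq_monom_span exps_N_def
proof (intro arg_cong[where f = monom_span] Collect_cong iff_allI)
  fix \<nu> :: "var \<Rightarrow>\<^sub>0 int" and v
  have "v \<in> V \<longleftrightarrow> v \<in> A \<or> v \<in> P" using assms by blast
  then show "(lk \<nu> v \<noteq> 0 \<longrightarrow> v \<in> P \<or> v \<in> A \<and> 0 \<le> lk \<nu> v)
      \<longleftrightarrow> (lk \<nu> v \<noteq> 0 \<longrightarrow> v \<in> V) \<and> (lk \<nu> v < 0 \<longrightarrow> v \<in> P)"
    by auto
qed

text \<open>Withdrawing \<open>w\<close> from the invertible variables only bounds its exponent
  below by zero; each summand of \<open>I_S\<close> and \<open>I_iS\<close> has this form.\<close>

lemma laurent_polys_nonneg_eq:
  assumes w: "w \<in> P" "w \<in> A" and A: "A \<union> (P - {w}) = V"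
  shows "laurent_polys A (P - {w}) = monom_span {\<nu> \<in> exps_N. 0 \<le> lk \<nu> w}"
  unfolding laurent_polys_eq_monom_span
proof (intro arg_cong[where f = monom_span] Collect_cong iffI)
  have V: "v \<in> V \<longleftrightarrow> v \<in> A \<or> v \<in> P \<and> v \<noteq> w" for v using A by blast
  fix \<nu> :: "var \<Rightarrow>\<^sub>0 int"
  assume l: "\<forall>v. lk \<nu> v \<noteq> 0 \<longrightarrow> v \<in> P - {w} \<or> v \<in> A \<and> 0 \<le> lk \<nu> v"
  have "0 \<le> lk \<nu> w" using spec[OF l, of w] by (cases "lk \<nu> w = 0") auto
  moreover have "v \<in> V" if "lk \<nu> v \<noteq> 0" for v using l that V by blast
  moreover have "v \<in> P" if "lk \<nu> v < 0" for v using spec[OF l, of v] that by auto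
  ultimately show "\<nu> \<in> exps_N \<and> 0 \<le> lk \<nu> w" by (simp add: exps_N_def)
next
  fix \<nu> :: "var \<Rightarrow>\<^sub>0 int"
  assume r: "\<nu> \<in> exps_N \<and> 0 \<le> lk \<nu> w"
  show "\<forall>v. lk \<nu> v \<noteq> 0 \<longrightarrow> v \<in> P - {w} \<or> v \<in> A \<and> 0 \<le> lk \<nu> v"
  proof (intro allI impI)
    fix v assume "lk \<nu> v \<noteq> 0"
    then have "v \<in> A \<union> (P - {w})" using exps_N_D(1) r A by blast
    moreover have "0 \<le> lk \<nu> v" if "v \<notin> P - {w}"
      using that r exps_N_D(2)[of \<nu> v] by (cases "v = w") force+
    ultimately show "v \<in> P - {w} \<or> v \<in> A \<and> 0 \<le> lk \<nu> v" by blast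
  qed
qed

text \<open>The union over \<open>w\<close> matches the sums of subspaces that define
  \<open>I_S\<close> and \<open>I_iS\<close>.\<close>

lemma I_eq: "I = monom_span (\<Union>w\<in>P. {\<nu> \<in> exps_N. 0 \<le> lk \<nu> w})"
  by (intro arg_cong[where f = monom_span] Set.set_eqI) (unfold exps_N_exps_M_iff, blast)

end

lemma pos_of_not_mem_0: "0 \<notin> S \<Longrightarrow> S \<subseteq> {0 :: nat<..}"
  by (metis greaterThan_iff neq0_conv subsetI)

lemma ys_pos: "0 \<notin> S \<Longrightarrow> ys S \<subseteq> {Yv k |k. k > 0}"
  using pos_of_not_mem_0[of S] by blast

lemma M_S_irreducible:
  assumes S: "finite S" "0 \<notin> S" and K: "K \<noteq> 0"
  shows "irreducible_lie_module CC affine_sl2 (M_S K J S)"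
proof -
  interpret laurent_space 1 K J "ys S"
    by unfold_locales (use S ys_pos[OF S(2)] in auto)
  have V: "V = xs \<union> Yv ` {0<..}" by (auto simp: V_def)
  have S0: "S \<subseteq> {0<..}" using S(2) by (rule pos_of_not_mem_0)
  have "N_S S = N"
    unfolding N_S_def by (rule laurent_polys_eq_N) (use S0 in \<open>auto simp: V\<close>)
  moreover have "I_S S = I"
  proof -
    have "laurent_polys (xs \<union> ys_hat (S - {k})) (ys (S - {k})) = monom_span {\<nu> \<in> exps_N. 0 \<le> lk \<nu> (Yv k)}" if "k \<in> S" for k
    proof -
      have "ys (S - {k}) = ys S - {Yv k}" by auto
      moreover have "xs \<union> ys_hat (S - {k}) \<union> (ys S - {Yv k}) = V"
        unfolding V using that S0 by auto
      moreover have "Yv k \<in> ys S" "Yv k \<in> xs \<union> ys_hat (S - {k})"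
        using that S0 by auto
      ultimately show ?thesis using laurent_polys_nonneg_eq by simp
    qed
    then have "I_S S = (\<Sum>k\<in>S. monom_span {\<nu> \<in> exps_N. 0 \<le> lk \<nu> (Yv k)})"
      unfolding I_S_def by (rule sum.cong[OF refl])
    then show ?thesis unfolding I_eq monom_span_sum[OF S(1)] by simp
  qed
  ultimately have M: "M_S K J S = lie_quotient (laurent_module N rep) I"
    by (simp add: M_S_def rep_Phi)
  have "ys S \<inter> xs = {}" by auto
  then show ?thesis unfolding M irreducible_iff using irreducible_no_X[OF K] by blast
qed

lemma M_iS_irreducible_iff:
  assumes S: "finite S" "0 \<notin> S" and K: "K \<noteq> 0"
  shows "irreducible_lie_module CC affine_sl2 (M_iS K J i S) \<longleftrightarrow> J - of_int i * K \<notin> \<int>"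
proof -
  interpret laurent_space 1 K J "{Xv i} \<union> ys S"
    by unfold_locales (use S ys_pos[OF S(2)] in auto)
  have V: "V = xs \<union> Yv ` {0<..}" by (auto simp: V_def)
  have S0: "S \<subseteq> {0<..}" using S(2) by (rule pos_of_not_mem_0)
  have xV: "xs_hat i \<union> {Xv i} = xs" by auto
  have "N_iS i S = N"
    unfolding N_iS_def by (rule laurent_polys_eq_N) (unfold V xV[symmetric], use S0 in blast)
  moreover have "I_iS i S = I"
  proof -
    have "laurent_polys (xs_hat i \<union> ys_hat (S - {k})) ({Xv i} \<union> ys (S - {k})) = monom_span {\<nu> \<in> exps_N. 0 \<le> lk \<nu> (Yv k)}"
      if k: "k \<in> S" for k
    proof -
      have "{Xv i} \<union> ys (S - {k}) = {Xv i} \<union> ys S - {Yv k}" by auto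
      moreover have "xs_hat i \<union> ys_hat (S - {k}) \<union> ({Xv i} \<union> ys S - {Yv k}) = V"
        unfolding V xV[symmetric] using k S0 by blast
      moreover have "Yv k \<in> {Xv i} \<union> ys S" "Yv k \<in> xs_hat i \<union> ys_hat (S - {k})"
        using k S0 by auto
      ultimately show ?thesis using laurent_polys_nonneg_eq by simp
    qed
    then have "(\<Sum>k\<in>S. laurent_polys (xs_hat i \<union> ys_hat (S - {k})) ({Xv i} \<union> ys (S - {k})))
        = (\<Sum>k\<in>S. monom_span {\<nu> \<in> exps_N. 0 \<le> lk \<nu> (Yv k)})"
      by (rule sum.cong[OF refl])
    \<comment> \<open>The summand belonging to the polar variable \<open>x_i\<close>.\<close>
    moreover have "laurent_polys (xs \<union> ys_hat S) (ys S) = monom_span {\<nu> \<in> exps_N. 0 \<le> lk \<nu> (Xv i)}"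
    proof -
      have e: "{Xv i} \<union> ys S - {Xv i} = ys S" by auto
      have "xs \<union> ys_hat S \<union> ys S = V" unfolding V using S0 by auto
      then show ?thesis using laurent_polys_nonneg_eq[of "Xv i" "xs \<union> ys_hat S"] unfolding e by simp
    qed
    ultimately show ?thesis
      unfolding I_iS_def I_eq monom_span_sum[OF S(1)] by (simp add: monom_span_plus)
  qed
  ultimately have M: "M_iS K J i S = lie_quotient (laurent_module N rep) I"
    by (simp add: M_iS_def rep_Phi)
  have PX: "({Xv i} \<union> ys S) \<inter> xs = {Xv i}" by auto
  show ?thesis
  proof (cases "J - of_int i * K \<in> \<int>")
    case True
    then obtain z where "J - of_int i * K = of_int z" by (rule Ints_cases)
    then interpret integral_weight 1 K J "{Xv i} \<union> ys S" i z
      by unfold_locales (use PX in auto)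
    show ?thesis using reducible M True by simp
  next
    case False
    then interpret nonintegral_weight 1 K J "{Xv i} \<union> ys S" i
      by unfold_locales (use PX K in auto)
    show ?thesis unfolding M irreducible_iff using irreducible_polar False by blast
  qed
qed

lemma M_i_irreducible_iff:
  "irreducible_lie_module CC affine_sl2 (M_i J i) \<longleftrightarrow> J \<notin> \<int>"
proof -
  interpret laurent_space 0 0 J "{Xv i}"
    by unfold_locales auto
  have V: "V = xs" by (auto simp: V_def)
  have "laurent_polys (xs_hat i) {Xv i} = N"
    by (rule laurent_polys_eq_N) (auto simp: V)
  moreover have "laurent_polys xs {} = I"
    using laurent_polys_nonneg_eq[of "Xv i" xs] unfolding I_eq by (simp add: V)
  ultimately have M: "M_i J i = lie_quotient (laurent_module N rep) I"
    by (simp add: M_i_def rep_Phi')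
  have PX: "{Xv i} \<inter> xs = {Xv i}" by auto
  show ?thesis
  proof (cases "J \<in> \<int>")
    case True
    then obtain z where "J = of_int z" by (rule Ints_cases)
    then interpret integral_weight 0 0 J "{Xv i}" i z
      by unfold_locales (use PX in auto)
    show ?thesis using reducible M True by simp
  next
    case False
    then interpret nonintegral_weight 0 0 J "{Xv i}" i
      by unfold_locales (use PX in auto)
    show ?thesis unfolding M irreducible_iff using irreducible_polar False by blast
  qed
qed

theorem theorem4p3:
  fixes i :: int and S :: "nat set" and K J :: complex
  assumes "finite S" and "0 \<notin> S"
  shows "(K \<noteq> 0 \<longrightarrow>
            irreducible_lie_module CC affine_sl2 (M_S K J S) \<and>
            (irreducible_lie_module CC affine_sl2 (M_iS K J i S) \<longleftrightarrow> J - of_int i * K \<notin> \<int>)) \<and>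
         (K = 0 \<longrightarrow>
            (irreducible_lie_module CC affine_sl2 (M_i J i) \<longleftrightarrow> J \<notin> \<int>))"
  using M_S_irreducible[OF assms] M_iS_irreducible_iff[OF assms] M_i_irreducible_iff by blast

end
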